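(* Let $F$ be a degree 2 Siegel modular form of weight $k\in\mathbb Z_+$, level $\mathcal N$ and character $\chi$, with Fourier expansion $F(\tau)=\sum_T a(T)\exp(2\pi i\,\mathrm{Tr}(T\tau))$. Let $I$ be the $2\times 2$ identity matrix. Suppose that $p$ is a prime with $F|T(p)=\lambda(p)F$ and $F|\widetilde T_1(p^2)=\widetilde\lambda_1(p^2)F$ for some $\lambda(p),\widetilde\lambda_1(p^2)\in\mathbb C$. In parts (a) and (b), let $m\in\mathbb Z_+$ with $p\nmid m$. (a) We have $$\lambda(p)a(mI)=\chi(p)p^{k-2}\eta(p)a(mI)+a(mpI),$$ where $\eta(p)=1+\chi(-1)(-1)^k$ if $p\equiv 1\pmod 4$, $\eta(p)=0$ if $p\equiv 3\pmod 4$, and $\eta(p)=1$ if $p=2$. (Thus when $a(mI)\neq0$, $\lambda(p)$ is given explicitly in terms of $p$, $a(mI)$ and $a(pmI)$.) As well, $$\chi(p)p^{k-2}\widetilde\lambda_1(p^2)a(mI)=\chi(p^2)p^{2k-4}(\alpha(I;p)-p)a(mI)+\lambda(p)a(pmI)-a(p^2mI),$$ where $\alpha(I;p)=2$ if $p\equiv1\pmod 4$, $\alpha(I;p)=0$ if $p\equiv 3\pmod 4$, and $\alpha(I;p)=1$ if $p=2$. (Thus when $\chi(p)a(mI)\neq0$, $\widetilde\lambda_1(p^2)$ is given explicitly in terms of $p$, $a(mI)$, $a(pmI)$ and $a(p^2mI)$.) (b) Set $\epsilon=1+\chi(-1)(-1)^k$. For $r\ge 1$, $$\begin{aligned}a(mI)a(p^{r+1}I)&=a(pmI)a(p^rI)-\chi(p^2)p^{2k-3}a(mI)a(p^{r-1}I)\\&\quad+\epsilon\chi(p)p^{k-2}a(mI)\,a\begin{pmatrix}p^{r-1}m&0\\0&p^{r+1}m\end{pmatrix}\\&\quad+\epsilon\chi(p)p^{k-2}a(mI)\sum_{\substack{1\le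 u<p/2\\ u^2\not\equiv-1\,(\mathrm{mod}\ p)}}a\left(p^rm\begin{pmatrix}(1+u^2)/p&u\\ u&p\end{pmatrix}\right).\end{aligned}$$ (c) Suppose that $n$ is a product of powers of primes $p$ such that $F$ is an eigenform for $T(p)$ and $\widetilde T_1(p^2)$, and that $m\in\mathbb Z_+$ with $(m,n)=1$. If $a(mI)=0$ then $a(mnI)=0$. Also, $a(I)a(mnI)=a(mI)a(nI)$.
   Context: Let $\mathfrak h_{(2)}=\{X+iY: X,Y\text{ real symmetric }2\times2\text{ matrices}, Y>0\}$. Let $Sp_2(R)$ be the group of $4\times4$ symplectic matrices over $R$, $\mathcal N\in\mathbb Z_+$, $\Gamma=\Gamma_0(\mathcal N)=\{\begin{pmatrix}A&B\\C&D\end{pmatrix}\in Sp_2(\mathbb Z):\mathcal N\mid C\}$ (with $2\times2$ blocks), and $\chi$ a Dirichlet character modulo $\mathcal N$ (so $\chi(p)=0$ for primes $p\mid\mathcal N$). For $\gamma=\begin{pmatrix}A&B\\C&D\end{pmatrix}$ a rational symplectic matrix, or a rational symplectic similitude with positive multiplier, set $$F(\tau)|\gamma=(\det\gamma)^{k/2}\det(C\tau+D)^{-k}F((A\tau+B)(C\tau+D)^{-1}).$$ A degree 2 Siegel modular form of weight $k$, level $\mathcal N$ and character $\chi$ is a holomorphic $F:\mathfrak h_{(2)}\to\mathbb C$ with $F|\gamma=\chi(\det D_\gamma)F$ for all $\gamma\in\Gamma_0(\mathcal N)$, where $D_\gamma$ is the lower right block of $\gamma$; write $\chi(\gamma)=\chi(\det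 D_\gamma)$. Its Fourier expansion runs over $2\times2$ symmetric positive semi-definite half-integral $T$ (entries in $\frac12\mathbb Z$, integer diagonal). For $p$ prime, put $\delta(p)=\mathrm{diag}(p,p,1,1)$ and $\delta_1(p^2)=\mathrm{diag}(p,1,1/p,1)$. The Hecke operators are $$F|T(p)=p^{k-3}\sum_\gamma\overline\chi(\gamma)F|\delta(p)^{-1}\gamma,\qquad F|T_1(p^2)=p^{k-3}\sum_\gamma\overline\chi(\gamma)F|\delta_1(p^2)^{-1}\gamma,$$ where $\gamma$ runs over $(\delta(p)\Gamma\delta(p)^{-1}\cap\Gamma)\backslash\Gamma$, respectively $(\delta_1(p^2)\Gamma\delta_1(p^2)^{-1}\cap\Gamma)\backslash\Gamma$. Finally, $\widetilde T_1(p^2)=T_1(p^2)+\chi(p)p^{k-3}(p+1)$. $F$ is an eigenform for an operator if the operator maps $F$ to a complex multiple of $F$.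
   Formalization: In (b) the two terms with factor ε carry a minus sign instead of plus, and the inconsistent m's are replaced by a second parameter l prime to p: a(mI)a(p^{r+1}lI) = a(pmI)a(p^r lI) - ..., with l in all remaining arguments; as printed the formula fails for the weight 4 Eisenstein series. *)

theory Defs
  imports "HOL-Analysis.Analysis" "HOL-Number_Theory.Cong"
begin

text \<open>A \<open>4 \<times> 4\<close> matrix of \<open>2 \<times> 2\<close> blocks is indexed by the sum type \<open>2 + 2\<close>: \<open>Inl\<close> is the
  first half of the rows or columns, \<open>Inr\<close> the second half.\<close>

type_synonym 'a mat2 = "'a^2^2"
type_synonym 'a mat4 = "'a^(2 + 2)^(2 + 2)"

definition mk2 :: "'a::zero \<Rightarrow> 'a \<Rightarrow> 'a \<Rightarrow> 'a \<Rightarrow> 'a mat2" where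
  "mk2 a b c d = vector [vector [a, b], vector [c, d]]"

definition block :: "'a mat2 \<Rightarrow> 'a mat2 \<Rightarrow> 'a mat2 \<Rightarrow> 'a mat2 \<Rightarrow> 'a mat4" where
  "block A B C D = (\<chi> i j. case i of
      Inl s \<Rightarrow> (case j of Inl t \<Rightarrow> A $ s $ t | Inr t \<Rightarrow> B $ s $ t)
    | Inr s \<Rightarrow> (case j of Inl t \<Rightarrow> C $ s $ t | Inr t \<Rightarrow> D $ s $ t))"

definition blkA :: "'a mat4 \<Rightarrow> 'a mat2" where "blkA M = (\<chi> i j. M $ Inl i $ Inl j)"
definition blkB :: "'a mat4 \<Rightarrow> 'a mat2" where "blkB M = (\<chi> i j. M $ Inl i $ Inr j)"
definition blkC :: "'a mat4 \<Rightarrow> 'a mat2" where "blkC M = (\<chi> i j. M $ Inr i $ Inl j)"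
definition blkD :: "'a mat4 \<Rightarrow> 'a mat2" where "blkD M = (\<chi> i j. M $ Inr i $ Inr j)"

definition cmat :: "real mat2 \<Rightarrow> complex mat2" where
  "cmat M = (\<chi> i j. complex_of_real (M $ i $ j))"

definition siegel2 :: "complex mat2 set" where
  "siegel2 = {\<tau>. transpose \<tau> = \<tau> \<and>
     (\<forall>v::real^2. v \<noteq> 0 \<longrightarrow> v \<bullet> ((\<chi> i j. Im (\<tau> $ i $ j)) *v v) > 0)}"

text \<open>Holomorphy in several variables is complex Frechet differentiability. \<open>siegel2\<close> is open
  in the space of symmetric matrices, whence the derivative within \<open>siegel2\<close>. Only its values on
  symmetric matrices are determined, and a complex linear map on these extends to one on all
  matrices.\<close>

definition holomorphic_siegel2 :: "(complex mat2 \<Rightarrow> complex) \<Rightarrow> bool" where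
  "holomorphic_siegel2 F \<longleftrightarrow> (\<forall>\<tau>\<in>siegel2. \<exists>F'.
     (F has_derivative F') (at \<tau> within siegel2) \<and>
     (\<forall>c v. F' (\<chi> i j. c * v $ i $ j) = c * F' v))"

definition symplectic :: "real mat4 \<Rightarrow> bool" where
  "symplectic M \<longleftrightarrow> transpose M ** block 0 (mat 1) (- mat 1) 0 ** M = block 0 (mat 1) (- mat 1) 0"

definition Gamma0 :: "nat \<Rightarrow> real mat4 set" where
  "Gamma0 N = {M. symplectic M \<and> (\<forall>i j. M $ i $ j \<in> \<int>) \<and>
     (\<forall>i j. \<exists>c::int. blkC M $ i $ j = real N * of_int c)}"

definition dirichlet_character :: "nat \<Rightarrow> (int \<Rightarrow> complex) \<Rightarrow> bool" where
  "dirichlet_character N \<chi>' \<longleftrightarrow>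
     (\<forall>x. \<chi>' (x + int N) = \<chi>' x) \<and> (\<forall>x y. \<chi>' (x * y) = \<chi>' x * \<chi>' y) \<and>
     (\<forall>x. \<chi>' x \<noteq> 0 \<longleftrightarrow> coprime x (int N))"

text \<open>On \<open>Gamma0 N\<close> the determinant of the lower right block is an integer, so the floor only
  converts its type.\<close>

definition char_mat :: "(int \<Rightarrow> complex) \<Rightarrow> real mat4 \<Rightarrow> complex" where
  "char_mat \<chi>' M = \<chi>' \<lfloor>det (blkD M)\<rfloor>"

definition slash :: "nat \<Rightarrow> (complex mat2 \<Rightarrow> complex) \<Rightarrow> real mat4 \<Rightarrow> complex mat2 \<Rightarrow> complex" where
  "slash k F M \<tau> =
     complex_of_real (det M powr (real k / 2)) *
     det (cmat (blkC M) ** \<tau> + cmat (blkD M)) powi (- int k) *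
     F ((cmat (blkA M) ** \<tau> + cmat (blkB M)) ** matrix_inv (cmat (blkC M) ** \<tau> + cmat (blkD M)))"

definition siegel_modular_form ::
  "nat \<Rightarrow> nat \<Rightarrow> (int \<Rightarrow> complex) \<Rightarrow> (complex mat2 \<Rightarrow> complex) \<Rightarrow> bool" where
  "siegel_modular_form k N \<chi>' F \<longleftrightarrow> holomorphic_siegel2 F \<and>
     (\<forall>M\<in>Gamma0 N. \<forall>\<tau>\<in>siegel2. slash k F M \<tau> = char_mat \<chi>' M * F \<tau>)"

definition half_integral_psd :: "real mat2 set" where
  "half_integral_psd = {T. transpose T = T \<and> (\<forall>i j. 2 * T $ i $ j \<in> \<int>) \<and>
     (\<forall>i. T $ i $ i \<in> \<int>) \<and> (\<forall>v. v \<bullet> (T *v v) \<ge> 0)}"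

definition fourier_expansion :: "(complex mat2 \<Rightarrow> complex) \<Rightarrow> (real mat2 \<Rightarrow> complex) \<Rightarrow> bool" where
  "fourier_expansion F a \<longleftrightarrow> (\<forall>\<tau>\<in>siegel2.
     ((\<lambda>T. a T * exp (2 * of_real pi * \<i> * trace (cmat T ** \<tau>))) has_sum F \<tau>) half_integral_psd)"

text \<open>The operator attached to a double coset: the sum over
  \<open>(\<delta> \<Gamma> \<delta>\<inverse> \<inter> \<Gamma>) \<setminus> \<Gamma>\<close>. For a modular form \<open>F\<close> the summand does not depend on the
  representative chosen in a coset.\<close>

definition hecke_cosets :: "nat \<Rightarrow> real mat4 \<Rightarrow> real mat4 set set" where
  "hecke_cosets N \<delta> =
     {(\<lambda>h. h ** \<gamma>) ` ({\<delta> ** g ** matrix_inv \<delta> | g. g \<in> Gamma0 N} \<inter> Gamma0 N) | \<gamma>. \<gamma> \<in> Gamma0 N}"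

definition hecke_sum ::
  "nat \<Rightarrow> nat \<Rightarrow> (int \<Rightarrow> complex) \<Rightarrow> real mat4 \<Rightarrow> (complex mat2 \<Rightarrow> complex) \<Rightarrow> complex mat2 \<Rightarrow> complex" where
  "hecke_sum k N \<chi>' \<delta> F \<tau> = (\<Sum>X\<in>hecke_cosets N \<delta>.
     (let \<gamma> = (SOME \<gamma>. \<gamma> \<in> X) in cnj (char_mat \<chi>' \<gamma>) * slash k F (matrix_inv \<delta> ** \<gamma>) \<tau>))"

definition delta :: "nat \<Rightarrow> real mat4" where
  "delta p = block (mat (real p)) 0 0 (mat 1)"

definition delta1 :: "nat \<Rightarrow> real mat4" where
  "delta1 p = block (mk2 (real p) 0 0 1) 0 0 (mk2 (1 / real p) 0 0 1)"

definition hecke_T ::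
  "nat \<Rightarrow> nat \<Rightarrow> (int \<Rightarrow> complex) \<Rightarrow> nat \<Rightarrow> (complex mat2 \<Rightarrow> complex) \<Rightarrow> complex mat2 \<Rightarrow> complex" where
  "hecke_T k N \<chi>' p F \<tau> = of_nat p powi (int k - 3) * hecke_sum k N \<chi>' (delta p) F \<tau>"

text \<open>The argument \<open>p\<close> of \<open>delta1\<close>, \<open>hecke_T1\<close> and \<open>hecke_T1_tilde\<close> is the prime itself, although
  the operators are usually denoted \<open>T\<^sub>1(p\<^sup>2)\<close>.\<close>

definition hecke_T1 ::
  "nat \<Rightarrow> nat \<Rightarrow> (int \<Rightarrow> complex) \<Rightarrow> nat \<Rightarrow> (complex mat2 \<Rightarrow> complex) \<Rightarrow> complex mat2 \<Rightarrow> complex" where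
  "hecke_T1 k N \<chi>' p F \<tau> = of_nat p powi (int k - 3) * hecke_sum k N \<chi>' (delta1 p) F \<tau>"

definition hecke_T1_tilde ::
  "nat \<Rightarrow> nat \<Rightarrow> (int \<Rightarrow> complex) \<Rightarrow> nat \<Rightarrow> (complex mat2 \<Rightarrow> complex) \<Rightarrow> complex mat2 \<Rightarrow> complex" where
  "hecke_T1_tilde k N \<chi>' p F \<tau> =
     hecke_T1 k N \<chi>' p F \<tau> + \<chi>' (int p) * of_nat p powi (int k - 3) * (of_nat p + 1) * F \<tau>"

definition has_eigenvalue ::
  "((complex mat2 \<Rightarrow> complex) \<Rightarrow> complex mat2 \<Rightarrow> complex) \<Rightarrow> (complex mat2 \<Rightarrow> complex) \<Rightarrow> complex \<Rightarrow> bool" where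
  "has_eigenvalue H F c \<longleftrightarrow> (\<forall>\<tau>\<in>siegel2. H F \<tau> = c * F \<tau>)"

definition eps :: "nat \<Rightarrow> (int \<Rightarrow> complex) \<Rightarrow> complex" where
  "eps k \<chi>' = 1 + \<chi>' (-1) * (-1) ^ k"

definition eta :: "nat \<Rightarrow> (int \<Rightarrow> complex) \<Rightarrow> nat \<Rightarrow> complex" where
  "eta k \<chi>' p = (if p = 2 then 1 else if [p = 1] (mod 4) then 1 + \<chi>' (-1) * (-1) ^ k else 0)"

definition alphaI :: "nat \<Rightarrow> complex" where
  "alphaI p = (if p = 2 then 1 else if [p = 1] (mod 4) then 2 else 0)"

definition scalarI :: "nat \<Rightarrow> real mat2" where
  "scalarI m = mat (real m)"

text \<open>A pitfall in the recursion for the coefficients at \<open>p\<^sup>r\<^sup>+\<^sup>1 I\<close>: comparing coefficients at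
  \<open>p\<^sup>r l I\<close> in the eigenvalue equation of \<open>T(p)\<close> and multiplying by \<open>a (m I)\<close> makes both terms with
  factor \<open>\<epsilon> \<chi>(p) p\<^sup>k\<^sup>-\<^sup>2\<close> enter with a minus sign, and ties the argument \<open>p\<^sup>r\<^sup>+\<^sup>1 l I\<close> on the left
  to the arguments with \<open>l\<close> on the right. The formula is also found in print with plus signs, and
  with \<open>l = 1\<close> in some terms and \<open>l = m\<close> in others. With plus signs it fails for the Eisenstein
  series of weight 4 and level 1, \<open>p = 2\<close>, \<open>r = m = l = 1\<close>: scaled to \<open>a (I) = 1\<close> this has
  \<open>a (2 I) = 41\<close>, \<open>a (4 I) = 1385\<close> and \<open>a (diag (1, 4)) = 33\<close>, and
  \<open>1385 = 41 * 41 - 32 - 8 * 33\<close>.\<close>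

end

theory Submission
  imports Defs "HOL-Number_Theory.Number_Theory"
begin

text \<open>Explicit coset representatives \<open>\<delta>\<inverse> \<gamma> = g M\<close> with \<open>g\<close> in \<open>Gamma0 N\<close> and \<open>M\<close> block upper triangular turn the Hecke
  operators into finite sums of substitutions \<open>\<tau> \<mapsto> c A (\<tau> + S) A\<^sup>T\<close>, so Fourier coefficients can be compared. With
  \<open>C n\<close> the coefficient at \<open>n I\<close>, \<open>x = \<chi>(p) p\<^sup>k\<^sup>-\<^sup>2\<close> and \<open>W n\<close> the sum of the coefficients of \<open>n I\<close> restricted to the
  \<open>p + 1\<close> sublattices of index \<open>p\<close>, the eigenvalue equations read
  \<open>\<lambda> C n = C (p n) + x W (n / p) + p x\<^sup>2 C (n / p)\<close> and, for \<open>p\<close> not dividing the level,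
  \<open>\<lambda>\<^sub>1 C n = W n + x \<alpha> C n + p x\<^sup>2 W (n / p\<^sup>2)\<close>, where \<open>\<alpha>\<close> counts isotropic lines. Since every integral form of
  determinant one is equivalent to \<open>I\<close>, \<open>W (l / p)\<close> is a multiple of \<open>C l\<close> for \<open>l\<close> prime to \<open>p\<close>. The first two parts
  follow at once, and eliminating \<open>W\<close> gives a recursion making \<open>C (p\<^sup>e l) / C l\<close> independent of \<open>l\<close>. If \<open>p\<close> divides the
  level, \<open>x = 0\<close> and the first equation suffices. If \<open>\<chi>(-1) (-1)\<^sup>k = -1\<close>, then all \<open>C n\<close> vanish.\<close>

section \<open>Uniqueness of absolutely convergent trigonometric series\<close>

text \<open>The recursion in \<open>r\<close> needs \<open>T(p)\<close> only. Multiplying the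
  relation at \<open>p n\<close> by \<open>C m\<close> and replacing \<open>\<lambda> C m\<close>
  through the relation at \<open>m\<close> makes the isotropic terms cancel: they enter
  \<open>W n\<close> as \<open>\<alpha> C (p n)\<close>, and the relation at \<open>m\<close>
  carries the same \<open>x \<alpha>\<close>. The remaining sublattices pair off under
  \<open>u \<mapsto> - u\<close>, which produces the factor 2, the value of \<open>eps\<close> in
  the case that is left. The term \<open>p + 1\<close> in the modified second operator is a count of
  lines as well: exponential sums over the nonzero residues modulo \<open>p\<close> fall short by
  one for each of the \<open>p + 1\<close> lines. Three obstacles shape the rest. The operators pick
  an element of each coset by choice, so the summand must be shown constant on cosets. Coefficients
  are compared by averaging over rational points instead of integrating. And \<open>a\<close> is
  arbitrary off the half-integral semi-definite matrices, whereas the relations mention indices such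
  as \<open>n / p\<close>; hence the extension of \<open>a\<close> by zero.\<close>

lemma sum_cis_roots:
  fixes q :: nat and m :: int
  assumes "q > 0"
  shows "(\<Sum>j<q. cis (2 * pi * of_int m * (real j / real q))) = (if int q dvd m then of_nat q else 0)"
proof -
  define w where "w = cis (2 * pi * of_int m / real q)"
  have pw: "cis (2 * pi * of_int m * (real j / real q)) = w ^ j" for j
    unfolding w_def by (simp add: Complex.DeMoivre mult_ac)
  have w1: "w ^ q = 1"
    unfolding w_def Complex.DeMoivre using assms cis_multiple_2pi [of "of_int m"] by (simp add: mult_ac)
  have "w = 1 \<longleftrightarrow> int q dvd m"
  proof
    assume "w = 1"
    then have "cos (2 * pi * of_int m / real q) = 1"
      by (metis w_def cis.simps(1) one_complex.simps(1))
    then obtain n :: int where "2 * pi * of_int m / real q = of_int n * 2 * pi"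
      unfolding cos_one_2pi_int by auto
    then have "of_int m = (of_int (n * int q) :: real)"
      using assms by (simp add: field_simps)
    then have "m = n * int q"
      by linarith
    then show "int q dvd m" by simp
  next
    assume "int q dvd m"
    then obtain n where "m = int q * n" by auto
    then have "w = cis (2 * pi * of_int n)"
      unfolding w_def using assms by (simp add: field_simps)
    then show "w = 1" by (simp add: cis_multiple_2pi Ints_of_int)
  qed
  then show ?thesis
    unfolding pw using w1 by (cases "w = 1") (auto simp: sum_gp_strict)
qed

lemma has_sum_sum_finite:
  fixes f :: "'j \<Rightarrow> 'i \<Rightarrow> 'a::{topological_comm_monoid_add}"
  assumes "\<And>j. j \<in> J \<Longrightarrow> (f j has_sum s j) A"
  shows "((\<lambda>i. \<Sum>j\<in>J. f j i) has_sum (\<Sum>j\<in>J. s j)) A"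
  using assms by (induction J rule: infinite_finite_induct) (auto intro!: has_sum_add)

text \<open>Averaging over the \<open>q\<close> points \<open>x = j / q\<close> isolates the
  frequencies congruent to \<open>n\<close> modulo \<open>q\<close>. For large \<open>q\<close> all
  of these except \<open>n\<close> itself lie in the tail of an absolutely convergent sum, so finite
  averages do the work of an integral over a period.\<close>

lemma infsum_frequency_zero:
  fixes f :: "'i \<Rightarrow> complex" and \<phi> :: "'i \<Rightarrow> int"
  assumes sf: "f summable_on I"
    and zero: "\<And>x::real. (\<Sum>\<^sub>\<infinity>i\<in>I. f i * cis (2 * pi * of_int (\<phi> i) * x)) = 0"
  shows "infsum f {i\<in>I. \<phi> i = n} = 0"
proof -
  have abs: "(\<lambda>i. norm (f i)) summable_on I"
    using sf summable_on_iff_abs_summable_on_complex by blast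
  have sfx: "(\<lambda>i. f i * cis (2 * pi * of_int (\<phi> i - n) * x)) summable_on I" for x :: real
    by (rule abs_summable_summable) (simp add: norm_mult abs)
  have zero': "(\<Sum>\<^sub>\<infinity>i\<in>I. f i * cis (2 * pi * of_int (\<phi> i - n) * x)) = 0" for x :: real
  proof -
    have "cis (2 * pi * of_int (\<phi> i - n) * x)
        = cis (- 2 * pi * of_int n * x) * cis (2 * pi * of_int (\<phi> i) * x)" for i
      unfolding cis_mult by (rule arg_cong [where f = cis]) (simp add: algebra_simps)
    then have "f i * cis (2 * pi * of_int (\<phi> i - n) * x)
        = cis (- 2 * pi * of_int n * x) * (f i * cis (2 * pi * of_int (\<phi> i) * x))" for i
      by (simp only: mult.left_commute)
    then have "(\<Sum>\<^sub>\<infinity>i\<in>I. f i * cis (2 * pi * of_int (\<phi> i - n) * x))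
        = cis (- 2 * pi * of_int n * x) * (\<Sum>\<^sub>\<infinity>i\<in>I. f i * cis (2 * pi * of_int (\<phi> i) * x))"
      by (simp only: infsum_cmult_right')
    then show ?thesis using zero by simp
  qed
  have res: "infsum f {i\<in>I. int q dvd \<phi> i - n} = 0" if q: "q > 0" for q :: nat
  proof -
    have "0 = (\<Sum>j<q. \<Sum>\<^sub>\<infinity>i\<in>I. f i * cis (2 * pi * of_int (\<phi> i - n) * (real j / real q)))"
      by (simp only: zero' sum.neutral_const)
    also have "\<dots> = (\<Sum>\<^sub>\<infinity>i\<in>I. \<Sum>j<q. f i * cis (2 * pi * of_int (\<phi> i - n) * (real j / real q)))"
      by (rule infsumI [symmetric], rule has_sum_sum_finite, rule has_sum_infsum, rule sfx)
    also have "\<dots> = (\<Sum>\<^sub>\<infinity>i\<in>I. of_nat q * (if int q dvd \<phi> i - n then f i else 0))"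
    proof (rule infsum_cong)
      fix i
      have "(\<Sum>j<q. f i * cis (2 * pi * of_int (\<phi> i - n) * (real j / real q)))
          = f i * (if int q dvd \<phi> i - n then of_nat q else 0)"
        unfolding sum_distrib_left [symmetric] sum_cis_roots [OF q] ..
      then show "(\<Sum>j<q. f i * cis (2 * pi * of_int (\<phi> i - n) * (real j / real q)))
          = of_nat q * (if int q dvd \<phi> i - n then f i else 0)"
        by (cases "int q dvd \<phi> i - n") (simp_all only: if_True if_False mult_zero_right mult_zero_left mult.commute)
    qed
    also have "\<dots> = of_nat q * (\<Sum>\<^sub>\<infinity>i\<in>I. if int q dvd \<phi> i - n then f i else 0)"
      by (rule infsum_cmult_right')
    also have "(\<Sum>\<^sub>\<infinity>i\<in>I. if int q dvd \<phi> i - n then f i else 0) = infsum f {i\<in>I. int q dvd \<phi> i - n}"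
      by (rule infsum_cong_neutral) auto
    finally show ?thesis using q by simp
  qed
  have "norm (infsum f {i\<in>I. \<phi> i = n}) \<le> e" if e: "e > 0" for e :: real
  proof -
    obtain S where S: "finite S" "S \<subseteq> I"
      and Se: "dist (\<Sum>i\<in>S. norm (f i)) (\<Sum>\<^sub>\<infinity>i\<in>I. norm (f i)) \<le> e"
      using infsum_finite_approximation [OF abs e] by blast
    \<comment> \<open>\<open>q\<close> exceeds every deviation from \<open>n\<close> on the finite
      set \<open>S\<close>, so an index of \<open>S\<close> in the residue class of \<open>n\<close>
      has frequency exactly \<open>n\<close>.\<close>
    define q where "q = Suc (\<Sum>i\<in>S. nat \<bar>\<phi> i - n\<bar>)"
    define R where "R = {i\<in>I. int q dvd \<phi> i - n \<and> \<phi> i \<noteq> n}"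
    have RS: "R \<subseteq> I - S"
    proof
      fix i assume i: "i \<in> R"
      have "i \<notin> S"
      proof
        assume "i \<in> S"
        then have "nat \<bar>\<phi> i - n\<bar> \<le> (\<Sum>i\<in>S. nat \<bar>\<phi> i - n\<bar>)"
          by (intro member_le_sum) (use S in auto)
        then have "nat \<bar>\<phi> i - n\<bar> < q" by (simp add: q_def)
        moreover have "int q \<le> \<bar>\<phi> i - n\<bar>"
          using i by (intro zdvd_imp_le) (auto simp: R_def)
        ultimately show False by linarith
      qed
      then show "i \<in> I - S" using i by (auto simp: R_def)
    qed
    have sI: "f summable_on A" if "A \<subseteq> I" for A
      using sf that summable_on_subset_banach by blast
    have aI: "(\<lambda>i. norm (f i)) summable_on A" if "A \<subseteq> I" for A
      using abs that summable_on_subset_banach by blast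
    have "infsum f ({i\<in>I. \<phi> i = n} \<union> R) = infsum f {i\<in>I. \<phi> i = n} + infsum f R"
      by (intro infsum_Un_disjoint sI) (auto simp: R_def)
    moreover have "{i\<in>I. \<phi> i = n} \<union> R = {i\<in>I. int q dvd \<phi> i - n}"
      by (auto simp: R_def)
    ultimately have "infsum f {i\<in>I. \<phi> i = n} = - infsum f R"
      using res [of q] by (simp add: q_def add_eq_0_iff2)
    then have "norm (infsum f {i\<in>I. \<phi> i = n}) = norm (infsum f R)" by simp
    also have "\<dots> \<le> (\<Sum>\<^sub>\<infinity>i\<in>R. norm (f i))"
      by (rule norm_infsum_bound) (use RS in \<open>auto intro!: aI\<close>)
    also have "\<dots> \<le> (\<Sum>\<^sub>\<infinity>i\<in>I - S. norm (f i))"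
      by (rule infsum_mono2) (use RS in \<open>auto intro!: aI\<close>)
    also have "\<dots> = (\<Sum>\<^sub>\<infinity>i\<in>I. norm (f i)) - (\<Sum>\<^sub>\<infinity>i\<in>S. norm (f i))"
      by (rule infsum_Diff) (use S abs in \<open>auto intro!: aI\<close>)
    also have "\<dots> \<le> e" using Se S by (simp add: dist_real_def)
    finally show ?thesis .
  qed
  then have "norm (infsum f {i\<in>I. \<phi> i = n}) \<le> 0"
    using field_le_epsilon [of "norm (infsum f {i\<in>I. \<phi> i = n})" 0] by (metis add_0)
  then show ?thesis by simp
qed

section \<open>Block matrices\<close>

lemma mk2_nth [simp]:
  "mk2 a b c d $ 1 $ 1 = a" "mk2 a b c d $ 1 $ 2 = b"
  "mk2 a b c d $ 2 $ 1 = c" "mk2 a b c d $ 2 $ 2 = d"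
  by (simp_all add: mk2_def)

lemma mat2_eq_iff:
  fixes A B :: "'a mat2"
  shows "A = B \<longleftrightarrow> A$1$1 = B$1$1 \<and> A$1$2 = B$1$2 \<and> A$2$1 = B$2$1 \<and> A$2$2 = B$2$2"
  by (auto simp: vec_eq_iff forall_2)

lemma mk2_eq_iff [simp]: "mk2 a b c d = mk2 a' b' c' d' \<longleftrightarrow> a = a' \<and> b = b' \<and> c = c' \<and> d = d'"
  by (auto simp: mat2_eq_iff)

lemma mk2_mult: "mk2 a b c d ** mk2 a' b' c' d' =
    mk2 (a * a' + b * c') (a * b' + b * d') (c * a' + d * c') (c * b' + d * (d' :: 'a::semiring_1))"
  by (simp add: mat2_eq_iff matrix_matrix_mult_def sum_2)

lemma mk2_add: "mk2 a b c d + mk2 a' b' c' d' = mk2 (a + a') (b + b') (c + c') (d + (d'::'a::monoid_add))"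
  by (simp add: mat2_eq_iff)

lemma mk2_diff: "mk2 a b c d - mk2 a' b' c' d' = mk2 (a - a') (b - b') (c - c') (d - (d'::'a::group_add))"
  by (simp add: mat2_eq_iff)

lemma mk2_uminus: "- mk2 a b c d = mk2 (- a) (- b) (- c) (- (d::'a::group_add))"
  by (simp add: mat2_eq_iff)

lemma mk2_scaleR: "x *\<^sub>R mk2 a b c d = mk2 (x *\<^sub>R a) (x *\<^sub>R b) (x *\<^sub>R c) (x *\<^sub>R (d::'a::real_vector))"
  by (simp add: mat2_eq_iff)

lemma transpose_mk2: "transpose (mk2 a b c d) = mk2 a c b d"
  by (simp add: mat2_eq_iff transpose_def)

lemma det_mk2: "det (mk2 a b c d) = a * d - b * (c :: 'a::comm_ring_1)"
  by (simp add: det_2)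

lemma mat_mk2: "mat x = mk2 x 0 0 x"
  by (simp add: mat2_eq_iff mat_def)

lemma zero_mk2: "0 = mk2 0 0 0 (0::'a::zero)"
  by (simp add: mat2_eq_iff)

lemma trace_mk2: "trace (mk2 a b c d) = a + (d :: 'a::semiring_1)"
  by (simp add: trace_def sum_2)

lemma cmat_mk2: "cmat (mk2 a b c d) = mk2 (of_real a) (of_real b) (of_real c) (of_real d)"
  by (simp add: mat2_eq_iff cmat_def)

lemmas mk2_simps = mk2_mult mk2_add mk2_diff mk2_uminus mk2_scaleR transpose_mk2 det_mk2 trace_mk2

lemma cmat_mult: "cmat (A ** B) = cmat A ** cmat B"
  by (simp add: mat2_eq_iff cmat_def matrix_matrix_mult_def sum_2)

lemma cmat_add: "cmat (A + B) = cmat A + cmat B"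
  by (simp add: mat2_eq_iff cmat_def)

lemma cmat_mat: "cmat (mat x) = mat (of_real x)"
  by (simp add: mat_mk2 cmat_mk2)

lemma cmat_0 [simp]: "cmat 0 = 0"
  by (simp add: mat2_eq_iff cmat_def)

lemma det_cmat: "det (cmat A) = of_real (det A)"
  by (simp add: det_2 cmat_def)

lemma block_nth [simp]:
  "block A B C D $ Inl i $ Inl j = A $ i $ j" "block A B C D $ Inl i $ Inr j = B $ i $ j"
  "block A B C D $ Inr i $ Inl j = C $ i $ j" "block A B C D $ Inr i $ Inr j = D $ i $ j"
  by (simp_all add: block_def)

lemma blk_block [simp]:
  "blkA (block A B C D) = A" "blkB (block A B C D) = B"
  "blkC (block A B C D) = C" "blkD (block A B C D) = D"
  by (simp_all add: blkA_def blkB_def blkC_def blkD_def vec_eq_iff)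

lemma mat4_eq_iff: "(M :: 'a mat4) = M' \<longleftrightarrow>
    (\<forall>i j. M $ Inl i $ Inl j = M' $ Inl i $ Inl j) \<and> (\<forall>i j. M $ Inl i $ Inr j = M' $ Inl i $ Inr j) \<and>
    (\<forall>i j. M $ Inr i $ Inl j = M' $ Inr i $ Inl j) \<and> (\<forall>i j. M $ Inr i $ Inr j = M' $ Inr i $ Inr j)"
  unfolding vec_eq_iff by (metis sum.exhaust)

lemma block_blk: "block (blkA M) (blkB M) (blkC M) (blkD M) = M"
  by (simp add: mat4_eq_iff blkA_def blkB_def blkC_def blkD_def)

lemma block_eq_iff [simp]:
  "block A B C D = block A' B' C' D' \<longleftrightarrow> A = A' \<and> B = B' \<and> C = C' \<and> D = D'"
  by (metis blk_block)

lemma block_mult: "block A B C D ** block A' B' C' D' =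
    block (A ** A' + B ** C') (A ** B' + B ** D') (C ** A' + D ** C') (C ** B' + D ** (D' :: 'a::semiring_1 mat2))"
  by (simp add: mat4_eq_iff matrix_matrix_mult_def UNIV_Plus_UNIV [symmetric] sum.Plus del: UNIV_Plus_UNIV)

lemma block_transpose: "transpose (block A B C D) = block (transpose A) (transpose C) (transpose B) (transpose D)"
  by (simp add: mat4_eq_iff transpose_def)

lemma mat_block: "mat x = block (mat x) 0 0 (mat x)"
  by (simp add: mat4_eq_iff mat_def)

lemma block_all: "(\<forall>i j. P (block A B C D $ i $ j)) \<longleftrightarrow>
    (\<forall>i j. P (A $ i $ j)) \<and> (\<forall>i j. P (B $ i $ j)) \<and> (\<forall>i j. P (C $ i $ j)) \<and> (\<forall>i j. P (D $ i $ j))"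
  by (metis block_nth sum.exhaust)

section \<open>Symplectic matrices and the slash operator\<close>

definition symJ :: "real mat4" where
  "symJ = block 0 (mat 1) (- mat 1) 0"

text \<open>The inverse of a symplectic matrix in closed form. Integrality and divisibility of the
  lower left block by \<open>N\<close> are visibly preserved.\<close>

definition sp_inv :: "real mat4 \<Rightarrow> real mat4" where
  "sp_inv M = block (transpose (blkD M)) (- transpose (blkB M)) (- transpose (blkC M)) (transpose (blkA M))"

lemma symplectic_symJ: "symplectic M \<longleftrightarrow> transpose M ** symJ ** M = symJ"
  by (simp add: symplectic_def symJ_def)

lemma matrix_minus_left: "(- A) ** B = - (A ** (B :: real^'n^'m))"
  by (simp add: matrix_matrix_mult_def vec_eq_iff sum_negf)

lemma matrix_minus_right: "A ** (- B) = - (A ** (B :: real^'n^'m))"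
  by (simp add: matrix_matrix_mult_def vec_eq_iff sum_negf)

lemma transpose_minus: "transpose (- A) = - transpose (A :: real^'n^'m)"
  by (simp add: transpose_def vec_eq_iff)

lemma transpose_zero [simp]: "transpose 0 = 0"
  by (simp add: transpose_def vec_eq_iff)

lemma matrix_mult_zero [simp]:
  "0 ** (A :: 'a::semiring_1^'n^'m) = 0" "(B :: 'a::semiring_1^'n^'m) ** 0 = 0"
  by (simp_all add: matrix_matrix_mult_def vec_eq_iff)

lemma symJ_symJ: "symJ ** symJ = - mat 1"
  by (simp add: symJ_def block_mult matrix_minus_left matrix_minus_right mat_block mat4_eq_iff)

lemma sp_inv_eq: "sp_inv M = - (symJ ** transpose M ** symJ)"
proof -
  have "sp_inv (block A B C D) = - (symJ ** transpose (block A B C D) ** symJ)" for A B C D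
    by (simp add: sp_inv_def symJ_def block_mult block_transpose matrix_minus_left matrix_minus_right mat4_eq_iff)
  then show ?thesis by (metis block_blk)
qed

lemma symplectic_inv_left:
  assumes "symplectic M" shows "sp_inv M ** M = mat 1"
proof -
  have "sp_inv M ** M = - (symJ ** (transpose M ** symJ ** M))"
    by (simp add: sp_inv_eq matrix_minus_left matrix_mul_assoc)
  also have "\<dots> = mat 1"
    using assms by (simp add: symplectic_symJ symJ_symJ)
  finally show ?thesis .
qed

lemma symplectic_inv_right: "symplectic M \<Longrightarrow> M ** sp_inv M = mat 1"
  using matrix_left_right_inverse symplectic_inv_left by blast

lemma symplectic_iff_inv: "symplectic M \<longleftrightarrow> sp_inv M ** M = mat 1"
proof
  assume "sp_inv M ** M = mat 1"
  then have "symJ ** (symJ ** (transpose M ** symJ ** M)) = - symJ"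
    by (simp add: sp_inv_eq matrix_minus_left matrix_mul_assoc)
      (metis (no_types, lifting) matrix_minus_right matrix_mul_assoc matrix_mul_rid minus_minus)
  then show "symplectic M"
    by (simp add: symplectic_symJ matrix_mul_assoc symJ_symJ matrix_minus_left)
qed (rule symplectic_inv_left)

lemma symplectic_mult:
  assumes "symplectic M" "symplectic M'" shows "symplectic (M ** M')"
proof -
  have "transpose (M ** M') ** symJ ** (M ** M') = transpose M' ** (transpose M ** symJ ** M) ** M'"
    by (simp add: matrix_transpose_mul matrix_mul_assoc)
  then show ?thesis using assms by (simp add: symplectic_symJ)
qed

lemma sp_inv_sp_inv: "sp_inv (sp_inv M) = M"
  by (simp add: sp_inv_def transpose_minus block_blk)

lemma symplectic_sp_inv: "symplectic M \<Longrightarrow> symplectic (sp_inv M)"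
  by (simp add: symplectic_iff_inv [of "sp_inv M"] sp_inv_sp_inv symplectic_inv_right)

text \<open>Of the four block equations in \<open>sp_inv M ** M = mat 1\<close> one is the transpose
  of another, which leaves three.\<close>

lemma symplectic_transpose_relation:
  "symplectic (block A B C D) \<longleftrightarrow>
     transpose D ** A - transpose B ** C = mat 1 \<and> transpose D ** B = transpose B ** D \<and>
     transpose A ** C = transpose C ** A"
proof -
  have "symplectic (block A B C D) \<longleftrightarrow>
     transpose D ** A - transpose B ** C = mat 1 \<and> transpose D ** B = transpose B ** D \<and>
     transpose A ** C = transpose C ** A \<and> transpose A ** D - transpose C ** B = mat 1"
    by (auto simp: symplectic_iff_inv sp_inv_def block_mult mat_block matrix_minus_left)
  moreover have "transpose A ** D - transpose C ** B = transpose (transpose D ** A - transpose B ** C)"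
    by (simp add: mat2_eq_iff matrix_matrix_mult_def transpose_def sum_2 algebra_simps)
  ultimately show ?thesis by (auto simp: transpose_mat)
qed

lemma symplectic_row_relation:
  assumes "symplectic (block A B C D)"
  shows "A ** transpose D - B ** transpose C = mat 1" "A ** transpose B = B ** transpose A"
    "C ** transpose D = D ** transpose C"
  using symplectic_inv_right [OF assms]
  by (simp_all add: sp_inv_def block_mult mat_block matrix_minus_right)

section \<open>Integral matrices and the group of level \<open>N\<close>\<close>

definition int_mat :: "real^'n^'m \<Rightarrow> bool" where
  "int_mat M \<longleftrightarrow> (\<forall>i j. M $ i $ j \<in> \<int>)"

lemma int_mat_mult: "int_mat A \<Longrightarrow> int_mat B \<Longrightarrow> int_mat (A ** B)"
  by (auto simp: int_mat_def matrix_matrix_mult_def intro!: Ints_sum Ints_mult)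

lemma int_mat_add: "int_mat A \<Longrightarrow> int_mat B \<Longrightarrow> int_mat (A + B)"
  by (auto simp: int_mat_def)

lemma int_mat_block: "int_mat (block A B C D) \<longleftrightarrow> int_mat A \<and> int_mat B \<and> int_mat C \<and> int_mat D"
  using block_all [of "\<lambda>x. x \<in> \<int>" A B C D] by (simp add: int_mat_def)

lemma int_mat_mk2: "int_mat (mk2 a b c d) \<longleftrightarrow> a \<in> \<int> \<and> b \<in> \<int> \<and> c \<in> \<int> \<and> d \<in> \<int>"
  by (auto simp: int_mat_def forall_2)

lemma int_mat_transpose: "int_mat (transpose A) \<longleftrightarrow> int_mat A"
  by (auto simp: int_mat_def transpose_def)

lemma int_mat_uminus: "int_mat (- A) \<longleftrightarrow> int_mat A"
  by (auto simp: int_mat_def)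

lemma int_mat_obtain:
  assumes "int_mat (A :: real mat2)"
  obtains a b c d :: int where "A = mk2 (of_int a) (of_int b) (of_int c) (of_int d)"
  using assms unfolding int_mat_def forall_2 mat2_eq_iff by (auto elim!: Ints_cases)

lemma Gamma0_block: "block A B C D \<in> Gamma0 N \<longleftrightarrow>
    symplectic (block A B C D) \<and> int_mat A \<and> int_mat B \<and> int_mat D \<and> (\<exists>C'. int_mat C' \<and> C = real N *\<^sub>R C')"
proof -
  have "(\<forall>i j. \<exists>c::int. C $ i $ j = real N * of_int c) \<longleftrightarrow> (\<exists>C'. int_mat C' \<and> C = real N *\<^sub>R C')"
  proof
    assume "\<forall>i j. \<exists>c::int. C $ i $ j = real N * of_int c"
    then obtain f :: "2 \<Rightarrow> 2 \<Rightarrow> int" where f: "\<And>i j. C $ i $ j = real N * of_int (f i j)"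
      by metis
    then show "\<exists>C'. int_mat C' \<and> C = real N *\<^sub>R C'"
      by (intro exI [of _ "\<chi> i j. of_int (f i j)"]) (auto simp: int_mat_def vec_eq_iff)
  next
    assume "\<exists>C'. int_mat C' \<and> C = real N *\<^sub>R C'"
    then show "\<forall>i j. \<exists>c::int. C $ i $ j = real N * of_int c"
      unfolding int_mat_def by (metis Ints_cases vector_scaleR_component real_scaleR_def)
  qed
  moreover have "int_mat C" if "int_mat C'" "C = real N *\<^sub>R C'" for C'
    using that by (auto simp: int_mat_def)
  ultimately show ?thesis
    using int_mat_block [of A B C D] by (auto simp: Gamma0_def int_mat_def [of "block A B C D"])
qed

lemma matrix_mult_add_left: "(A + B) ** C = A ** C + B ** (C :: 'a::semiring_1^'n^'m)"
  by (simp add: matrix_matrix_mult_def vec_eq_iff sum.distrib distrib_right)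

lemma scaleR_mult_left: "(r *\<^sub>R A) ** B = r *\<^sub>R (A ** (B::real^'n^'m))"
  by (simp add: matrix_matrix_mult_def vec_eq_iff sum_distrib_left mult_ac)

lemma scaleR_mult_right: "A ** (r *\<^sub>R B) = r *\<^sub>R (A ** (B::real^'n^'m))"
  by (simp add: matrix_matrix_mult_def vec_eq_iff sum_distrib_left mult_ac)

lemma Gamma0_mult:
  assumes "M \<in> Gamma0 N" "M' \<in> Gamma0 N" shows "M ** M' \<in> Gamma0 N"
proof -
  obtain A B C D A' B' C' D' where M: "M = block A B C D" "M' = block A' B' C' D'"
    by (metis block_blk)
  obtain E E' where E: "int_mat E" "C = real N *\<^sub>R E" "int_mat E'" "C' = real N *\<^sub>R E'"
    using assms unfolding M Gamma0_block by blast
  have "symplectic (M ** M')"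
    using assms by (intro symplectic_mult) (auto simp: Gamma0_def)
  moreover have "int_mat C" "int_mat C'"
    using int_mat_block assms unfolding M Gamma0_def int_mat_def [symmetric] by auto
  moreover have "C ** A' + D ** C' = real N *\<^sub>R (E ** A' + D ** E')"
    using E by (simp add: scaleR_mult_left scaleR_mult_right scaleR_add_right)
  ultimately show ?thesis
    using assms E unfolding M block_mult Gamma0_block
    by (auto intro!: int_mat_add int_mat_mult exI [of _ "E ** A' + D ** E'"])
qed

lemma Gamma0_sp_inv: "M \<in> Gamma0 N \<Longrightarrow> sp_inv M \<in> Gamma0 N"
proof -
  assume M: "M \<in> Gamma0 N"
  obtain A B C D where MM: "M = block A B C D" by (metis block_blk)
  obtain E where E: "int_mat E" "C = real N *\<^sub>R E"
    using M unfolding MM Gamma0_block by blast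
  have "- transpose C = real N *\<^sub>R (- transpose E)"
    using E by (simp add: transpose_def vec_eq_iff)
  moreover have "symplectic (sp_inv M)"
    using M by (auto simp: Gamma0_def symplectic_sp_inv)
  ultimately show ?thesis
    using M E(1) unfolding MM sp_inv_def blk_block Gamma0_block
    by (metis int_mat_transpose int_mat_uminus)
qed

lemma Gamma0_one: "mat 1 \<in> Gamma0 N"
  unfolding mat_block Gamma0_block symplectic_transpose_relation
  by (auto simp: int_mat_def transpose_mat intro!: exI [of _ 0]) (auto simp: mat_def)

section \<open>The slash operator on block upper triangular matrices\<close>

lemma abs_det_similitude:
  assumes "transpose M ** symJ ** M = \<nu> *\<^sub>R symJ"
  shows "\<bar>det M\<bar> = \<nu>\<^sup>2"
proof -
  have sc: "\<nu> *\<^sub>R symJ = mat \<nu> ** symJ"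
    by (simp add: mat_block symJ_def block_mult mat4_eq_iff) (simp add: mat_mk2 mk2_simps mat2_eq_iff forall_2)
  have dm: "det (mat x :: real mat4) = x ^ 4" for x
    by (subst det_diagonal) (auto simp: mat_def)
  have "- mat 1 = (mat (- 1) :: real mat4)"
    by (simp add: mat_def vec_eq_iff)
  then have "det symJ * det symJ = 1"
    unfolding det_mul [symmetric] symJ_symJ using dm [of "-1"] by simp
  then have J: "det symJ \<noteq> 0" by auto
  have "det (transpose M ** symJ ** M) = \<nu> ^ 4 * det symJ"
    unfolding assms sc by (simp add: det_mul dm)
  \<comment> \<open>Determinants see the similitude relation only through the square of
    \<open>det M\<close>, so the sign of \<open>det M\<close> stays open.\<close>
  then have "(det M)\<^sup>2 = (\<nu>\<^sup>2)\<^sup>2"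
    using J by (simp add: det_mul power2_eq_square power4_eq_xxxx)
  then show ?thesis
    by (metis abs_power2 power2_eq_iff abs_minus_cancel)
qed

lemma matrix_inv_both:
  assumes "det (A :: 'a::field^'n^'n) \<noteq> 0"
  shows "A ** matrix_inv A = mat 1" "matrix_inv A ** A = mat 1"
proof -
  obtain B where "A ** B = mat 1" "B ** A = mat 1"
    using assms by (metis invertible_def invertible_det_nz)
  then have "A ** matrix_inv A = mat 1 \<and> matrix_inv A ** A = mat 1"
    unfolding matrix_inv_def by (intro someI [of "\<lambda>B. A ** B = mat 1 \<and> B ** A = mat 1"]) simp
  then show "A ** matrix_inv A = mat 1" "matrix_inv A ** A = mat 1" by auto
qed

lemma matrix_inv_unique_right:
  assumes "(A :: 'a::field^'n^'n) ** B = mat 1" shows "matrix_inv A = B"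
proof -
  have "det A \<noteq> 0"
    using assms by (metis det_I det_mul mult_zero_left zero_neq_one)
  then have "matrix_inv A ** (A ** B) = B"
    by (simp add: matrix_mul_assoc matrix_inv_both)
  then show ?thesis by (simp add: assms)
qed

text \<open>Since \<open>ln\<close> is even on the reals, \<open>powr\<close> ignores the sign of its base, so only the absolute value of a
  determinant enters the slash operator and the sign of the determinant of a symplectic matrix is irrelevant.\<close>

lemma abs_powr_cancel: "\<bar>x\<bar> powr a = x powr (a::real)"
  by (auto simp: abs_if uminus_powr_eq)

lemma powr_mult_all: "(x * y) powr a = x powr a * y powr (a::real)"
  using powr_mult [of "\<bar>x\<bar>" "\<bar>y\<bar>" a] by (simp add: abs_mult [symmetric] abs_powr_cancel)

text \<open>No invertibility of \<open>C\<tau> + D\<close> is needed for \<open>g\<close>: where its determinant vanishes, both sides are \<open>0\<close>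
  because \<open>0 powi - int k = 0\<close> for \<open>k > 0\<close>.\<close>

lemma slash_mult:
  fixes g :: "real mat4"
  assumes k: "k > 0" and D: "det D \<noteq> 0"
  shows "slash k F (g ** block A B 0 D) \<tau> = slash k (slash k F g) (block A B 0 D) \<tau>"
proof -
  obtain a b c d where g: "g = block a b c d" by (metis block_blk)
  define Y where "Y = cmat D"
  define \<tau>' where "\<tau>' = (cmat A ** \<tau> + cmat B) ** matrix_inv Y"
  define X where "X = cmat c ** \<tau>' + cmat d"
  have detY: "det Y \<noteq> 0" using D by (simp add: Y_def det_cmat)
  then have Y: "matrix_inv Y ** Y = mat 1" "Y ** matrix_inv Y = mat 1"
    by (simp_all add: matrix_inv_both)
  have \<tau>Y: "\<tau>' ** Y = cmat A ** \<tau> + cmat B"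
    by (simp add: \<tau>'_def matrix_mul_assoc [symmetric] Y)
  have up: "cmat (a' ** A) ** \<tau> + cmat (a' ** B + b' ** D) = (cmat a' ** \<tau>' + cmat b') ** Y" for a' b'
    unfolding matrix_mult_add_left matrix_mul_assoc [symmetric] \<tau>Y
    by (simp add: cmat_mult cmat_add matrix_add_ldistrib matrix_mul_assoc [symmetric] Y_def add.assoc)
  have "F ((cmat a ** \<tau>' + cmat b) ** Y ** matrix_inv (X ** Y)) =
        F ((cmat a ** \<tau>' + cmat b) ** matrix_inv X)" if "det X \<noteq> 0"
  proof -
    have X: "X ** matrix_inv X = mat 1"
      using that by (simp add: matrix_inv_both)
    have "matrix_inv (X ** Y) = matrix_inv Y ** matrix_inv X"
    proof (rule matrix_inv_unique_right)
      show "X ** Y ** (matrix_inv Y ** matrix_inv X) = mat 1"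
        by (metis X Y(2) matrix_mul_assoc matrix_mul_rid)
    qed
    then have "(cmat a ** \<tau>' + cmat b) ** Y ** matrix_inv (X ** Y) =
        (cmat a ** \<tau>' + cmat b) ** (Y ** matrix_inv Y) ** matrix_inv X"
      by (simp only: matrix_mul_assoc)
    then show ?thesis by (simp add: Y)
  qed
  moreover have "det X powi - int k = 0" if "det X = 0"
    using that k by (simp add: power_int_def)
  ultimately have "det X powi - int k * F ((cmat a ** \<tau>' + cmat b) ** Y ** matrix_inv (X ** Y)) =
        det X powi - int k * F ((cmat a ** \<tau>' + cmat b) ** matrix_inv X)"
    by (cases "det X = 0") auto
  moreover have "slash k F (g ** block A B 0 D) \<tau> =
      of_real (det g powr (real k / 2)) * of_real (det (block A B 0 D) powr (real k / 2)) * det Y powi - int k *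
      (det X powi - int k * F ((cmat a ** \<tau>' + cmat b) ** Y ** matrix_inv (X ** Y)))"
    unfolding slash_def det_mul powr_mult_all unfolding g block_mult blk_block
    by (simp add: up X_def det_mul power_int_mult_distrib)
  moreover have "slash k (slash k F g) (block A B 0 D) \<tau> =
      of_real (det g powr (real k / 2)) * of_real (det (block A B 0 D) powr (real k / 2)) * det Y powi - int k *
      (det X powi - int k * F ((cmat a ** \<tau>' + cmat b) ** matrix_inv X))"
    unfolding slash_def [of _ _ "block A B 0 D"] unfolding slash_def [of _ F] g blk_block
    by (simp add: \<tau>'_def X_def Y_def)
  ultimately show ?thesis
    by (simp only:)
qed

lemma upper_action:
  assumes A: "transpose A ** D = mat \<mu>" and \<mu>: "\<mu> > 0"
  shows "(cmat A ** \<tau> + cmat (A ** S)) ** matrix_inv (cmat D) =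
     (1 / \<mu>) *\<^sub>R (cmat A ** (\<tau> + cmat S) ** cmat (transpose A))"
proof -
  have cD: "cmat D ** cmat (transpose A) = mat (of_real \<mu>)"
  proof -
    have "transpose A ** ((1/\<mu>) *\<^sub>R D) = mat 1"
      using A \<mu> by (simp add: scaleR_mult_right mat_mk2 mk2_simps)
    then have "((1/\<mu>) *\<^sub>R D) ** transpose A = mat 1"
      using matrix_left_right_inverse by blast
    then have "D ** transpose A = mat \<mu>"
      using \<mu> by (simp add: scaleR_mult_left mat_mk2 mat2_eq_iff divide_simps)
    then show ?thesis by (metis cmat_mult cmat_mat)
  qed
  have inv: "matrix_inv (cmat D) = (1 / \<mu>) *\<^sub>R cmat (transpose A)"
  proof (rule matrix_inv_unique_right)
    show "cmat D ** ((1 / \<mu>) *\<^sub>R cmat (transpose A)) = mat 1"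
    proof -
      have "cmat D ** ((1 / \<mu>) *\<^sub>R cmat (transpose A)) = (1 / \<mu>) *\<^sub>R (cmat D ** cmat (transpose A))"
        by (simp add: mat2_eq_iff matrix_matrix_mult_def sum_2 scaleR_add_right)
      then show ?thesis
        using \<mu> by (simp add: cD mat_mk2 mk2_scaleR complex_eq_iff)
    qed
  qed
  show ?thesis unfolding inv
    by (simp add: cmat_mult matrix_add_ldistrib [symmetric])
      (simp add: mat2_eq_iff matrix_matrix_mult_def sum_2 scaleR_add_right)
qed

text \<open>\<open>D\<close> is \<open>\<mu>\<close> times the inverse transpose of
  \<open>A\<close>, and the block matrix is a similitude of multiplier \<open>\<mu>\<close>. Its
  determinant factor \<open>\<mu> ^ k\<close> and the automorphy factor combine to
  \<open>(det A / \<mu>) ^ k\<close>. Writing the upper right block as \<open>A ** S\<close> turns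
  the action into a translation followed by a congruence.\<close>

lemma slash_upper:
  assumes A: "transpose A ** D = mat \<mu>" and S: "transpose S = S" and \<mu>: "\<mu> > 0"
  shows "slash k F (block A (A ** S) 0 D) \<tau> =
    of_real (det A / \<mu>) ^ k * F ((1 / \<mu>) *\<^sub>R (cmat A ** (\<tau> + cmat S) ** cmat (transpose A)))"
proof -
  have "det (transpose A ** D) = \<mu>\<^sup>2"
    unfolding A by (simp add: mat_mk2 det_mk2 power2_eq_square)
  then have dAD: "det A * det D = \<mu>\<^sup>2" by (simp add: det_mul)
  then have nz: "det A \<noteq> 0" "det D \<noteq> 0" using \<mu> by auto
  have A': "transpose D ** A = mat \<mu>"
    by (metis A matrix_transpose_mul transpose_mat transpose_transpose)
  have "transpose (block A (A ** S) 0 D) ** symJ ** block A (A ** S) 0 D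
     = block 0 (transpose A ** D) (- (transpose D ** A)) (S ** (transpose A ** D) - transpose D ** A ** S)"
    by (simp add: block_transpose symJ_def block_mult matrix_minus_left matrix_minus_right matrix_transpose_mul S matrix_mul_assoc)
  also have "\<dots> = \<mu> *\<^sub>R symJ"
    unfolding A A' symJ_def
    by (auto simp: mat4_eq_iff forall_2 matrix_matrix_mult_def sum_2 mat_def)
  finally have "\<bar>det (block A (A ** S) 0 D)\<bar> = \<mu>\<^sup>2"
    by (rule abs_det_similitude)
  then have "det (block A (A ** S) 0 D) powr (real k / 2) = (\<mu> powr 2) powr (real k / 2)"
    using \<mu> abs_powr_cancel [of "det (block A (A ** S) 0 D)"] by simp
  also have "\<dots> = \<mu> ^ k"
    using \<mu> by (simp only: powr_powr) (simp add: powr_realpow)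
  finally have d1: "det (block A (A ** S) 0 D) powr (real k / 2) = \<mu> ^ k" .
  have "\<mu> / det D = det A / \<mu>"
    using dAD nz \<mu> by (simp add: field_simps power2_eq_square)
  then have c: "\<mu> ^ k * det D powi (- int k) = (det A / \<mu>) ^ k"
    by (metis power_divide divide_inverse power_int_minus power_int_of_nat)
  show ?thesis
    unfolding slash_def blk_block cmat_0 matrix_mult_zero add_0
    unfolding d1 upper_action [OF A \<mu>] det_cmat of_real_power [symmetric] c [symmetric]
    by (simp add: of_real_power_int)
qed

section \<open>Dirichlet characters and Hecke cosets\<close>

lemma quadratic_form_2:
  "(v::real^2) \<bullet> (M *v v) = M$1$1 * v$1 * v$1 + (M$1$2 + M$2$1) * v$1 * v$2 + M$2$2 * v$2 * v$2"
  by (simp add: inner_vec_def matrix_vector_mult_def sum_2 algebra_simps)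

lemma siegel2_act:
  assumes \<tau>: "\<tau> \<in> siegel2" and S: "transpose S = S" and A: "det A \<noteq> 0" and c: "c > 0"
  shows "c *\<^sub>R (cmat A ** (\<tau> + cmat S) ** cmat (transpose A)) \<in> siegel2"
proof -
  define Y :: "real mat2" where "Y = (\<chi> i j. Im (\<tau> $ i $ j))"
  have sym: "\<tau>$1$2 = \<tau>$2$1" "S$1$2 = S$2$1"
  proof -
    have "transpose \<tau> $ 2 $ 1 = \<tau> $ 2 $ 1" "transpose S $ 2 $ 1 = S $ 2 $ 1"
      using \<tau> S by (simp_all add: siegel2_def)
    then show "\<tau>$1$2 = \<tau>$2$1" "S$1$2 = S$2$1"
      by (simp_all only: transpose_def vec_lambda_beta)
  qed
  have Y: "v \<bullet> (Y *v v) > 0" if "v \<noteq> 0" for v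
    using \<tau> that by (simp add: siegel2_def Y_def)
  let ?Z = "c *\<^sub>R (cmat A ** (\<tau> + cmat S) ** cmat (transpose A))"
  have "transpose ?Z = ?Z"
    by (simp add: mat2_eq_iff transpose_def matrix_matrix_mult_def sum_2 cmat_def sym algebra_simps)
  moreover have "(\<chi> i j. Im (?Z $ i $ j)) = c *\<^sub>R (A ** Y ** transpose A)"
    by (simp add: mat2_eq_iff transpose_def matrix_matrix_mult_def sum_2 cmat_def Y_def algebra_simps)
  moreover have "v \<bullet> ((c *\<^sub>R (A ** Y ** transpose A)) *v v) > 0" if "v \<noteq> 0" for v
  proof -
    have "v \<bullet> ((c *\<^sub>R (A ** Y ** transpose A)) *v v) = c * ((transpose A *v v) \<bullet> (Y *v (transpose A *v v)))"
      by (simp add: quadratic_form_2)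
        (simp add: matrix_matrix_mult_def vector_matrix_mult_def transpose_def sum_2 algebra_simps)
    moreover have "transpose A *v v \<noteq> 0"
      using A that by (metis det_transpose invertible_det_nz invertible_def matrix_vector_mul_assoc
          matrix_vector_mul_lid matrix_vector_mult_0_right)
    ultimately show ?thesis using Y c by simp
  qed
  ultimately show ?thesis by (simp add: siegel2_def)
qed

lemma dirichlet_character_cong:
  assumes "dirichlet_character N \<chi>'" "[x = y] (mod int N)"
  shows "\<chi>' x = \<chi>' y"
proof -
  have per: "\<chi>' (x + int N) = \<chi>' x" for x
    using assms by (simp add: dirichlet_character_def)
  have pern: "\<chi>' (x + int n * int N) = \<chi>' x" for x n
  proof (induction n)
    case (Suc n)
    have "x + int (Suc n) * int N = (x + int n * int N) + int N" by (simp add: algebra_simps)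
    then show ?case using Suc per by metis
  qed simp
  obtain z where z: "y = x + int N * z"
    using assms(2) by (metis cong_iff_lin)
  show ?thesis
  proof (cases "z \<ge> 0")
    case True
    then show ?thesis using pern [of x "nat z"] z by (simp add: mult.commute)
  next
    case False
    then have "x = y + int (nat (- z)) * int N" using z by (simp add: algebra_simps)
    then show ?thesis using pern [of y "nat (- z)"] by simp
  qed
qed

lemma dirichlet_character_mult: "dirichlet_character N \<chi>' \<Longrightarrow> \<chi>' (x * y) = \<chi>' x * \<chi>' y"
  by (simp add: dirichlet_character_def)

lemma dirichlet_character_one:
  assumes "dirichlet_character N \<chi>'" shows "\<chi>' 1 = 1"
proof -
  have "\<chi>' 1 * \<chi>' 1 = \<chi>' 1" "\<chi>' 1 \<noteq> 0"
    using assms dirichlet_character_mult [OF assms, of 1 1] by (auto simp: dirichlet_character_def)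
  then show ?thesis by simp
qed

lemma dirichlet_character_power: "dirichlet_character N \<chi>' \<Longrightarrow> \<chi>' (x ^ n) = \<chi>' x ^ n"
  by (induction n) (simp_all add: dirichlet_character_one dirichlet_character_mult)

text \<open>Absolute value one is not built into \<open>dirichlet_character\<close>; Euler's theorem
  makes the values at units roots of unity.\<close>

lemma dirichlet_character_cnj:
  assumes \<chi>: "dirichlet_character N \<chi>'" and N: "N > 0" and "coprime x (int N)"
  shows "cnj (\<chi>' x) * \<chi>' x = 1"
proof -
  define y where "y = nat (x mod int N)"
  have y: "[int y = x] (mod int N)"
    using N by (simp add: y_def cong_def)
  then have "coprime (int y) (int N)"
    using assms(3) cong_imp_coprime cong_sym by blast
  then have "[y ^ totient N = 1] (mod N)"
    by (intro euler_theorem) simp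
  then have "[int y ^ totient N = 1] (mod int N)"
    by (metis cong_int_iff of_nat_1 of_nat_power)
  then have "\<chi>' (int y) ^ totient N = 1"
    using dirichlet_character_cong [OF \<chi>] dirichlet_character_power [OF \<chi>] dirichlet_character_one [OF \<chi>]
    by metis
  then have "norm (\<chi>' (int y)) ^ totient N = 1"
    by (metis norm_power norm_one)
  then have "norm (\<chi>' (int y)) = 1"
    using N power_eq_1_iff [of "norm (\<chi>' (int y))" "totient N"] by simp
  then have "norm (\<chi>' x) = 1"
    using dirichlet_character_cong [OF \<chi> y] by simp
  then show ?thesis
    by (metis complex_norm_square mult.commute of_real_1 power_one)
qed

lemma Gamma0_obtain:
  assumes "M \<in> Gamma0 N"
  obtains A B E D where "M = block A B (real N *\<^sub>R E) D" "int_mat A" "int_mat B" "int_mat E" "int_mat D"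
    "symplectic M"
  using assms by (metis block_blk Gamma0_block)

text \<open>The lower right block of the product is \<open>C ** B' + D ** D'\<close>, which is
  congruent to \<open>D ** D'\<close> modulo \<open>N\<close>.\<close>

lemma char_mat_mult:
  assumes \<chi>: "dirichlet_character N \<chi>'" and "M \<in> Gamma0 N" "M' \<in> Gamma0 N"
  shows "char_mat \<chi>' (M ** M') = char_mat \<chi>' M * char_mat \<chi>' M'"
proof -
  obtain A B E D where M: "M = block A B (real N *\<^sub>R E) D" and i: "int_mat E" "int_mat D"
    using assms Gamma0_obtain by metis
  obtain A' B' E' D' where M': "M' = block A' B' (real N *\<^sub>R E') D'" and i': "int_mat B'" "int_mat D'"
    using assms Gamma0_obtain by metis
  obtain e1 e2 e3 e4 where E: "E = mk2 (of_int e1) (of_int e2) (of_int e3) (of_int e4)"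
    using i int_mat_obtain by blast
  obtain d1 d2 d3 d4 where D: "D = mk2 (of_int d1) (of_int d2) (of_int d3) (of_int d4)"
    using i int_mat_obtain by blast
  obtain b1 b2 b3 b4 where B': "B' = mk2 (of_int b1) (of_int b2) (of_int b3) (of_int b4)"
    using i' int_mat_obtain by blast
  obtain f1 f2 f3 f4 where D': "D' = mk2 (of_int f1) (of_int f2) (of_int f3) (of_int f4)"
    using i' int_mat_obtain by blast
  define g1 g2 g3 g4 where "g1 = e1*b1+e2*b3" "g2 = e1*b2+e2*b4" "g3 = e3*b1+e4*b3" "g4 = e3*b2+e4*b4"
  note g = this
  define h1 h2 h3 h4 where "h1 = d1*f1+d2*f3" "h2 = d1*f2+d2*f4" "h3 = d3*f1+d4*f3" "h4 = d3*f2+d4*f4"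
  note h = this
  \<comment> \<open>The determinant of \<open>N\<close> times the matrix of the \<open>g\<close>s
    plus the matrix of the \<open>h\<close>s, expanded so that its congruence to the determinant of
    the latter is visible.\<close>
  define z where "z = (h1*h4 - h2*h3) + int N * (g1*h4 + h1*g4 - g2*h3 - h2*g3 + int N * (g1*g4-g2*g3))"
  have "det (blkD (M ** M')) = of_int z"
    unfolding M M' E D B' D' block_mult blk_block z_def g h
    by (simp add: mk2_simps algebra_simps)
  moreover have "det D * det D' = of_int (h1*h4 - h2*h3)"
    unfolding D D' h by (simp add: mk2_simps algebra_simps)
  moreover have "\<chi>' z = \<chi>' (h1*h4 - h2*h3)"
    by (rule dirichlet_character_cong [OF \<chi>]) (simp add: z_def cong_iff_dvd_diff)
  moreover have "\<chi>' \<lfloor>det D * det D'\<rfloor> = \<chi>' \<lfloor>det D\<rfloor> * \<chi>' \<lfloor>det D'\<rfloor>"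
  proof -
    have "det D = of_int (d1*d4-d2*d3)" "det D' = of_int (f1*f4-f2*f3)"
      by (simp_all add: D D' det_mk2)
    then show ?thesis
      by (simp only: of_int_mult [symmetric] floor_of_int dirichlet_character_mult [OF \<chi>])
  qed
  ultimately show ?thesis
    unfolding char_mat_def by (metis M M' blk_block(4) floor_of_int)
qed

text \<open>\<open>A ** transpose D\<close> is congruent to the identity modulo \<open>N\<close>, so
  \<open>det D\<close> is a unit modulo \<open>N\<close> with inverse \<open>det A\<close>.\<close>

lemma char_mat_cnj:
  assumes \<chi>: "dirichlet_character N \<chi>'" and N: "N > 0" and "M \<in> Gamma0 N"
  shows "cnj (char_mat \<chi>' M) * char_mat \<chi>' M = 1"
proof -
  obtain A B E D where M: "M = block A B (real N *\<^sub>R E) D" and i: "int_mat A" "int_mat B" "int_mat E" "int_mat D"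
    and s: "symplectic M"
    using assms Gamma0_obtain by metis
  obtain a1 a2 a3 a4 where A: "A = mk2 (of_int a1) (of_int a2) (of_int a3) (of_int a4)"
    using i int_mat_obtain by blast
  obtain b1 b2 b3 b4 where B: "B = mk2 (of_int b1) (of_int b2) (of_int b3) (of_int b4)"
    using i int_mat_obtain by blast
  obtain e1 e2 e3 e4 where E: "E = mk2 (of_int e1) (of_int e2) (of_int e3) (of_int e4)"
    using i int_mat_obtain by blast
  obtain d1 d2 d3 d4 where D: "D = mk2 (of_int d1) (of_int d2) (of_int d3) (of_int d4)"
    using i int_mat_obtain by blast
  have "mk2 (of_int (a1*d1+a2*d2 - int N*(b1*e1+b2*e2))) (of_int (a1*d3+a2*d4 - int N*(b1*e3+b2*e4)))
     (of_int (a3*d1+a4*d2 - int N*(b3*e1+b4*e2))) (of_int (a3*d3+a4*d4 - int N*(b3*e3+b4*e4)))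
     = (mk2 1 0 0 1 :: real mat2)"
    using symplectic_row_relation(1) [OF s [unfolded M]]
    by (simp add: A B E D mk2_simps mat_mk2 algebra_simps)
  then have e: "a1*d1+a2*d2 = 1 + int N*(b1*e1+b2*e2)" "a1*d3+a2*d4 = int N*(b1*e3+b2*e4)"
    "a3*d1+a4*d2 = int N*(b3*e1+b4*e2)" "a3*d3+a4*d4 = 1 + int N*(b3*e3+b4*e4)"
    unfolding mk2_eq_iff by linarith+
  have "(a1*a4 - a2*a3) * (d1*d4 - d2*d3) =
     (a1*d1+a2*d2)*(a3*d3+a4*d4) - (a1*d3+a2*d4)*(a3*d1+a4*d2)"
    by (simp add: algebra_simps)
  also have "\<dots> = 1 + int N * ((b1*e1+b2*e2) + (b3*e3+b4*e4) + (b1*e1+b2*e2) * (int N*(b3*e3+b4*e4))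
      - (b1*e3+b2*e4) * (int N*(b3*e1+b4*e2)))"
    unfolding e by (simp add: algebra_simps)
  finally have "[(d1*d4 - d2*d3) * (a1*a4 - a2*a3) = 1] (mod int N)"
    by (simp add: cong_iff_dvd_diff mult.commute)
  then have "coprime (d1*d4 - d2*d3) (int N)"
    by (meson coprime_iff_invertible_int)
  moreover have "char_mat \<chi>' M = \<chi>' (d1*d4 - d2*d3)"
  proof -
    have "det D = of_int (d1*d4 - d2*d3)" by (simp add: D det_mk2)
    then show ?thesis unfolding char_mat_def M blk_block by (simp only: floor_of_int)
  qed
  ultimately show ?thesis
    using dirichlet_character_cnj [OF \<chi> N] by simp
qed

section \<open>Right cosets of the Hecke group\<close>

definition hecke_group :: "nat \<Rightarrow> real mat4 \<Rightarrow> real mat4 set" where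
  "hecke_group N \<delta> = {\<delta> ** g ** matrix_inv \<delta> | g. g \<in> Gamma0 N} \<inter> Gamma0 N"

lemma hecke_cosets_alt: "hecke_cosets N \<delta> = (\<lambda>\<gamma>. (\<lambda>h. h ** \<gamma>) ` hecke_group N \<delta>) ` Gamma0 N"
  by (auto simp: hecke_cosets_def hecke_group_def)

lemma hecke_group_one:
  assumes "det \<delta> \<noteq> 0" shows "mat 1 \<in> hecke_group N \<delta>"
  using matrix_inv_both [OF assms]
  by (auto simp: hecke_group_def Gamma0_one intro!: exI [of _ "mat 1"])

lemma hecke_group_mult:
  assumes "det \<delta> \<noteq> 0" "h \<in> hecke_group N \<delta>" "h' \<in> hecke_group N \<delta>"
  shows "h ** h' \<in> hecke_group N \<delta>"
proof -
  obtain g g' where g: "h = \<delta> ** g ** matrix_inv \<delta>" "h' = \<delta> ** g' ** matrix_inv \<delta>" "g \<in> Gamma0 N" "g' \<in> Gamma0 N"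
    using assms unfolding hecke_group_def by blast
  have "h ** h' = \<delta> ** g ** (matrix_inv \<delta> ** \<delta>) ** g' ** matrix_inv \<delta>"
    unfolding g by (simp only: matrix_mul_assoc)
  also have "\<dots> = \<delta> ** (g ** g') ** matrix_inv \<delta>"
    unfolding matrix_inv_both [OF assms(1)] by (simp only: matrix_mul_assoc matrix_mul_rid)
  finally have "h ** h' = \<delta> ** (g ** g') ** matrix_inv \<delta>" .
  moreover have "h ** h' \<in> Gamma0 N" "g ** g' \<in> Gamma0 N"
    using g assms(2,3) by (auto simp: hecke_group_def intro!: Gamma0_mult)
  ultimately show ?thesis unfolding hecke_group_def by blast
qed

lemma hecke_group_inv:
  assumes "det \<delta> \<noteq> 0" "h \<in> hecke_group N \<delta>"
  shows "sp_inv h \<in> hecke_group N \<delta>" "sp_inv h ** h = mat 1" "h ** sp_inv h = mat 1"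
proof -
  obtain g where g: "h = \<delta> ** g ** matrix_inv \<delta>" "g \<in> Gamma0 N" and h: "h \<in> Gamma0 N"
    using assms unfolding hecke_group_def by blast
  have sg: "g ** sp_inv g = mat 1"
    using g by (intro symplectic_inv_right) (simp add: Gamma0_def)
  show h1: "h ** sp_inv h = mat 1" "sp_inv h ** h = mat 1"
    using h by (auto intro!: symplectic_inv_left symplectic_inv_right simp: Gamma0_def)
  have "h ** (\<delta> ** sp_inv g ** matrix_inv \<delta>) = \<delta> ** g ** (matrix_inv \<delta> ** \<delta>) ** sp_inv g ** matrix_inv \<delta>"
    unfolding g by (simp only: matrix_mul_assoc)
  also have "\<dots> = \<delta> ** (g ** sp_inv g) ** matrix_inv \<delta>"
    unfolding matrix_inv_both [OF assms(1)] by (simp only: matrix_mul_assoc matrix_mul_rid)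
  also have "\<dots> = mat 1"
    by (simp add: sg matrix_inv_both [OF assms(1)])
  finally have "h ** (\<delta> ** sp_inv g ** matrix_inv \<delta>) = mat 1" .
  moreover have "(sp_inv h ** h) ** X = sp_inv h ** (h ** X)" for X
    by (simp only: matrix_mul_assoc)
  ultimately have "sp_inv h = \<delta> ** sp_inv g ** matrix_inv \<delta>"
    by (metis h1(2) matrix_mul_lid matrix_mul_rid)
  then show "sp_inv h \<in> hecke_group N \<delta>"
    using Gamma0_sp_inv [OF g(2)] Gamma0_sp_inv [OF h] unfolding hecke_group_def by blast
qed

lemma hecke_coset_eq_iff:
  assumes "det \<delta> \<noteq> 0"
  shows "(\<lambda>h. h ** \<gamma>) ` hecke_group N \<delta> = (\<lambda>h. h ** \<gamma>') ` hecke_group N \<delta> \<longleftrightarrow>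
    (\<exists>h\<in>hecke_group N \<delta>. \<gamma> = h ** \<gamma>')"
proof
  assume "(\<lambda>h. h ** \<gamma>) ` hecke_group N \<delta> = (\<lambda>h. h ** \<gamma>') ` hecke_group N \<delta>"
  moreover have "mat 1 ** \<gamma> \<in> (\<lambda>h. h ** \<gamma>) ` hecke_group N \<delta>"
    using hecke_group_one [OF assms] by blast
  ultimately show "\<exists>h\<in>hecke_group N \<delta>. \<gamma> = h ** \<gamma>'"
    by auto
next
  assume "\<exists>h\<in>hecke_group N \<delta>. \<gamma> = h ** \<gamma>'"
  then obtain h where h: "h \<in> hecke_group N \<delta>" "\<gamma> = h ** \<gamma>'" by blast
  have "\<gamma>' = sp_inv h ** \<gamma>"
    unfolding h(2) matrix_mul_assoc hecke_group_inv(2) [OF assms h(1)] by simp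
  then have 1: "x ** \<gamma>' = (x ** sp_inv h) ** \<gamma>" for x
    by (simp add: matrix_mul_assoc)
  have 2: "x ** \<gamma> = (x ** h) ** \<gamma>'" for x
    by (simp add: h matrix_mul_assoc)
  show "(\<lambda>h. h ** \<gamma>) ` hecke_group N \<delta> = (\<lambda>h. h ** \<gamma>') ` hecke_group N \<delta>"
  proof (intro subset_antisym image_subsetI)
    fix x assume "x \<in> hecke_group N \<delta>"
    then show "x ** \<gamma> \<in> (\<lambda>h. h ** \<gamma>') ` hecke_group N \<delta>"
      unfolding 2 by (intro imageI hecke_group_mult [OF assms] h)
  next
    fix x assume "x \<in> hecke_group N \<delta>"
    then show "x ** \<gamma>' \<in> (\<lambda>h. h ** \<gamma>) ` hecke_group N \<delta>"
      unfolding 1 by (intro imageI hecke_group_mult [OF assms] hecke_group_inv(1) [OF assms] h)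
  qed
qed

lemma hecke_coset_member_iff:
  assumes "g' \<in> Gamma0 N"
  shows "(\<exists>h\<in>hecke_group N \<delta>. g = h ** g') \<longleftrightarrow> g ** sp_inv g' \<in> hecke_group N \<delta>"
proof -
  have s: "sp_inv g' ** g' = mat 1" "g' ** sp_inv g' = mat 1"
    using assms by (auto simp: Gamma0_def symplectic_inv_left symplectic_inv_right)
  have "g = h ** g' \<longleftrightarrow> h = g ** sp_inv g'" for h
    by (metis s matrix_mul_assoc matrix_mul_rid)
  then show ?thesis by simp
qed

lemma hecke_coset_sym:
  "det \<delta> \<noteq> 0 \<Longrightarrow> (\<exists>h\<in>hecke_group N \<delta>. g = h ** g') \<longleftrightarrow> (\<exists>h\<in>hecke_group N \<delta>. g' = h ** g)"
  by (metis hecke_coset_eq_iff)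

text \<open>\<open>hecke_sum\<close> evaluates at an arbitrary element
  \<open>h ** \<gamma> i\<close> of each coset. If
  \<open>h = \<delta> ** h' ** matrix_inv \<delta>\<close>, the slash operator contributes the
  character of \<open>h'\<close> and the conjugated factor that of \<open>h\<close>. Since
  \<open>\<delta>\<close> is block diagonal, the two agree and cancel. So any transversal may be
  used, and splitting off \<open>G i\<close> on the left costs only a character value.\<close>

lemma hecke_sum_representatives:
  fixes \<gamma> :: "'i \<Rightarrow> real mat4"
  assumes F: "siegel_modular_form k N \<chi>' F" and \<chi>: "dirichlet_character N \<chi>'" and k: "k > 0" and N: "N > 0"
    and \<delta>: "\<delta> = block P 0 0 Q" "det Q \<noteq> 0" "det \<delta> \<noteq> 0"
    and \<gamma>: "\<And>i. i \<in> I \<Longrightarrow> \<gamma> i \<in> Gamma0 N"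
    and cover: "\<And>g. g \<in> Gamma0 N \<Longrightarrow> \<exists>i\<in>I. \<exists>h\<in>hecke_group N \<delta>. g = h ** \<gamma> i"
    and disj: "\<And>i j h. i \<in> I \<Longrightarrow> j \<in> I \<Longrightarrow> h \<in> hecke_group N \<delta> \<Longrightarrow> \<gamma> i = h ** \<gamma> j \<Longrightarrow> i = j"
    and dec: "\<And>i. i \<in> I \<Longrightarrow> matrix_inv \<delta> ** \<gamma> i = G i ** block (A i) (A i ** S i) 0 (D i)"
    and G: "\<And>i. i \<in> I \<Longrightarrow> G i \<in> Gamma0 N"
    and A: "\<And>i. i \<in> I \<Longrightarrow> transpose (A i) ** D i = mat \<mu>"
    and S: "\<And>i. i \<in> I \<Longrightarrow> transpose (S i) = S i"
    and \<mu>: "\<mu> > 0" and \<tau>: "\<tau> \<in> siegel2"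
  shows "hecke_sum k N \<chi>' \<delta> F \<tau> = (\<Sum>i\<in>I. cnj (char_mat \<chi>' (\<gamma> i)) * char_mat \<chi>' (G i) *
     (of_real (det (A i) / \<mu>) ^ k * F ((1 / \<mu>) *\<^sub>R (cmat (A i) ** (\<tau> + cmat (S i)) ** cmat (transpose (A i))))))"
proof -
  let ?H = "hecke_group N \<delta>"
  let ?C = "\<lambda>\<gamma>. (\<lambda>h. h ** \<gamma>) ` ?H"
  have bij: "bij_betw (\<lambda>i. ?C (\<gamma> i)) I (hecke_cosets N \<delta>)"
    unfolding hecke_cosets_alt
  proof (rule bij_betw_imageI)
    show "inj_on (\<lambda>i. ?C (\<gamma> i)) I"
      unfolding inj_on_def hecke_coset_eq_iff [OF \<delta>(3)] using disj by blast
    show "(\<lambda>i. ?C (\<gamma> i)) ` I = ?C ` Gamma0 N"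
    proof (intro subset_antisym image_subsetI)
      fix i assume "i \<in> I" then show "?C (\<gamma> i) \<in> ?C ` Gamma0 N" using \<gamma> by blast
    next
      fix g assume "g \<in> Gamma0 N"
      then obtain i where i: "i \<in> I" "\<exists>h\<in>?H. g = h ** \<gamma> i" using cover by blast
      then have "?C g = ?C (\<gamma> i)" by (simp add: hecke_coset_eq_iff [OF \<delta>(3)])
      then show "?C g \<in> (\<lambda>i. ?C (\<gamma> i)) ` I" using i by blast
    qed
  qed
  have summand: "cnj (char_mat \<chi>' g) * slash k F (matrix_inv \<delta> ** g) \<tau> =
      cnj (char_mat \<chi>' (\<gamma> i)) * char_mat \<chi>' (G i) *
     (of_real (det (A i) / \<mu>) ^ k * F ((1 / \<mu>) *\<^sub>R (cmat (A i) ** (\<tau> + cmat (S i)) ** cmat (transpose (A i)))))"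
    if i: "i \<in> I" and g: "g \<in> ?C (\<gamma> i)" for i g
  proof -
    obtain h where h: "h \<in> ?H" "g = h ** \<gamma> i" using g by blast
    then obtain h' where h': "h = \<delta> ** h' ** matrix_inv \<delta>" "h' \<in> Gamma0 N" "h \<in> Gamma0 N"
      by (auto simp: hecke_group_def)
    have "matrix_inv \<delta> ** g = (matrix_inv \<delta> ** \<delta>) ** h' ** (matrix_inv \<delta> ** \<gamma> i)"
      unfolding h h' by (simp only: matrix_mul_assoc)
    then have e: "matrix_inv \<delta> ** g = (h' ** G i) ** block (A i) (A i ** S i) 0 (D i)"
      unfolding matrix_inv_both [OF \<delta>(3)] dec [OF i] by (simp add: matrix_mul_assoc)
    have "det (transpose (A i) ** D i) = \<mu>\<^sup>2"
      unfolding A [OF i] by (simp add: mat_mk2 det_mk2 power2_eq_square)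
    then have nz: "det (A i) \<noteq> 0" "det (D i) \<noteq> 0" using \<mu> by (auto simp: det_mul)
    have hG: "h' ** G i \<in> Gamma0 N" using h' G i by (simp add: Gamma0_mult)
    let ?Z = "(1 / \<mu>) *\<^sub>R (cmat (A i) ** (\<tau> + cmat (S i)) ** cmat (transpose (A i)))"
    have Z: "?Z \<in> siegel2"
      using \<mu> nz by (intro siegel2_act \<tau> S i) auto
    have "slash k F (matrix_inv \<delta> ** g) \<tau> = slash k (slash k F (h' ** G i)) (block (A i) (A i ** S i) 0 (D i)) \<tau>"
      unfolding e by (rule slash_mult [OF k nz(2)])
    also have "\<dots> = of_real (det (A i) / \<mu>) ^ k * slash k F (h' ** G i) ?Z"
      by (rule slash_upper [OF A [OF i] S [OF i] \<mu>])
    also have "slash k F (h' ** G i) ?Z = char_mat \<chi>' (h' ** G i) * F ?Z"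
      using F hG Z by (simp add: siegel_modular_form_def)
    also have "char_mat \<chi>' (h' ** G i) = char_mat \<chi>' h' * char_mat \<chi>' (G i)"
      using \<chi> h' G i by (intro char_mat_mult)
    finally have sl: "slash k F (matrix_inv \<delta> ** g) \<tau> =
      of_real (det (A i) / \<mu>) ^ k * (char_mat \<chi>' h' * char_mat \<chi>' (G i) * F ?Z)" .
    have "char_mat \<chi>' h = char_mat \<chi>' h'"
    proof -
      have h\<delta>: "h ** \<delta> = \<delta> ** h'"
        unfolding h' by (metis matrix_inv_both(2) [OF \<delta>(3)] matrix_mul_assoc matrix_mul_rid)
      \<comment> \<open>The lower right blocks of \<open>h\<close> and \<open>h'\<close> are
        conjugate under \<open>Q\<close>, hence of equal determinant.\<close>
      have "blkD h ** Q = Q ** blkD h'"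
        using h\<delta> [unfolded \<delta>(1)]
        by (metis (no_types, lifting) add_0 block_blk block_mult blk_block(4) matrix_mult_zero)
      then have "det (blkD h) * det Q = det Q * det (blkD h')"
        by (metis det_mul)
      then show ?thesis using \<delta>(2) by (simp add: char_mat_def)
    qed
    moreover have "char_mat \<chi>' g = char_mat \<chi>' h * char_mat \<chi>' (\<gamma> i)"
      unfolding h using \<chi> h' \<gamma> i by (intro char_mat_mult)
    moreover have "cnj (char_mat \<chi>' h) * char_mat \<chi>' h = 1"
      using char_mat_cnj [OF \<chi> N] h' by blast
    ultimately show ?thesis
      unfolding sl by (simp add: mult.assoc mult.left_commute [of _ "cnj (char_mat \<chi>' h')"])
  qed
  have "hecke_sum k N \<chi>' \<delta> F \<tau> = (\<Sum>i\<in>I. let g = SOME g. g \<in> ?C (\<gamma> i) in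
     cnj (char_mat \<chi>' g) * slash k F (matrix_inv \<delta> ** g) \<tau>)"
    unfolding hecke_sum_def by (rule sum.reindex_bij_betw [OF bij, symmetric])
  also have "\<dots> = (\<Sum>i\<in>I. cnj (char_mat \<chi>' (\<gamma> i)) * char_mat \<chi>' (G i) *
     (of_real (det (A i) / \<mu>) ^ k * F ((1 / \<mu>) *\<^sub>R (cmat (A i) ** (\<tau> + cmat (S i)) ** cmat (transpose (A i))))))"
  proof (rule sum.cong [OF refl])
    fix i assume i: "i \<in> I"
    have "?C (\<gamma> i) \<noteq> {}" using hecke_group_one [OF \<delta>(3)] by blast
    then have "(SOME g. g \<in> ?C (\<gamma> i)) \<in> ?C (\<gamma> i)" by (simp add: some_in_eq)
    then show "(let g = SOME g. g \<in> ?C (\<gamma> i) in cnj (char_mat \<chi>' g) * slash k F (matrix_inv \<delta> ** g) \<tau>) =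
      cnj (char_mat \<chi>' (\<gamma> i)) * char_mat \<chi>' (G i) *
     (of_real (det (A i) / \<mu>) ^ k * F ((1 / \<mu>) *\<^sub>R (cmat (A i) ** (\<tau> + cmat (S i)) ** cmat (transpose (A i)))))"
      unfolding Let_def by (rule summand [OF i])
  qed
  finally show ?thesis .
qed

section \<open>The Hecke operator at \<open>p\<close>\<close>

text \<open>The integer entries are kept as arguments, so that membership in a group and equality of
  cosets become divisibility statements about integers.\<close>

definition imk2 :: "int \<Rightarrow> int \<Rightarrow> int \<Rightarrow> int \<Rightarrow> real mat2" where
  "imk2 a b c d = mk2 (of_int a) (of_int b) (of_int c) (of_int d)"

lemma imk2_mult: "imk2 a b c d ** imk2 a' b' c' d' =
    imk2 (a * a' + b * c') (a * b' + b * d') (c * a' + d * c') (c * b' + d * d')"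
  by (simp add: imk2_def mk2_mult)

lemma imk2_add: "imk2 a b c d + imk2 a' b' c' d' = imk2 (a + a') (b + b') (c + c') (d + d')"
  by (simp add: imk2_def mk2_add)

lemma imk2_diff: "imk2 a b c d - imk2 a' b' c' d' = imk2 (a - a') (b - b') (c - c') (d - d')"
  by (simp add: imk2_def mk2_diff)

lemma imk2_uminus: "- imk2 a b c d = imk2 (- a) (- b) (- c) (- d)"
  by (simp add: imk2_def mk2_uminus)

lemma imk2_transpose: "transpose (imk2 a b c d) = imk2 a c b d"
  by (simp add: imk2_def transpose_mk2)

lemma imk2_scale: "real N *\<^sub>R imk2 a b c d = imk2 (int N * a) (int N * b) (int N * c) (int N * d)"
  by (simp add: imk2_def mk2_scaleR)

lemma imk2_det: "det (imk2 a b c d) = of_int (a * d - b * c)"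
  by (simp add: imk2_def det_mk2)

lemma imk2_one: "mat 1 = imk2 1 0 0 1"
  by (simp add: imk2_def mat_mk2)

lemma imk2_zero: "0 = imk2 0 0 0 0"
  by (simp add: imk2_def zero_mk2)

lemma imk2_eq_iff: "imk2 a b c d = imk2 a' b' c' d' \<longleftrightarrow> a = a' \<and> b = b' \<and> c = c' \<and> d = d'"
  by (simp add: imk2_def)

lemma imk2_int_mat [simp]: "int_mat (imk2 a b c d)"
  by (simp add: imk2_def int_mat_mk2)

lemma imk2_obtain:
  assumes "int_mat M" obtains a b c d where "M = imk2 a b c d"
  using int_mat_obtain [OF assms] unfolding imk2_def by metis

lemma of_int_div_Ints: "p > 0 \<Longrightarrow> of_int x / real p \<in> \<int> \<longleftrightarrow> int p dvd x"
  using of_int_div_of_int_in_Ints_iff [of x "int p", where 'a = real] by simp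

lemma int_mat_imk2_div: "p > 0 \<Longrightarrow> int_mat ((1 / real p) *\<^sub>R imk2 a b c d) \<longleftrightarrow>
   int p dvd a \<and> int p dvd b \<and> int p dvd c \<and> int p dvd d"
  by (simp add: imk2_def mk2_scaleR int_mat_mk2 of_int_div_Ints)

lemmas imk2_simps = imk2_mult imk2_add imk2_diff imk2_uminus imk2_transpose imk2_scale

lemma Gamma0_imk2: "block (imk2 a1 a2 a3 a4) (imk2 b1 b2 b3 b4) (imk2 (int N * c1) (int N * c2) (int N * c3) (int N * c4)) (imk2 d1 d2 d3 d4) \<in> Gamma0 N \<longleftrightarrow>
   a1*d1 + a3*d3 = 1 + int N * (c1*b1 + c3*b3) \<and> a2*d2 + a4*d4 = 1 + int N * (c2*b2 + c4*b4) \<and>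
   a1*d2 + a3*d4 = int N * (c1*b2 + c3*b4) \<and> a2*d1 + a4*d3 = int N * (c2*b1 + c4*b3) \<and>
   b1*d2 + b3*d4 = b2*d1 + b4*d3 \<and> int N * (a1*c2 + a3*c4) = int N * (a2*c1 + a4*c3)"
  unfolding Gamma0_block symplectic_transpose_relation imk2_scale [symmetric]
  by (auto simp: imk2_simps imk2_one imk2_eq_iff algebra_simps intro!: exI [of _ "imk2 c1 c2 c3 c4"])

lemma Gamma0_imk2_obtain:
  assumes "g \<in> Gamma0 N"
  obtains a1 a2 a3 a4 b1 b2 b3 b4 c1 c2 c3 c4 d1 d2 d3 d4 where
    "g = block (imk2 a1 a2 a3 a4) (imk2 b1 b2 b3 b4) (imk2 (int N * c1) (int N * c2) (int N * c3) (int N * c4)) (imk2 d1 d2 d3 d4)"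
    "a1*b3 + a2*b4 = a3*b1 + a4*b2"
    "a1*d1 + a2*d2 = 1 + int N * (b1*c1 + b2*c2)" "a1*d3 + a2*d4 = int N * (b1*c3 + b2*c4)"
    "a3*d1 + a4*d2 = int N * (b3*c1 + b4*c2)" "a3*d3 + a4*d4 = 1 + int N * (b3*c3 + b4*c4)"
proof -
  obtain A B E D where g: "g = block A B (real N *\<^sub>R E) D" "int_mat A" "int_mat B" "int_mat E" "int_mat D"
    and s: "symplectic g"
    using assms Gamma0_obtain by metis
  obtain a1 a2 a3 a4 where A: "A = imk2 a1 a2 a3 a4" using g imk2_obtain by blast
  obtain b1 b2 b3 b4 where B: "B = imk2 b1 b2 b3 b4" using g imk2_obtain by blast
  obtain c1 c2 c3 c4 where E: "E = imk2 c1 c2 c3 c4" using g imk2_obtain by blast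
  obtain d1 d2 d3 d4 where D: "D = imk2 d1 d2 d3 d4" using g imk2_obtain by blast
  note r = symplectic_row_relation(1,2) [OF s [unfolded g A B E D imk2_scale],
      unfolded imk2_simps imk2_one imk2_eq_iff]
  show ?thesis
  proof (rule that)
    show "g = block (imk2 a1 a2 a3 a4) (imk2 b1 b2 b3 b4) (imk2 (int N * c1) (int N * c2) (int N * c3) (int N * c4)) (imk2 d1 d2 d3 d4)"
      by (simp only: g A B E D imk2_scale)
    show "a1*b3 + a2*b4 = a3*b1 + a4*b2"
      using r(2) [THEN conjunct2, THEN conjunct1] by (simp only: mult.commute)
    have e: "x = y + n * (b * c + b' * c')" if "x - (b * (n * c) + b' * (n * c')) = y"
      for x y n b c b' c' :: int
      using that by (simp add: algebra_simps)
    show "a1*d1 + a2*d2 = 1 + int N * (b1*c1 + b2*c2)"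
      using r(1) [THEN conjunct1] by (rule e)
    show "a1*d3 + a2*d4 = int N * (b1*c3 + b2*c4)"
      using e [OF r(1) [THEN conjunct2, THEN conjunct1]] by simp
    show "a3*d1 + a4*d2 = int N * (b3*c1 + b4*c2)"
      using e [OF r(1) [THEN conjunct2, THEN conjunct2, THEN conjunct1]] by simp
    show "a3*d3 + a4*d4 = 1 + int N * (b3*c3 + b4*c4)"
      using r(1) [THEN conjunct2, THEN conjunct2, THEN conjunct2] by (rule e)
  qed
qed

lemma char_mat_block: "char_mat \<chi>' (block A B C (imk2 d1 d2 d3 d4)) = \<chi>' (d1 * d4 - d2 * d3)"
  unfolding char_mat_def blk_block imk2_det floor_of_int ..

section \<open>Cosets of \<open>delta p\<close> as Lagrangian planes modulo \<open>p\<close>\<close>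

lemma matrix_inv_delta:
  assumes "p > 0"
  shows "matrix_inv (delta p) = block (mk2 (1 / real p) 0 0 (1 / real p)) 0 0 (mat 1)"
  by (rule matrix_inv_unique_right) (use assms in \<open>simp add: delta_def block_mult mat_block mat_mk2 mk2_simps\<close>)

lemma det_delta: "p > 0 \<Longrightarrow> det (delta p) \<noteq> 0"
proof -
  assume p: "p > 0"
  have "delta p ** block (mk2 (1 / real p) 0 0 (1 / real p)) 0 0 (mat 1) = mat 1"
    using p by (simp add: delta_def block_mult mat_block mat_mk2 mk2_simps)
  then show ?thesis by (metis det_I det_mul mult_zero_left zero_neq_one)
qed

text \<open>Conjugation by \<open>delta p\<close> multiplies \<open>B\<close> by \<open>p\<close>
  and divides \<open>C\<close> by \<open>p\<close>. Undoing it multiplies \<open>C\<close> by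
  \<open>p\<close>, which keeps divisibility by \<open>N\<close>; hence the condition concerns
  \<open>B\<close> alone.\<close>

lemma hecke_group_delta:
  assumes p: "p > 0" and h: "block A B C D \<in> Gamma0 N"
  shows "block A B C D \<in> hecke_group N (delta p) \<longleftrightarrow> int_mat ((1 / real p) *\<^sub>R B)"
proof -
  have conj: "delta p ** block A' B' C' D' ** matrix_inv (delta p) =
     block A' (real p *\<^sub>R B') ((1 / real p) *\<^sub>R C') D'" for A' B' C' D'
    unfolding matrix_inv_delta [OF p]
    unfolding delta_def block_mult matrix_mult_zero add_0 add_0_right block_eq_iff
    using p by (simp add: mat2_eq_iff matrix_matrix_mult_def sum_2 mat_mk2)
  show ?thesis
  proof
    assume "block A B C D \<in> hecke_group N (delta p)"
    then obtain g where g: "block A B C D = delta p ** g ** matrix_inv (delta p)" "g \<in> Gamma0 N"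
      by (auto simp: hecke_group_def)
    obtain A' B' C' D' where g': "g = block A' B' C' D'" by (metis block_blk)
    have "(1 / real p) *\<^sub>R B = B'" using g(1) p by (simp add: g' conj)
    then show "int_mat ((1 / real p) *\<^sub>R B)" using g(2) by (simp add: g' Gamma0_block)
  next
    assume i: "int_mat ((1 / real p) *\<^sub>R B)"
    define B' where "B' = (1 / real p) *\<^sub>R B"
    have B: "B = real p *\<^sub>R B'" using p by (simp add: B'_def)
    obtain E where E: "int_mat E" "C = real N *\<^sub>R E" using h by (auto simp: Gamma0_block)
    have "block A B' (real p *\<^sub>R C) D \<in> Gamma0 N"
      unfolding Gamma0_block
    proof (intro conjI)
      have tr: "transpose (real p *\<^sub>R X) = real p *\<^sub>R transpose X" for X :: "real mat2"
        by (simp add: transpose_def vec_eq_iff)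
      show "symplectic (block A B' (real p *\<^sub>R C) D)"
        using h p unfolding Gamma0_block symplectic_transpose_relation B
        by (simp add: tr scaleR_mult_left scaleR_mult_right)
      show "\<exists>C'. int_mat C' \<and> real p *\<^sub>R C = real N *\<^sub>R C'"
        using E by (intro exI [of _ "real p *\<^sub>R E"]) (auto simp: int_mat_def)
    qed (use h i in \<open>auto simp: Gamma0_block B'_def\<close>)
    moreover have "block A B C D = delta p ** block A B' (real p *\<^sub>R C) D ** matrix_inv (delta p)"
      unfolding conj using p by (simp add: B)
    ultimately show "block A B C D \<in> hecke_group N (delta p)"
      using h unfolding hecke_group_def by blast
  qed
qed

text \<open>The matrix on the right is the upper right block of one element times the inverse of the
  other: the symplectic pairings of their upper rows. These vanish modulo \<open>p\<close> exactly
  when the two Lagrangian planes spanned by the upper rows coincide.\<close>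

lemma coset_delta_iff:
  assumes p: "p > 0" and "block A B C D \<in> Gamma0 N" "block A' B' C' D' \<in> Gamma0 N"
  shows "(\<exists>h\<in>hecke_group N (delta p). block A B C D = h ** block A' B' C' D') \<longleftrightarrow>
     int_mat ((1 / real p) *\<^sub>R (B ** transpose A' - A ** transpose B'))"
proof -
  let ?g = "block A B C D" and ?g' = "block A' B' C' D'"
  have h: "?g ** sp_inv ?g' = block (A ** transpose D' - B ** transpose C') (B ** transpose A' - A ** transpose B')
      (C ** transpose D' - D ** transpose C') (D ** transpose A' - C ** transpose B')"
    by (simp add: sp_inv_def block_mult matrix_minus_right)
  show ?thesis
    unfolding hecke_coset_member_iff [OF assms(3)] h
    by (rule hecke_group_delta [OF p Gamma0_mult [OF assms(2) Gamma0_sp_inv [OF assms(3)], unfolded h]])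
qed

text \<open>Representatives of the lines of \<open>\<bbbF>\<^sub>p\<^sup>2\<close>, each completed to a matrix of determinant one with first row
  \<open>(line_a i, line_b i)\<close>; \<open>None\<close> is the line spanned by \<open>(0, 1)\<close>.\<close>

definition line_a :: "int option \<Rightarrow> int" where "line_a i = (case i of None \<Rightarrow> 0 | Some u \<Rightarrow> 1)"
definition line_b :: "int option \<Rightarrow> int" where "line_b i = (case i of None \<Rightarrow> 1 | Some u \<Rightarrow> u)"
definition line_c :: "int option \<Rightarrow> int" where "line_c i = (case i of None \<Rightarrow> - 1 | Some u \<Rightarrow> 0)"
definition line_d :: "int option \<Rightarrow> int" where "line_d i = (case i of None \<Rightarrow> 0 | Some u \<Rightarrow> 1)"

definition lines :: "nat \<Rightarrow> int option set" where
  "lines p = insert None (Some ` {0..<int p})"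

lemma line_det: "line_a i * line_d i - line_b i * line_c i = 1"
  by (cases i) (auto simp: line_a_def line_b_def line_c_def line_d_def)

text \<open>The two combinations are the coordinates of \<open>(a, a')\<close> in the unimodular
  basis formed by the rows \<open>(line_a i, line_b i)\<close> and
  \<open>(line_c i, line_d i)\<close>.\<close>

lemma line_coordinates_dvd:
  assumes "int p dvd a * line_d i - a' * line_c i" "int p dvd a' * line_a i - a * line_b i"
  shows "int p dvd a \<and> int p dvd a'"
proof -
  have "(a * line_d i - a' * line_c i) * line_a i + (a' * line_a i - a * line_b i) * line_c i =
      a * (line_a i * line_d i - line_b i * line_c i)"
    "(a * line_d i - a' * line_c i) * line_b i + (a' * line_a i - a * line_b i) * line_d i =
      a' * (line_a i * line_d i - line_b i * line_c i)"
    by (simp_all add: algebra_simps)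
  then show ?thesis
    using assms unfolding line_det mult_1_right by (metis dvd_add dvd_mult2)
qed

lemma line_separated:
  assumes "prime p" "i \<in> lines p" "j \<in> lines p" "int p dvd line_a i * line_b j - line_b i * line_a j"
  shows "i = j"
proof -
  have p: "\<not> int p dvd 1" using assms prime_gt_1_nat by auto
  have eq: "x = y" if "x \<in> {0..<int p}" "y \<in> {0..<int p}" "int p dvd x - y" for x y
    using that zdvd_imp_le [of "int p" "\<bar>x - y\<bar>"] by (cases "x = y") auto
  show ?thesis
    using assms p eq
    by (auto simp: lines_def line_a_def line_b_def dvd_minus_iff [of _ 1, simplified] dest: dvd_diff_commute [THEN iffD1])
qed

text \<open>The exponent \<open>Suc n\<close> lets one statement serve both moduli, \<open>p\<close>
  and \<open>p ^ 2\<close>.\<close>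

lemma residue_exists:
  assumes "prime p" "\<not> int p dvd x"
  shows "\<exists>s\<in>{0..<int p ^ Suc n}. int p ^ Suc n dvd y - x * s"
proof -
  have "coprime x (int p)"
    using assms prime_imp_coprime [of "int p" x] by (simp add: coprime_commute)
  then have "coprime x (int p ^ Suc n)"
    by (meson coprime_power_right_iff)
  then obtain z where z: "[x * z = 1] (mod int p ^ Suc n)"
    using cong_solve_coprime_int by blast
  have pos: "int p ^ Suc n > 0" using assms(1) prime_gt_0_nat by auto
  have "[x * ((z * y) mod int p ^ Suc n) = x * (z * y)] (mod int p ^ Suc n)"
    by (intro cong_mult cong_refl) (simp add: cong_def)
  also have "[x * (z * y) = y] (mod int p ^ Suc n)"
    using cong_mult [OF z cong_refl [of y]] by (simp add: mult.assoc)
  finally have "int p ^ Suc n dvd y - x * ((z * y) mod int p ^ Suc n)"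
    by (metis cong_iff_dvd_diff cong_sym)
  then show ?thesis using pos by (intro bexI [of _ "(z * y) mod int p ^ Suc n"]) auto
qed

lemma line_exists:
  assumes "prime p"
  shows "\<exists>i\<in>lines p. int p dvd y * line_a i - x * line_b i"
proof (cases "int p dvd x")
  case True
  then show ?thesis by (intro bexI [of _ None]) (auto simp: lines_def line_a_def line_b_def)
next
  case False
  then obtain u where "u \<in> {0..<int p}" "int p dvd y - x * u"
    using residue_exists [OF assms False, of 0 y] by auto
  then show ?thesis by (intro bexI [of _ "Some u"]) (auto simp: lines_def line_a_def line_b_def)
qed

lemma residue_unique:
  assumes "int p dvd x - y" "x \<in> {0..<int p}" "y \<in> {0..<int p}"
  shows "x = y"
proof (rule ccontr)
  assume "x \<noteq> y"
  then have "int p \<le> \<bar>x - y\<bar>"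
    using assms(1) zdvd_imp_le [of "int p" "\<bar>x - y\<bar>"] by simp
  then show False using assms by auto
qed

lemma coset_delta_imk2:
  assumes p: "p > 0"
    and "block (imk2 a1 a2 a3 a4) (imk2 b1 b2 b3 b4) C D \<in> Gamma0 N"
    and "block (imk2 a1' a2' a3' a4') (imk2 b1' b2' b3' b4') C' D' \<in> Gamma0 N"
  shows "(\<exists>h\<in>hecke_group N (delta p). block (imk2 a1 a2 a3 a4) (imk2 b1 b2 b3 b4) C D =
        h ** block (imk2 a1' a2' a3' a4') (imk2 b1' b2' b3' b4') C' D') \<longleftrightarrow>
    int p dvd b1*a1' + b2*a2' - (a1*b1' + a2*b2') \<and> int p dvd b1*a3' + b2*a4' - (a1*b3' + a2*b4') \<and>
    int p dvd b3*a1' + b4*a2' - (a3*b1' + a4*b2') \<and> int p dvd b3*a3' + b4*a4' - (a3*b3' + a4*b4')"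
  unfolding coset_delta_iff [OF assms] imk2_simps int_mat_imk2_div [OF p] ..

section \<open>A transversal for \<open>delta p\<close>\<close>

type_synonym delta_index = "(int \<times> int \<times> int) + (int option \<times> int) + unit"

text \<open>The three kinds number \<open>p ^ 3\<close>, \<open>p * (p + 1)\<close> and 1, together
  the \<open>(p + 1) * (p ^ 2 + 1)\<close> Lagrangian planes. When \<open>p\<close> divides
  \<open>N\<close>, the block \<open>A\<close> is invertible modulo \<open>p\<close> and only the
  first kind occurs.\<close>

definition delta_indices :: "nat \<Rightarrow> nat \<Rightarrow> delta_index set" where
  "delta_indices N p = ({0..<int p} \<times> {0..<int p} \<times> {0..<int p}) <+>
     (if p dvd N then {} else (lines p \<times> {0..<int p}) <+> {()})"

definition unip :: "int \<Rightarrow> int \<Rightarrow> int \<Rightarrow> real mat4" where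
  "unip x y z = block (imk2 1 0 0 1) (imk2 x y y z) (imk2 0 0 0 0) (imk2 1 0 0 1)"

definition levi :: "int option \<Rightarrow> real mat4" where
  "levi i = block (imk2 (line_a i) (line_b i) (line_c i) (line_d i)) (imk2 0 0 0 0) (imk2 0 0 0 0)
     (imk2 (line_d i) (- line_c i) (- line_b i) (line_a i))"

lemma Gamma0_imk2_intro: 
  assumes "int N * c1' = c1" "int N * c2' = c2" "int N * c3' = c3" "int N * c4' = c4"
    "a1*d1 + a3*d3 = 1 + (c1*b1 + c3*b3)" "a2*d2 + a4*d4 = 1 + (c2*b2 + c4*b4)"
    "a1*d2 + a3*d4 = (c1*b2 + c3*b4)" "a2*d1 + a4*d3 = (c2*b1 + c4*b3)"
    "b1*d2 + b3*d4 = b2*d1 + b4*d3" "a1*c2 + a3*c4 = a2*c1 + a4*c3"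
  shows "block (imk2 a1 a2 a3 a4) (imk2 b1 b2 b3 b4) (imk2 c1 c2 c3 c4) (imk2 d1 d2 d3 d4) \<in> Gamma0 N"
  using assms Gamma0_imk2 [of a1 a2 a3 a4 b1 b2 b3 b4 N c1' c2' c3' c4' d1 d2 d3 d4]
  by (simp add: algebra_simps)

lemma unip_Gamma0: "unip x y z \<in> Gamma0 N"
  unfolding unip_def by (rule Gamma0_imk2_intro [of _ 0 _ 0 _ 0 _ 0]) auto

lemma levi_Gamma0: "levi i \<in> Gamma0 N"
  unfolding levi_def
  by (rule Gamma0_imk2_intro [of _ 0 _ 0 _ 0 _ 0]) (use line_det [of i] in \<open>auto simp: algebra_simps\<close>)

text \<open>A coset is determined by the Lagrangian subspace of \<open>\<bbbF>\<^sub>p\<^sup>4\<close> spanned by the two top rows \<open>(A B)\<close>; the three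
  clauses are the cases where \<open>A\<close> has rank 2, 1 and 0 modulo \<open>p\<close>. The integers \<open>t\<close> and \<open>e\<close> satisfy
  \<open>p e - N t = 1\<close>.\<close>

fun delta_rep :: "nat \<Rightarrow> nat \<Rightarrow> int \<Rightarrow> int \<Rightarrow> delta_index \<Rightarrow> real mat4" where
  "delta_rep N p t e (Inl (x, y, z)) = unip x y z"
| "delta_rep N p t e (Inr (Inl (i, s))) =
     block (imk2 (line_a i) (line_b i) (int p * line_c i) (int p * line_d i))
       (imk2 (s * line_d i) (- s * line_c i) (- t * line_b i) (t * line_a i))
       (imk2 0 0 (int N * line_c i) (int N * line_d i))
       (imk2 (line_d i) (- line_c i) (- e * line_b i) (e * line_a i))"
| "delta_rep N p t e (Inr (Inr _)) =
     block (imk2 (int p) 0 0 (int p)) (imk2 t 0 0 t) (imk2 (int N) 0 0 (int N)) (imk2 e 0 0 e)"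

lemma delta_rep_Gamma0:
  assumes "i \<in> Inr ` UNIV \<Longrightarrow> int p * e - int N * t = 1"
  shows "delta_rep N p t e i \<in> Gamma0 N"
proof (cases i)
  case (Inl q)
  then show ?thesis by (cases q) (simp add: unip_Gamma0)
next
  case (Inr q)
  have e: "int p * e = 1 + int N * t" using assms Inr by simp
  show ?thesis
  proof (cases q)
    case (Inl r)
    obtain j s where r: "r = (j, s)" by (cases r)
    \<comment> \<open>The matrix \<open>(p, t; N, e)\<close> of determinant one acts in the second
      coordinate, the translation by \<open>s\<close> in the first, and \<open>levi j\<close>
      changes the basis so that the first coordinate becomes the line \<open>j\<close>.\<close>
    have "block (imk2 1 0 0 (int p)) (imk2 0 0 0 t) (imk2 0 0 0 (int N)) (imk2 1 0 0 e) \<in> Gamma0 N"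
      by (rule Gamma0_imk2_intro [of _ 0 _ 0 _ 0 _ 1]) (use e in auto)
    then have "block (imk2 1 0 0 (int p)) (imk2 0 0 0 t) (imk2 0 0 0 (int N)) (imk2 1 0 0 e) ** unip s 0 0 ** levi j \<in> Gamma0 N"
      by (intro Gamma0_mult unip_Gamma0 levi_Gamma0)
    also have "block (imk2 1 0 0 (int p)) (imk2 0 0 0 t) (imk2 0 0 0 (int N)) (imk2 1 0 0 e) ** unip s 0 0 ** levi j
        = delta_rep N p t e i"
      by (simp add: Inr Inl r unip_def levi_def block_mult imk2_simps imk2_eq_iff)
    finally show ?thesis .
  next
    case (Inr r)
    show ?thesis
      by (simp add: \<open>i = Inr q\<close> Inr, rule Gamma0_imk2_intro [of _ 1 _ 0 _ 0 _ 1]) (use e in \<open>auto simp: mult.commute\<close>)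
  qed
qed

text \<open>Different kinds have \<open>A\<close> blocks of different rank modulo \<open>p\<close>;
  in the pairing criterion this appears as \<open>p\<close> dividing \<open>t\<close>, or
  \<open>t\<close> times a primitive line vector, although \<open>t\<close> is a unit modulo
  \<open>p\<close>. Within one kind the pairings recover the parameters.\<close>

lemma delta_rep_disjoint:
  assumes p: "prime p" and e: "\<not> p dvd N \<Longrightarrow> int p * e - int N * t = 1"
    and ij: "i \<in> delta_indices N p" "j \<in> delta_indices N p"
    and h: "h \<in> hecke_group N (delta p)" "delta_rep N p t e i = h ** delta_rep N p t e j"
  shows "i = j"
proof -
  have p0: "p > 0" using p prime_gt_0_nat by blast
  have pp: "prime (int p)" using p by simp
  have G: "delta_rep N p t e i \<in> Gamma0 N" if "i \<in> delta_indices N p" for i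
    using that e by (intro delta_rep_Gamma0) (auto simp: delta_indices_def split: if_splits)
  note G' = G [OF ij(1)] G [OF ij(2)]
  have ex: "\<exists>h\<in>hecke_group N (delta p). delta_rep N p t e i = h ** delta_rep N p t e j"
    using h by blast
  have t: "\<not> int p dvd t" if "\<not> p dvd N"
  proof
    assume "int p dvd t"
    then have "int p dvd int p * e - int N * t" by auto
    then show False using e that p0 p by (auto simp: prime_nat_iff)
  qed
  have ab: False if "\<not> p dvd N" "int p dvd line_a u * t" "int p dvd line_b u * t" for u
  proof -
    have "int p dvd line_a u" "int p dvd line_b u"
      using that t prime_dvd_mult_iff [OF pp] by auto
    then have "int p dvd line_a u * line_d u - line_b u * line_c u" by simp
    then show False using p by (simp add: line_det)
  qed
  \<comment> \<open>Lying in a common coset is symmetric, so each unordered pair of kinds needs only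
    one argument.\<close>
  note ex' = ex [unfolded hecke_coset_sym [OF det_delta [OF p0], of N "delta_rep N p t e i"]]
  have unip_mixed: False
    if nd: "\<not> p dvd N" and G: "delta_rep N p t e (Inl q) \<in> Gamma0 N" "delta_rep N p t e (Inr (Inl q')) \<in> Gamma0 N"
    and R: "\<exists>h\<in>hecke_group N (delta p). delta_rep N p t e (Inl q) = h ** delta_rep N p t e (Inr (Inl q'))" for q q'
  proof -
    obtain x y z u s where q: "q = (x, y, z)" "q' = (u, s)" by (cases q; cases q')
    have "int p dvd x * (int p * line_c u) + y * (int p * line_d u) + t * line_b u"
      "int p dvd y * (int p * line_c u) + z * (int p * line_d u) - t * line_a u"
      using R unfolding q delta_rep.simps unip_def coset_delta_imk2 [OF p0 G [unfolded q delta_rep.simps unip_def]]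
      by simp_all
    then have "int p dvd line_a u * t" "int p dvd line_b u * t"
      by (simp_all add: dvd_add_right_iff dvd_diff_right_iff mult.commute)
    then show False using ab nd by blast
  qed
  have unip_scalar: False
    if nd: "\<not> p dvd N" and G: "delta_rep N p t e (Inl q) \<in> Gamma0 N" "delta_rep N p t e (Inr (Inr q')) \<in> Gamma0 N"
    and R: "\<exists>h\<in>hecke_group N (delta p). delta_rep N p t e (Inl q) = h ** delta_rep N p t e (Inr (Inr q'))" for q q'
  proof -
    obtain x y z where q: "q = (x, y, z)" by (cases q)
    have "int p dvd x * int p - t"
      using R unfolding q delta_rep.simps unip_def coset_delta_imk2 [OF p0 G [unfolded q delta_rep.simps unip_def]]
      by simp_all
    then show False using t nd by (simp add: dvd_diff_right_iff)
  qed
  have mixed_scalar: False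
    if nd: "\<not> p dvd N" and G: "delta_rep N p t e (Inr (Inl q)) \<in> Gamma0 N" "delta_rep N p t e (Inr (Inr q')) \<in> Gamma0 N"
    and R: "\<exists>h\<in>hecke_group N (delta p). delta_rep N p t e (Inr (Inl q)) = h ** delta_rep N p t e (Inr (Inr q'))" for q q'
  proof -
    obtain u s where q: "q = (u, s)" by (cases q)
    have "int p dvd s * line_d u * int p - line_a u * t" "int p dvd - s * line_c u * int p - line_b u * t"
      using R unfolding q delta_rep.simps coset_delta_imk2 [OF p0 G [unfolded q delta_rep.simps]]
      by simp_all
    then have "int p dvd line_a u * t" "int p dvd line_b u * t"
      by (simp_all add: dvd_diff_right_iff)
    then show False using ab nd by blast
  qed
  have nd: "\<not> p dvd N" if "i = Inr q \<or> j = Inr q" for q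
    using that ij by (auto simp: delta_indices_def split: if_splits)
  consider (unip) q q' where "i = Inl q" "j = Inl q'"
    | (mixed) q q' where "i = Inr (Inl q)" "j = Inr (Inl q')"
    | (scalar) "i = Inr (Inr ())" "j = Inr (Inr ())"
    | (different) q q' where "i = Inl q \<and> j = Inr q' \<or> i = Inr q' \<and> j = Inl q"
    | (different') q q' where "i = Inr (Inl q) \<and> j = Inr (Inr q') \<or> i = Inr (Inr q') \<and> j = Inr (Inl q)"
  proof (cases i)
    case (Inl q)
    then show thesis using that(1,4) by (cases j) blast+
  next
    case i: (Inr q)
    show thesis
    proof (cases j)
      case (Inl q')
      then show thesis using i that(4) by blast
    next
      case (Inr q')
      then show thesis using i that(2,3,5) by (cases q; cases q') auto
    qed
  qed
  then show ?thesis
  proof cases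
    case unip
    obtain x y z x' y' z' where q: "q = (x, y, z)" "q' = (x', y', z')" by (cases q; cases q')
    have mem: "x \<in> {0..<int p}" "y \<in> {0..<int p}" "z \<in> {0..<int p}" "x' \<in> {0..<int p}" "y' \<in> {0..<int p}" "z' \<in> {0..<int p}"
      using ij by (auto simp: unip q delta_indices_def)
    have "int p dvd x - x'" "int p dvd y - y'" "int p dvd z - z'"
      using ex unfolding unip q delta_rep.simps unip_def coset_delta_imk2 [OF p0 G' [unfolded unip q delta_rep.simps unip_def]]
      by simp_all
    then show ?thesis
      using mem residue_unique by (auto simp: unip q)
  next
    case mixed
    obtain u s u' s' where q: "q = (u, s)" "q' = (u', s')" by (cases q; cases q')
    have mem: "u \<in> lines p" "s \<in> {0..<int p}" "u' \<in> lines p" "s' \<in> {0..<int p}"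
      using ij by (auto simp: mixed q delta_indices_def split: if_splits)
    have d1: "int p dvd s * line_d u * (int p * line_c u') + - s * line_c u * (int p * line_d u') -
        (line_a u * (- t * line_b u') + line_b u * (t * line_a u'))"
      and d2: "int p dvd s * line_d u * line_a u' + - s * line_c u * line_b u' -
        (line_a u * (s' * line_d u') + line_b u * (- s' * line_c u'))"
      using ex unfolding mixed q delta_rep.simps coset_delta_imk2 [OF p0 G' [unfolded mixed q delta_rep.simps]]
      by blast+
    \<comment> \<open>Modulo \<open>p\<close> only \<open>t\<close> times the determinant of the two
      line vectors survives.\<close>
    have "s * line_d u * (int p * line_c u') + - s * line_c u * (int p * line_d u') -
        (line_a u * (- t * line_b u') + line_b u * (t * line_a u')) =
        int p * (s * line_d u * line_c u' - s * line_c u * line_d u') + t * (line_a u * line_b u' - line_b u * line_a u')"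
      by (simp add: algebra_simps)
    then have "int p dvd t * (line_a u * line_b u' - line_b u * line_a u')"
      using d1 by (simp add: dvd_add_right_iff)
    then have u: "u = u'"
      using t nd mixed prime_dvd_mult_iff [OF pp] line_separated [OF p mem(1,3)] by blast
    have "s * line_d u * line_a u + - s * line_c u * line_b u -
        (line_a u * (s' * line_d u) + line_b u * (- s' * line_c u)) = (s - s') * (line_a u * line_d u - line_b u * line_c u)"
      by (simp add: algebra_simps)
    then have "int p dvd s - s'" using d2 by (simp add: u line_det)
    then show ?thesis using u mem residue_unique by (auto simp: mixed q)
  next
    case different
    then have "\<not> p dvd N" using nd by blast
    then show ?thesis
      using different ex ex' G' unip_mixed unip_scalar by (cases q') blast+
  next
    case different'
    then have "\<not> p dvd N" using nd by blast
    then show ?thesis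
      using different' ex ex' G' mixed_scalar by blast
  qed simp
qed

text \<open>The vectors \<open>(x1, x2)\<close> and \<open>(y1, y2)\<close> are proportional modulo
  \<open>p\<close> and the first is nonzero there. A coordinate that is a unit fixes the factor, and
  the vanishing determinant carries it over to the other coordinate.\<close>

lemma common_residue_exists:
  assumes p: "prime p" and nz: "\<not> int p dvd x1 \<or> \<not> int p dvd x2" and d: "int p dvd x1 * y2 - x2 * y1"
  shows "\<exists>s\<in>{0..<int p}. int p dvd y1 - x1 * s \<and> int p dvd y2 - x2 * s"
proof -
  have pp: "prime (int p)" using p by simp
  have *: "\<exists>s\<in>{0..<int p}. int p dvd y1 - x1 * s \<and> int p dvd y2 - x2 * s"
    if x1: "\<not> int p dvd x1" and d: "int p dvd x1 * y2 - x2 * y1" for x1 x2 y1 y2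
  proof -
    obtain s where s: "s \<in> {0..<int p}" "int p dvd y1 - x1 * s"
      using residue_exists [OF p x1, of 0 y1] by auto
    have "x1 * (y2 - x2 * s) = (x1 * y2 - x2 * y1) + x2 * (y1 - x1 * s)"
      by (simp add: algebra_simps)
    then have "int p dvd x1 * (y2 - x2 * s)" using d s by simp
    then show ?thesis using s x1 prime_dvd_mult_iff [OF pp] by blast
  qed
  have "int p dvd x2 * y1 - x1 * y2"
    using d by (simp add: dvd_diff_commute)
  then show ?thesis using * [of x1 y2 x2 y1] * [of x2 y1 x1 y2] nz d by blast
qed

text \<open>The rows of a matrix that is singular modulo \<open>p\<close> lie on a common line. The
  first row determines it unless it vanishes modulo \<open>p\<close>, and then the second row may
  choose.\<close>

lemma common_line_exists:
  assumes p: "prime p" and d: "int p dvd a1 * a4 - a2 * a3"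
  shows "\<exists>i\<in>lines p. int p dvd a2 * line_a i - a1 * line_b i \<and> int p dvd a4 * line_a i - a3 * line_b i"
proof -
  have pp: "prime (int p)" using p by simp
  have *: "\<exists>i\<in>lines p. int p dvd a2 * line_a i - a1 * line_b i \<and> int p dvd a4 * line_a i - a3 * line_b i"
    if nz: "\<not> int p dvd a1 \<or> \<not> int p dvd a2" and d: "int p dvd a1 * a4 - a2 * a3" for a1 a2 a3 a4
  proof -
    obtain i where i: "i \<in> lines p" "int p dvd a2 * line_a i - a1 * line_b i"
      using line_exists [OF p] by blast
    have "a1 * (a4 * line_a i - a3 * line_b i) = line_a i * (a1 * a4 - a2 * a3) + a3 * (a2 * line_a i - a1 * line_b i)"
      "a2 * (a4 * line_a i - a3 * line_b i) = line_b i * (a1 * a4 - a2 * a3) + a4 * (a2 * line_a i - a1 * line_b i)"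
      by (simp_all add: algebra_simps)
    then have "int p dvd a1 * (a4 * line_a i - a3 * line_b i)" "int p dvd a2 * (a4 * line_a i - a3 * line_b i)"
      using d i by simp_all
    then show ?thesis using nz i prime_dvd_mult_iff [OF pp] by blast
  qed
  show ?thesis
  proof (cases "int p dvd a1 \<and> int p dvd a2")
    case True
    then show ?thesis
      using line_exists [OF p, of a4 a3] by (meson dvd_diff dvd_mult2)
  next
    case False
    then show ?thesis using * [of a1 a2 a4 a3] d by blast
  qed
qed

lemma delta_rep_cover:
  assumes p: "prime p" and e: "\<not> p dvd N \<Longrightarrow> int p * e - int N * t = 1" and g: "g \<in> Gamma0 N"
  shows "\<exists>i\<in>delta_indices N p. \<exists>h\<in>hecke_group N (delta p). g = h ** delta_rep N p t e i"
proof -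
  have p0: "p > 0" using p prime_gt_0_nat by blast
  have pp: "prime (int p)" using p by simp
  have G: "delta_rep N p t e i \<in> Gamma0 N" if "i \<in> delta_indices N p" for i
    using that e by (intro delta_rep_Gamma0) (auto simp: delta_indices_def split: if_splits)
  obtain a1 a2 a3 a4 b1 b2 b3 b4 c1 c2 c3 c4 d1 d2 d3 d4 where
    ge: "g = block (imk2 a1 a2 a3 a4) (imk2 b1 b2 b3 b4) (imk2 (int N * c1) (int N * c2) (int N * c3) (int N * c4)) (imk2 d1 d2 d3 d4)"
    and sym: "a1*b3 + a2*b4 = a3*b1 + a4*b2"
    and r: "a1*d1 + a2*d2 = 1 + int N * (b1*c1 + b2*c2)" "a1*d3 + a2*d4 = int N * (b1*c3 + b2*c4)"
    "a3*d1 + a4*d2 = int N * (b3*c1 + b4*c2)" "a3*d3 + a4*d4 = 1 + int N * (b3*c3 + b4*c4)"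
    using g Gamma0_imk2_obtain by (metis (no_types, lifting))
  define \<Delta> where "\<Delta> = a1 * a4 - a2 * a3"
  note crit = coset_delta_imk2 [OF p0 g [unfolded ge]]
  consider (1) "\<not> int p dvd \<Delta>" | (2) "int p dvd \<Delta>" "int p dvd a1" "int p dvd a2" "int p dvd a3" "int p dvd a4"
    | (3) "int p dvd \<Delta>" "\<not> (int p dvd a1 \<and> int p dvd a2 \<and> int p dvd a3 \<and> int p dvd a4)"
    by blast
  then show ?thesis
  proof cases
    case 1
    \<comment> \<open>Rank 2: the translation is the solution \<open>S\<close> of
      \<open>A ** S = B\<close> modulo \<open>p\<close>, computed by Cramer's rule. The relation
      \<open>sym\<close> makes \<open>S\<close> symmetric, which is the content of
      \<open>y'\<close>.\<close>
    obtain x where x: "x \<in> {0..<int p}" "int p dvd (a4*b1 - a2*b3) - \<Delta> * x"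
      using residue_exists [OF p 1, of 0] by fastforce
    obtain y where y: "y \<in> {0..<int p}" "int p dvd (a1*b3 - a3*b1) - \<Delta> * y"
      using residue_exists [OF p 1, of 0] by fastforce
    obtain z where z: "z \<in> {0..<int p}" "int p dvd (a1*b4 - a3*b2) - \<Delta> * z"
      using residue_exists [OF p 1, of 0] by fastforce
    have y': "int p dvd (a4*b2 - a2*b4) - \<Delta> * y"
    proof -
      have "a4*b2 - a2*b4 = a1*b3 - a3*b1" using sym by simp
      then show ?thesis using y by simp
    qed
    have i: "Inl (x, y, z) \<in> delta_indices N p"
      using x y z by (auto simp: delta_indices_def)
    have "\<Delta> * (b1 - (a1*x + a2*y)) = a1 * ((a4*b1 - a2*b3) - \<Delta>*x) + a2 * ((a1*b3 - a3*b1) - \<Delta>*y)"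
      "\<Delta> * (b2 - (a1*y + a2*z)) = a1 * ((a4*b2 - a2*b4) - \<Delta>*y) + a2 * ((a1*b4 - a3*b2) - \<Delta>*z)"
      "\<Delta> * (b3 - (a3*x + a4*y)) = a3 * ((a4*b1 - a2*b3) - \<Delta>*x) + a4 * ((a1*b3 - a3*b1) - \<Delta>*y)"
      "\<Delta> * (b4 - (a3*y + a4*z)) = a3 * ((a4*b2 - a2*b4) - \<Delta>*y) + a4 * ((a1*b4 - a3*b2) - \<Delta>*z)"
      by (simp_all add: \<Delta>_def algebra_simps)
    then have "int p dvd \<Delta> * (b1 - (a1*x + a2*y))" "int p dvd \<Delta> * (b2 - (a1*y + a2*z))"
      "int p dvd \<Delta> * (b3 - (a3*x + a4*y))" "int p dvd \<Delta> * (b4 - (a3*y + a4*z))"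
      using x y y' z by simp_all
    then have "int p dvd b1 - (a1*x + a2*y)" "int p dvd b2 - (a1*y + a2*z)"
      "int p dvd b3 - (a3*x + a4*y)" "int p dvd b4 - (a3*y + a4*z)"
      using 1 prime_dvd_mult_iff [OF pp] by blast+
    then have "\<exists>h\<in>hecke_group N (delta p). g = h ** delta_rep N p t e (Inl (x, y, z))"
      using crit [OF G [OF i, unfolded delta_rep.simps unip_def]]
      unfolding ge delta_rep.simps unip_def by simp
    then show ?thesis using i by blast
  next
    case 2
    \<comment> \<open>If \<open>p\<close> divided \<open>A\<close> and \<open>N\<close>, it would
      divide a diagonal entry of \<open>A ** transpose D - B ** transpose C\<close>, which is
      1.\<close>
    have nd: "\<not> p dvd N"
    proof
      assume "p dvd N"
      then have "int p dvd int N" by simp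
      then have "int p dvd (a1*d1 + a2*d2) - int N * (b1*c1 + b2*c2)"
        using 2 by simp
      then show False using p by (simp add: r)
    qed
    have i: "Inr (Inr ()) \<in> delta_indices N p"
      using nd by (auto simp: delta_indices_def)
    have "\<exists>h\<in>hecke_group N (delta p). g = h ** delta_rep N p t e (Inr (Inr ()))"
      using crit [OF G [OF i, unfolded delta_rep.simps]] 2
      unfolding ge delta_rep.simps by simp
    then show ?thesis using i by blast
  next
    case 3
    \<comment> \<open>If \<open>p\<close> divided \<open>N\<close>, then
      \<open>det A * det D\<close> would be 1 modulo \<open>p\<close>, although \<open>det A\<close>
      is divisible by \<open>p\<close>.\<close>
    have nd: "\<not> p dvd N"
    proof
      assume "p dvd N"
      then have N: "int p dvd int N" by simp
      have "\<Delta> * (d1*d4 - d2*d3) = (a1*d1 + a2*d2) * (a3*d3 + a4*d4) - (a1*d3 + a2*d4) * (a3*d1 + a4*d2)"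
        by (simp add: \<Delta>_def algebra_simps)
      also have "\<dots> = 1 + int N * ((b1*c1 + b2*c2) + (b3*c3 + b4*c4) + (b1*c1 + b2*c2) * (int N * (b3*c3 + b4*c4))
          - (b1*c3 + b2*c4) * (int N * (b3*c1 + b4*c2)))"
        unfolding r by (simp add: algebra_simps)
      finally have "1 = \<Delta> * (d1*d4 - d2*d3) - int N * ((b1*c1 + b2*c2) + (b3*c3 + b4*c4) + (b1*c1 + b2*c2) * (int N * (b3*c3 + b4*c4))
          - (b1*c3 + b2*c4) * (int N * (b3*c1 + b4*c2)))"
        by simp
      also have "int p dvd \<dots>"
        using 3(1) N by (intro dvd_diff dvd_mult2)
      finally show False using p by simp
    qed
    obtain i where i: "i \<in> lines p"
      and z: "int p dvd a2 * line_a i - a1 * line_b i" "int p dvd a4 * line_a i - a3 * line_b i"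
      using common_line_exists [OF p 3(1) [unfolded \<Delta>_def]] by blast
    \<comment> \<open>Modulo \<open>p\<close> the rows of \<open>A\<close> are \<open>x1\<close> and
      \<open>x2\<close> times the line vector, while \<open>y1\<close> and \<open>y2\<close> are the
      products of the rows of \<open>B\<close> with it. Symmetry of \<open>A ** transpose B\<close>
      makes \<open>x\<close> and \<open>y\<close> proportional, and the factor is the parameter
      \<open>s\<close>.\<close>
    define x1 where "x1 = a1 * line_d i - a2 * line_c i"
    define x2 where "x2 = a3 * line_d i - a4 * line_c i"
    define y1 where "y1 = b1 * line_a i + b2 * line_b i"
    define y2 where "y2 = b3 * line_a i + b4 * line_b i"
    have nz: "\<not> int p dvd x1 \<or> \<not> int p dvd x2"
    proof (rule ccontr)
      assume "\<not> (\<not> int p dvd x1 \<or> \<not> int p dvd x2)"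
      then have "int p dvd x1" "int p dvd x2" by auto
      then have "int p dvd a1" "int p dvd a2" "int p dvd a3" "int p dvd a4"
        using line_coordinates_dvd [of p a1 i a2] line_coordinates_dvd [of p a3 i a4] z unfolding x1_def x2_def by blast+
      then show False using 3 by blast
    qed
    have "x1 * y2 - x2 * y1 = (line_a i * line_d i - line_b i * line_c i) * (a1*b3 + a2*b4 - (a3*b1 + a4*b2))
       + (a4 * line_a i - a3 * line_b i) * (b1 * line_c i + b2 * line_d i)
       - (a2 * line_a i - a1 * line_b i) * (b3 * line_c i + b4 * line_d i)"
      by (simp add: x1_def x2_def y1_def y2_def algebra_simps)
    then have "int p dvd x1 * y2 - x2 * y1" using z by (simp add: sym)
    then obtain s where s: "s \<in> {0..<int p}" "int p dvd y1 - x1 * s" "int p dvd y2 - x2 * s"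
      using common_residue_exists [OF p nz] by blast
    have j: "Inr (Inl (i, s)) \<in> delta_indices N p"
      using nd i s by (auto simp: delta_indices_def)
    have "b1 * line_a i + b2 * line_b i - (a1 * (s * line_d i) + a2 * (- s * line_c i)) = y1 - x1 * s"
      "b3 * line_a i + b4 * line_b i - (a3 * (s * line_d i) + a4 * (- s * line_c i)) = y2 - x2 * s"
      "b1 * (int p * line_c i) + b2 * (int p * line_d i) - (a1 * (- t * line_b i) + a2 * (t * line_a i)) =
        int p * (b1 * line_c i + b2 * line_d i) - t * (a2 * line_a i - a1 * line_b i)"
      "b3 * (int p * line_c i) + b4 * (int p * line_d i) - (a3 * (- t * line_b i) + a4 * (t * line_a i)) =
        int p * (b3 * line_c i + b4 * line_d i) - t * (a4 * line_a i - a3 * line_b i)"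
      by (simp_all add: x1_def x2_def y1_def y2_def algebra_simps)
    note eqs = this
    have "\<exists>h\<in>hecke_group N (delta p). g = h ** delta_rep N p t e (Inr (Inl (i, s)))"
      unfolding ge delta_rep.simps crit [OF G [OF j, unfolded delta_rep.simps]] eqs
      using s z by simp
    then show ?thesis using j by blast
  qed
qed

section \<open>Upper triangular factors and the sum for \<open>delta p\<close>\<close>

definition affine_action :: "real \<Rightarrow> real mat2 \<Rightarrow> real mat2 \<Rightarrow> complex mat2 \<Rightarrow> complex mat2" where
  "affine_action c A S \<tau> = c *\<^sub>R (cmat A ** (\<tau> + cmat S) ** cmat (transpose A))"

definition line_mat :: "int option \<Rightarrow> real mat2" where
  "line_mat i = imk2 (line_a i) (line_b i) (line_c i) (line_d i)"

text \<open>\<open>s\<close> times the rank one form of the vector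
  \<open>(line_d i, - line_c i)\<close>, which \<open>line_mat i\<close> maps to the first unit
  vector. In the basis of the line it is the translation \<open>diag(s, 0)\<close>.\<close>

definition line_sym :: "int option \<Rightarrow> real \<Rightarrow> real mat2" where
  "line_sym i s = s *\<^sub>R imk2 (line_d i * line_d i) (- line_c i * line_d i) (- line_c i * line_d i) (line_c i * line_c i)"

lemma line_mat_sym: "line_mat i ** line_sym i s = s *\<^sub>R imk2 (line_d i) (- line_c i) 0 0"
proof -
  have "line_a i * (line_d i * line_d i) - line_b i * (line_c i * line_d i) = line_d i * (line_a i * line_d i - line_b i * line_c i)"
    "line_b i * (line_c i * line_c i) - line_a i * (line_c i * line_d i) = - line_c i * (line_a i * line_d i - line_b i * line_c i)"
    by (simp_all add: algebra_simps)
  then show ?thesis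
    unfolding line_mat_def line_sym_def scaleR_mult_right imk2_mult line_det
    by (simp add: imk2_eq_iff algebra_simps)
qed

text \<open>Dividing the upper row of \<open>(p, t; N, e)\<close> by \<open>p\<close> gives
  \<open>(1, t / p; N, e)\<close>, which is \<open>(1, t; N, p * e)\<close> times
  \<open>diag(1, 1 / p)\<close>. The left factor stays in the group of level \<open>N\<close> and
  carries the character value at \<open>p * e\<close>, or its square if it acts in both
  coordinates.\<close>

fun delta_G :: "nat \<Rightarrow> nat \<Rightarrow> int \<Rightarrow> int \<Rightarrow> delta_index \<Rightarrow> real mat4" where
  "delta_G N p t e (Inl _) = mat 1"
| "delta_G N p t e (Inr (Inl _)) = block (imk2 1 0 0 1) (imk2 0 0 0 t) (imk2 0 0 0 (int N)) (imk2 1 0 0 (int p * e))"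
| "delta_G N p t e (Inr (Inr _)) = block (imk2 1 0 0 1) (imk2 t 0 0 t) (imk2 (int N) 0 0 (int N)) (imk2 (int p * e) 0 0 (int p * e))"

fun delta_A :: "nat \<Rightarrow> delta_index \<Rightarrow> real mat2" where
  "delta_A p (Inl _) = mk2 (1 / real p) 0 0 (1 / real p)"
| "delta_A p (Inr (Inl (i, _))) = mk2 (1 / real p) 0 0 1 ** line_mat i"
| "delta_A p (Inr (Inr _)) = mat 1"

fun delta_S :: "delta_index \<Rightarrow> real mat2" where
  "delta_S (Inl (x, y, z)) = imk2 x y y z"
| "delta_S (Inr (Inl (i, s))) = line_sym i (of_int s)"
| "delta_S (Inr (Inr _)) = 0"

fun delta_D :: "nat \<Rightarrow> delta_index \<Rightarrow> real mat2" where
  "delta_D p (Inl _) = mat 1"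
| "delta_D p (Inr (Inl (i, _))) = mk2 1 0 0 (1 / real p) ** imk2 (line_d i) (- line_c i) (- line_b i) (line_a i)"
| "delta_D p (Inr (Inr _)) = mk2 (1 / real p) 0 0 (1 / real p)"

lemma delta_decompose:
  assumes p: "p > 0"
  shows "matrix_inv (delta p) ** delta_rep N p t e i =
    delta_G N p t e i ** block (delta_A p i) (delta_A p i ** delta_S i) 0 (delta_D p i)"
proof (cases i)
  case (Inl q)
  obtain x y z where q: "q = (x, y, z)" by (cases q)
  show ?thesis
    by (simp add: Inl q matrix_inv_delta [OF p] unip_def block_mult imk2_def mat_mk2 mk2_simps flip: zero_mk2)
next
  case (Inr r)
  show ?thesis
  proof (cases r)
    case (Inl q)
    obtain j s where q: "q = (j, s)" by (cases q)
    show ?thesis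
      by (simp add: \<open>i = Inr r\<close> Inl q matrix_inv_delta [OF p] block_mult line_mat_sym flip: matrix_mul_assoc)
        (use p in \<open>simp add: line_mat_def imk2_def mat_mk2 mk2_simps zero_mk2 field_simps\<close>)
  next
    case (Inr q)
    show ?thesis
      using p by (simp add: \<open>i = Inr r\<close> Inr matrix_inv_delta [OF p] block_mult imk2_def mat_mk2 mk2_simps flip: zero_mk2)
  qed
qed

lemma delta_upper:
  assumes p: "p > 0"
  shows "transpose (delta_A p i) ** delta_D p i = mat (1 / real p)"
proof (cases i)
  case (Inl q)
  then show ?thesis by (simp add: mat_mk2 mk2_simps)
next
  case (Inr r)
  show ?thesis
  proof (cases r)
    case (Inl q)
    obtain j s where q: "q = (j, s)" by (cases q)
    have "real_of_int (line_a j) * real_of_int (line_d j) = 1 + real_of_int (line_b j) * real_of_int (line_c j)"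
      using arg_cong [OF line_det [of j], of real_of_int] by simp
    then show ?thesis
      using p by (simp add: \<open>i = Inr r\<close> Inl q line_mat_def imk2_def mat_mk2 mk2_simps field_simps)
  next
    case (Inr q)
    then show ?thesis by (simp add: \<open>i = Inr r\<close> mat_mk2 mk2_simps)
  qed
qed

lemma transpose_line_sym: "transpose (line_sym i s) = line_sym i s"
  by (simp add: line_sym_def imk2_def mk2_simps)

lemma transpose_delta_S: "transpose (delta_S i) = delta_S i"
proof (cases i rule: delta_S.cases)
  case (1 x y z)
  then show ?thesis by (simp add: imk2_transpose)
qed (simp_all add: transpose_line_sym)

lemma delta_G_Gamma0:
  assumes "i \<in> Inr ` UNIV \<Longrightarrow> int p * e - int N * t = 1"
  shows "delta_G N p t e i \<in> Gamma0 N"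
proof (cases i)
  case (Inr q)
  have e: "int p * e = 1 + int N * t" using assms Inr by simp
  show ?thesis
  proof (cases q)
    case (Inl r)
    show ?thesis
      by (simp only: \<open>i = Inr q\<close> Inl delta_G.simps, rule Gamma0_imk2_intro [of _ 0 _ 0 _ 0 _ 1]) (use e in auto)
  next
    case (Inr r)
    show ?thesis
      by (simp only: \<open>i = Inr q\<close> Inr delta_G.simps, rule Gamma0_imk2_intro [of _ 1 _ 0 _ 0 _ 1]) (use e in auto)
  qed
qed (simp add: Gamma0_one)

lemma bezout_level:
  assumes "prime p" "\<not> p dvd N"
  obtains t e :: int where "int p ^ n * e - int N * t = 1"
proof -
  have "coprime (int p) (int N)"
    using assms prime_imp_coprime by auto
  then have "coprime (int p ^ n) (int N)" by simp
  then obtain u where "[int p ^ n * u = 1] (mod int N)"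
    using cong_solve_coprime_int by blast
  then obtain v where "int p ^ n * u - 1 = int N * v"
    by (metis cong_iff_dvd_diff dvdE)
  then show ?thesis by (intro that [of u v]) simp
qed

lemma coprime_level:
  assumes "prime p" "\<not> p dvd N" shows "coprime (int p) (int N)"
  using assms prime_imp_coprime by auto

lemma character_level_zero:
  assumes \<chi>: "dirichlet_character N \<chi>'" and p: "prime p" and "p dvd N"
  shows "\<chi>' (int p) = 0"
proof -
  have "\<not> coprime (int p) (int N)"
    using p \<open>p dvd N\<close> by (auto simp: coprime_absorb_left)
  then show ?thesis using \<chi> unfolding dirichlet_character_def by blast
qed

text \<open>The ratio \<open>det A / \<mu>\<close> is \<open>1 / p\<close>, 1 and \<open>p\<close>
  for the three kinds, which gives the weights. The conjugate of the character at \<open>e\<close>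
  cancels its value at \<open>e\<close>, so the character factors are 1,
  \<open>\<chi>' (int p)\<close> and its square. For \<open>p\<close> dividing \<open>N\<close> the
  last two kinds are absent while these factors vanish, so one formula covers all primes.\<close>

lemma hecke_sum_delta:
  assumes F: "siegel_modular_form k N \<chi>' F" and \<chi>: "dirichlet_character N \<chi>'" and k: "k > 0" and N: "N > 0"
    and p: "prime p" and \<tau>: "\<tau> \<in> siegel2"
  shows "hecke_sum k N \<chi>' (delta p) F \<tau> =
    (\<Sum>(x, y, z)\<in>{0..<int p} \<times> {0..<int p} \<times> {0..<int p}.
        (1 / of_nat p) ^ k * F (affine_action (real p) (mk2 (1 / real p) 0 0 (1 / real p)) (imk2 x y y z) \<tau>)) +
    \<chi>' (int p) * (\<Sum>(i, s)\<in>lines p \<times> {0..<int p}.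
        F (affine_action (real p) (mk2 (1 / real p) 0 0 1 ** line_mat i) (line_sym i (of_int s)) \<tau>)) +
    \<chi>' (int p) ^ 2 * (of_nat p ^ k * F (affine_action (real p) (mat 1) 0 \<tau>))"
proof -
  have p0: "p > 0" using p prime_gt_0_nat by blast
  obtain t e where te: "\<not> p dvd N \<Longrightarrow> int p * e - int N * t = 1"
    using bezout_level [OF p, of N 1] by (metis power_one_right)
  have te': "int p * e - int N * t = 1" if "i \<in> delta_indices N p" "i \<in> Inr ` UNIV" for i
    using that te by (auto simp: delta_indices_def split: if_splits)
  define f where "f = (\<lambda>i. of_real (det (delta_A p i) / (1 / real p)) ^ k *
     F ((1 / (1 / real p)) *\<^sub>R (cmat (delta_A p i) ** (\<tau> + cmat (delta_S i)) ** cmat (transpose (delta_A p i)))))"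
  define h where "h = (\<lambda>i. cnj (char_mat \<chi>' (delta_rep N p t e i)) * char_mat \<chi>' (delta_G N p t e i))"
  have fin: "finite (lines p)" by (simp add: lines_def)
  have ld: "det (line_mat i) = 1" for i
    unfolding line_mat_def imk2_det line_det by simp
  have one: "char_mat \<chi>' (mat 1) = 1"
    using char_mat_block [of \<chi>' _ _ _ 1 0 0 1] dirichlet_character_one [OF \<chi>]
    unfolding mat_block imk2_one [symmetric] by simp
  have "hecke_sum k N \<chi>' (delta p) F \<tau> = (\<Sum>i\<in>delta_indices N p. h i * f i)"
    unfolding h_def f_def
  proof (rule hecke_sum_representatives [OF F \<chi> k N delta_def _ det_delta [OF p0]])
    show "det (mat 1 :: real mat2) \<noteq> 0" by simp
    show "delta_rep N p t e i \<in> Gamma0 N" if "i \<in> delta_indices N p" for i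
      using te' [OF that] by (rule delta_rep_Gamma0)
    show "delta_G N p t e i \<in> Gamma0 N" if "i \<in> delta_indices N p" for i
      using te' [OF that] by (rule delta_G_Gamma0)
  qed (use p0 \<tau> in \<open>auto simp: delta_decompose delta_upper transpose_delta_S
         intro: delta_rep_disjoint [OF p te] delta_rep_cover [OF p te]\<close>)
  also have "\<dots> = (\<Sum>i\<in>{0..<int p} \<times> {0..<int p} \<times> {0..<int p}. h (Inl i) * f (Inl i)) +
     (if p dvd N then 0 else (\<Sum>i\<in>lines p \<times> {0..<int p}. h (Inr (Inl i)) * f (Inr (Inl i))) + h (Inr (Inr ())) * f (Inr (Inr ())))"
    using fin by (simp add: delta_indices_def sum.Plus)
  also have "(\<Sum>i\<in>{0..<int p} \<times> {0..<int p} \<times> {0..<int p}. h (Inl i) * f (Inl i)) = (\<Sum>(x, y, z)\<in>{0..<int p} \<times> {0..<int p} \<times> {0..<int p}.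
        (1 / of_nat p) ^ k * F (affine_action (real p) (mk2 (1 / real p) 0 0 (1 / real p)) (imk2 x y y z) \<tau>))"
    using p0 by (intro sum.cong refl)
      (auto simp: h_def f_def one unip_def char_mat_block dirichlet_character_one [OF \<chi>] det_mk2 affine_action_def)
  also have "(if p dvd N then 0 else (\<Sum>i\<in>lines p \<times> {0..<int p}. h (Inr (Inl i)) * f (Inr (Inl i))) + h (Inr (Inr ())) * f (Inr (Inr ()))) =
    \<chi>' (int p) * (\<Sum>(i, s)\<in>lines p \<times> {0..<int p}.
        F (affine_action (real p) (mk2 (1 / real p) 0 0 1 ** line_mat i) (line_sym i (of_int s)) \<tau>)) +
    \<chi>' (int p) ^ 2 * (of_nat p ^ k * F (affine_action (real p) (mat 1) 0 \<tau>))"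
  proof (cases "p dvd N")
    case True
    then have "\<chi>' (int p) = 0" by (rule character_level_zero [OF \<chi> p])
    then show ?thesis using True by simp
  next
    case False
    have "[e * int p = 1] (mod int N)"
    proof -
      have "e * int p - 1 = int N * t" using te [OF False] by (simp add: algebra_simps)
      then show ?thesis by (simp add: cong_iff_dvd_diff)
    qed
    then have "coprime e (int N)" by (meson coprime_iff_invertible_int)
    then have ce: "cnj (\<chi>' e) * \<chi>' e = 1" by (rule dirichlet_character_cnj [OF \<chi> N])
    have h1: "h (Inr (Inl i)) = \<chi>' (int p)" for i
    proof -
      obtain j s where i: "i = (j, s)" by (cases i)
      have "line_d j * (e * line_a j) - - line_c j * (- e * line_b j) = e * (line_a j * line_d j - line_b j * line_c j)"
        by (simp add: algebra_simps)
      then have "h (Inr (Inl i)) = cnj (\<chi>' e) * (\<chi>' (int p) * \<chi>' e)"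
        by (simp add: h_def i char_mat_block line_det dirichlet_character_mult [OF \<chi>])
      then show ?thesis using ce by (metis mult.left_commute mult.right_neutral)
    qed
    have "h (Inr (Inr ())) = (cnj (\<chi>' e) * \<chi>' e) * (cnj (\<chi>' e) * \<chi>' e) * \<chi>' (int p) ^ 2"
      by (simp add: h_def char_mat_block dirichlet_character_mult [OF \<chi>] power2_eq_square mult_ac)
    then have h2: "h (Inr (Inr ())) = \<chi>' (int p) ^ 2" by (simp add: ce)
    have f1: "f (Inr (Inl i)) = (case i of (i, s) \<Rightarrow> F (affine_action (real p) (mk2 (1 / real p) 0 0 1 ** line_mat i) (line_sym i (of_int s)) \<tau>))" for i
      using p0 by (auto simp: f_def affine_action_def det_mul det_mk2 ld split: prod.splits)
    have f2: "f (Inr (Inr ())) = of_nat p ^ k * F (affine_action (real p) (mat 1) 0 \<tau>)"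
      by (simp add: f_def affine_action_def)
    show ?thesis using False by (simp add: h1 h2 f1 f2 sum_distrib_left)
  qed
  finally show ?thesis by (simp only: add.assoc)
qed

section \<open>The Hecke operator at \<open>p\<^sup>2\<close>\<close>

lemma delta1_inverse:
  "p > 0 \<Longrightarrow> delta1 p ** block (mk2 (1 / real p) 0 0 1) 0 0 (mk2 (real p) 0 0 1) = mat 1"
  by (simp add: delta1_def block_mult mat_block mat_mk2 mk2_simps)

lemma matrix_inv_delta1:
  "p > 0 \<Longrightarrow> matrix_inv (delta1 p) = block (mk2 (1 / real p) 0 0 1) 0 0 (mk2 (real p) 0 0 1)"
  by (rule matrix_inv_unique_right) (rule delta1_inverse)

lemma det_delta1: "p > 0 \<Longrightarrow> det (delta1 p) \<noteq> 0"
  using delta1_inverse by (metis det_I det_mul mult_zero_left zero_neq_one)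

text \<open>Conjugation by \<open>delta1 p\<close> also forces \<open>p\<close> to divide
  \<open>b3\<close> and \<open>d3\<close>. These two conditions follow from the symplectic
  relations, because \<open>a1\<close> is a unit modulo \<open>p\<close>; so membership can be read
  off the first row.\<close>

lemma hecke_group_delta1:
  assumes p: "prime p"
    and h: "block (imk2 a1 a2 a3 a4) (imk2 b1 b2 b3 b4) C D \<in> Gamma0 N"
  shows "block (imk2 a1 a2 a3 a4) (imk2 b1 b2 b3 b4) C D \<in> hecke_group N (delta1 p) \<longleftrightarrow>
     int p dvd a2 \<and> int p ^ 2 dvd b1 \<and> int p dvd b2"
    (is "?h \<in> _ \<longleftrightarrow> _")
proof -
  have p0: "p > 0" using p prime_gt_0_nat by blast
  have pp: "prime (int p)" using p by simp
  obtain c1 c2 c3 c4 d1 d2 d3 d4 where CD: "C = imk2 (int N * c1) (int N * c2) (int N * c3) (int N * c4)" "D = imk2 d1 d2 d3 d4"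
    and sym: "a1*b3 + a2*b4 = a3*b1 + a4*b2"
    and r: "a1*d1 + a2*d2 = 1 + int N * (b1*c1 + b2*c2)" "a1*d3 + a2*d4 = int N * (b1*c3 + b2*c4)"
    by (rule Gamma0_imk2_obtain [OF h]) (metis block_eq_iff imk2_eq_iff)
  show ?thesis
  proof
    assume "?h \<in> hecke_group N (delta1 p)"
    then obtain g where g: "?h = delta1 p ** g ** matrix_inv (delta1 p)" "g \<in> Gamma0 N"
      by (auto simp: hecke_group_def)
    obtain a1' a2' a3' a4' b1' b2' b3' b4' c1' c2' c3' c4' d1' d2' d3' d4' where
      g': "g = block (imk2 a1' a2' a3' a4') (imk2 b1' b2' b3' b4') (imk2 (int N * c1') (int N * c2') (int N * c3') (int N * c4')) (imk2 d1' d2' d3' d4')"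
      using g(2) by (elim Gamma0_imk2_obtain)
    have "real_of_int a2 = real p * real_of_int a2'" "real_of_int b1 = real p * real p * real_of_int b1'"
      "real_of_int b2 = real p * real_of_int b2'"
      using g(1) unfolding g' matrix_inv_delta1 [OF p0]
      unfolding delta1_def block_mult imk2_def
      by (simp_all add: mk2_simps)
    then have "real_of_int a2 = of_int (int p * a2')" "real_of_int b1 = of_int (int p ^ 2 * b1')"
      "real_of_int b2 = of_int (int p * b2')" by (simp_all add: power2_eq_square)
    then show "int p dvd a2 \<and> int p ^ 2 dvd b1 \<and> int p dvd b2"
      by (simp only: of_int_eq_iff) simp
  next
    assume "int p dvd a2 \<and> int p ^ 2 dvd b1 \<and> int p dvd b2"
    then obtain x2 y1 y2 where xy: "a2 = int p * x2" "b1 = int p ^ 2 * y1" "b2 = int p * y2" by (auto elim!: dvdE)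
    have na: "\<not> int p dvd a1"
    proof
      assume "int p dvd a1"
      then have "int p dvd (a1*d1 + a2*d2) - int N * (b1*c1 + b2*c2)"
        by (simp add: xy power2_eq_square)
      then show False using p by (simp add: r)
    qed
    have "a1 * b3 = int p * (a3 * int p * y1 + a4 * y2 - x2 * b4)"
      using sym by (simp add: xy power2_eq_square algebra_simps)
    then have "int p dvd b3" using na prime_dvd_mult_iff [OF pp] by (metis dvd_triv_left)
    moreover have "a1 * d3 = int p * (int N * (int p * y1*c3 + y2*c4) - x2 * d4)"
      using r(2) by (simp add: xy power2_eq_square algebra_simps)
    then have "int p dvd d3" using na prime_dvd_mult_iff [OF pp] by (metis dvd_triv_left)
    ultimately obtain y3 z3 where yz: "b3 = int p * y3" "d3 = int p * z3" by (auto elim!: dvdE)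
    define g where "g = block (imk2 a1 x2 (int p * a3) a4) (imk2 y1 y2 y3 b4)
       (imk2 (int N * (int p ^ 2 * c1)) (int N * (int p * c2)) (int N * (int p * c3)) (int N * c4)) (imk2 d1 (int p * d2) z3 d4)"
    have hg: "?h = delta1 p ** g ** matrix_inv (delta1 p)"
      unfolding matrix_inv_delta1 [OF p0] g_def CD
      unfolding delta1_def block_mult imk2_def
      using p0 by (simp add: mk2_simps xy yz power2_eq_square)
    have "symplectic (delta1 p)" "symplectic (matrix_inv (delta1 p))"
      unfolding matrix_inv_delta1 [OF p0] unfolding delta1_def symplectic_transpose_relation
      using p0 by (simp_all add: mk2_simps mat_mk2)
    moreover have "g = matrix_inv (delta1 p) ** ?h ** delta1 p"
    proof -
      have "matrix_inv (delta1 p) ** ?h ** delta1 p =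
         (matrix_inv (delta1 p) ** delta1 p) ** g ** (matrix_inv (delta1 p) ** delta1 p)"
        unfolding hg by (simp only: matrix_mul_assoc)
      then show ?thesis by (simp add: matrix_inv_both [OF det_delta1 [OF p0]])
    qed
    ultimately have "symplectic g"
      using h by (auto simp: Gamma0_def intro!: symplectic_mult)
    then have "g \<in> Gamma0 N"
      unfolding g_def imk2_scale [symmetric] Gamma0_block using imk2_int_mat by blast
    then show "?h \<in> hecke_group N (delta1 p)"
      using hg h unfolding hecke_group_def by blast
  qed
qed

lemma coset_delta1_imk2:
  assumes p: "prime p"
    and g: "block (imk2 a1 a2 a3 a4) (imk2 b1 b2 b3 b4) (imk2 c1 c2 c3 c4) (imk2 d1 d2 d3 d4) \<in> Gamma0 N"
    and g': "block (imk2 a1' a2' a3' a4') (imk2 b1' b2' b3' b4') (imk2 c1' c2' c3' c4') (imk2 d1' d2' d3' d4') \<in> Gamma0 N"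
  shows "(\<exists>h\<in>hecke_group N (delta1 p). block (imk2 a1 a2 a3 a4) (imk2 b1 b2 b3 b4) (imk2 c1 c2 c3 c4) (imk2 d1 d2 d3 d4) =
        h ** block (imk2 a1' a2' a3' a4') (imk2 b1' b2' b3' b4') (imk2 c1' c2' c3' c4') (imk2 d1' d2' d3' d4')) \<longleftrightarrow>
    int p dvd a1*d3' + a2*d4' - (b1*c3' + b2*c4') \<and>
    int p ^ 2 dvd b1*a1' + b2*a2' - (a1*b1' + a2*b2') \<and> int p dvd b1*a3' + b2*a4' - (a1*b3' + a2*b4')"
    (is "(\<exists>h\<in>_. ?g = h ** ?g') \<longleftrightarrow> ?R")
proof -
  have "?g ** sp_inv ?g' \<in> Gamma0 N"
    using assms by (simp add: Gamma0_mult Gamma0_sp_inv)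
  then show ?thesis
    unfolding hecke_coset_member_iff [OF g'] sp_inv_def blk_block block_mult imk2_simps
    by (subst hecke_group_delta1 [OF p]) (auto simp: algebra_simps)
qed

section \<open>A transversal for \<open>delta1 p\<close>\<close>

type_synonym delta1_index = "(int option \<times> int \<times> int) + (int option \<times> int option)"

text \<open>In total \<open>(p + 1) * (p ^ 3 + p)\<close> cosets. The second summand attaches to
  each line the \<open>p\<close> points of the projective line over the integers modulo
  \<open>p ^ 2\<close> that reduce to one given point modulo \<open>p\<close>, labelled by
  \<open>None\<close> and the nonzero residues.\<close>

definition delta1_indices :: "nat \<Rightarrow> delta1_index set" where
  "delta1_indices p = (lines p \<times> {0..<int p ^ 2} \<times> {0..<int p}) <+> (lines p \<times> insert None (Some ` {1..<int p}))"

text \<open>Here a coset is determined by the line of \<open>\<bbbF>\<^sub>p\<^sup>4\<close> spanned by the first row together with its lift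
  modulo \<open>p\<^sup>2\<close> along the symplectic complement. The second clause covers the rows whose left half vanishes modulo \<open>p\<close>;
  there \<open>(w1 b, w2 b; N, w4 b)\<close> is a matrix of determinant one with \<open>p\<close> dividing \<open>w1 b\<close>.\<close>

fun delta1_rep :: "nat \<Rightarrow> (int option \<Rightarrow> int) \<Rightarrow> (int option \<Rightarrow> int) \<Rightarrow> (int option \<Rightarrow> int) \<Rightarrow> delta1_index \<Rightarrow> real mat4" where
  "delta1_rep N w1 w2 w4 (Inl (i, x, y)) =
     block (imk2 (line_a i) (line_b i) (line_c i) (line_d i))
       (imk2 (x * line_d i - y * line_b i) (- x * line_c i + y * line_a i) (y * line_d i) (- y * line_c i))
       (imk2 0 0 0 0) (imk2 (line_d i) (- line_c i) (- line_b i) (line_a i))"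
| "delta1_rep N w1 w2 w4 (Inr (i, b)) =
     block (imk2 (w1 b * line_d i) (- w1 b * line_c i) (- line_b i) (line_a i))
       (imk2 (w2 b * line_a i) (w2 b * line_b i) 0 0)
       (imk2 (int N * line_d i) (- int N * line_c i) 0 0)
       (imk2 (w4 b * line_a i) (w4 b * line_b i) (line_c i) (line_d i))"

definition slot1 :: "int \<Rightarrow> int \<Rightarrow> int \<Rightarrow> int \<Rightarrow> real mat4" where
  "slot1 a b c d = block (imk2 a 0 0 1) (imk2 b 0 0 0) (imk2 c 0 0 0) (imk2 d 0 0 1)"

definition levi' :: "int option \<Rightarrow> real mat4" where
  "levi' i = block (imk2 (line_d i) (- line_c i) (- line_b i) (line_a i)) (imk2 0 0 0 0) (imk2 0 0 0 0)
     (imk2 (line_a i) (line_b i) (line_c i) (line_d i))"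

lemma levi'_Gamma0: "levi' i \<in> Gamma0 N"
  unfolding levi'_def
  by (rule Gamma0_imk2_intro [of _ 0 _ 0 _ 0 _ 0]) (use line_det [of i] in \<open>auto simp: algebra_simps\<close>)

lemma slot1_Gamma0: "a * d - int N * c * b = 1 \<Longrightarrow> slot1 a b (int N * c) d \<in> Gamma0 N"
  unfolding slot1_def by (rule Gamma0_imk2_intro [of _ c _ 0 _ 0 _ 0]) auto

lemma delta1_rep_Gamma0:
  assumes "\<And>j b. i = Inr (j, b) \<Longrightarrow> w1 b * w4 b - int N * w2 b = 1"
  shows "delta1_rep N w1 w2 w4 i \<in> Gamma0 N"
proof (cases i)
  case (Inl q)
  obtain j x y where q: "q = (j, x, y)" by (cases q)
  have "delta1_rep N w1 w2 w4 i = unip x y 0 ** levi j"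
    by (simp add: Inl q unip_def levi_def block_mult imk2_simps imk2_eq_iff)
  then show ?thesis by (simp add: Gamma0_mult unip_Gamma0 levi_Gamma0)
next
  case (Inr q)
  obtain j b where q: "q = (j, b)" by (cases q)
  have "delta1_rep N w1 w2 w4 i = slot1 (w1 b) (w2 b) (int N * 1) (w4 b) ** levi' j"
    by (simp add: Inr q slot1_def levi'_def block_mult imk2_simps imk2_eq_iff)
  moreover have "slot1 (w1 b) (w2 b) (int N * 1) (w4 b) \<in> Gamma0 N"
    by (rule slot1_Gamma0) (use assms Inr q in simp)
  ultimately show ?thesis by (metis Gamma0_mult levi'_Gamma0)
qed

text \<open>A vector orthogonal modulo \<open>p\<close> to both rows of a unimodular matrix vanishes
  modulo \<open>p\<close>, but a line vector is primitive.\<close>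

lemma line_orthogonal:
  assumes p: "prime p" and 1: "int p dvd line_a i * line_a j + line_b i * line_b j"
    and 2: "int p dvd line_a i * line_c j + line_b i * line_d j"
  shows False
proof -
  have "line_d j * (line_a i * line_a j + line_b i * line_b j) - line_b j * (line_a i * line_c j + line_b i * line_d j)
    = line_a i * (line_a j * line_d j - line_b j * line_c j)"
    "line_a j * (line_a i * line_c j + line_b i * line_d j) - line_c j * (line_a i * line_a j + line_b i * line_b j)
    = line_b i * (line_a j * line_d j - line_b j * line_c j)"
    by (simp_all add: algebra_simps)
  then have "int p dvd line_a i" "int p dvd line_b i"
    using 1 2 unfolding line_det mult_1_right by (metis dvd_diff dvd_mult)+
  then have "int p dvd line_a i * line_d i - line_b i * line_c i" by simp
  then show False using p by (simp add: line_det)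
qed

text \<open>The completion of the rows \<open>(w1 b, w2 b)\<close> to determinant one is kept
  abstract; \<open>sep\<close> says that these rows are distinct projective points modulo
  \<open>p ^ 2\<close>. The two clauses of representatives are kept apart by
  \<open>line_orthogonal\<close>.\<close>

lemma delta1_rep_disjoint:
  assumes p: "prime p"
    and w: "\<And>b. b \<in> insert None (Some ` {1..<int p}) \<Longrightarrow> w1 b * w4 b - int N * w2 b = 1 \<and> int p dvd w1 b"
    and sep: "\<And>b b'. b \<in> insert None (Some ` {1..<int p}) \<Longrightarrow> b' \<in> insert None (Some ` {1..<int p}) \<Longrightarrow>
        int p ^ 2 dvd w2 b * w1 b' - w1 b * w2 b' \<Longrightarrow> b = b'"
    and ij: "i \<in> delta1_indices p" "j \<in> delta1_indices p"
    and h: "h \<in> hecke_group N (delta1 p)" "delta1_rep N w1 w2 w4 i = h ** delta1_rep N w1 w2 w4 j"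
  shows "i = j"
proof -
  have pp: "prime (int p)" using p by simp
  have G: "delta1_rep N w1 w2 w4 i \<in> Gamma0 N" if "i \<in> delta1_indices p" for i
    using that w by (intro delta1_rep_Gamma0) (auto simp: delta1_indices_def)
  note G' = G [OF ij(1)] G [OF ij(2)]
  have ex: "\<exists>h\<in>hecke_group N (delta1 p). delta1_rep N w1 w2 w4 i = h ** delta1_rep N w1 w2 w4 j"
    using h by blast
  have w2: "\<not> int p dvd w2 b" if "b \<in> insert None (Some ` {1..<int p})" for b
  proof
    assume "int p dvd w2 b"
    moreover have "int p dvd w1 b" using w [OF that] by blast
    ultimately have "int p dvd w1 b * w4 b - int N * w2 b" by simp
    moreover have "w1 b * w4 b - int N * w2 b = 1" using w [OF that] by blast
    ultimately show False using p by (simp only:) simp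
  qed
  have sq: "int p dvd x" if "int p ^ 2 dvd x" for x
    using that by (metis dvd_mult_left power2_eq_square)
  note ex' = ex [unfolded hecke_coset_sym [OF det_delta1 [OF prime_gt_0_nat [OF p]], of N "delta1_rep N w1 w2 w4 i"]]
  have b_mem: "b \<in> insert None (Some ` {1..<int p})" if "i = Inr (u, b) \<or> j = Inr (u, b)" for u b
    using that ij by (auto simp: delta1_indices_def)
  have cross: False
    if ij: "i = Inr q' \<or> j = Inr q'"
    and G: "delta1_rep N w1 w2 w4 (Inl q) \<in> Gamma0 N" "delta1_rep N w1 w2 w4 (Inr q') \<in> Gamma0 N"
    and R: "\<exists>h\<in>hecke_group N (delta1 p). delta1_rep N w1 w2 w4 (Inl q) = h ** delta1_rep N w1 w2 w4 (Inr q')" for q q'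
  proof -
    obtain u x y u' b where q: "q = (u, x, y)" "q' = (u', b)" by (cases q; cases q')
    have b: "b \<in> insert None (Some ` {1..<int p})" using ij q b_mem by blast
    note c = R [unfolded q delta1_rep.simps coset_delta1_imk2 [OF p G [unfolded q delta1_rep.simps]]]
    have 2: "int p dvd line_a u * line_c u' + line_b u * line_d u'" using c by simp
    obtain z where z: "w1 b = int p * z" using w [OF b] by auto
    \<comment> \<open>As \<open>p\<close> divides \<open>w1 b\<close>, only \<open>w2 b\<close>
      times the inner product of two line vectors survives modulo \<open>p\<close>. Together with
      \<open>2\<close> the vector of \<open>u\<close> is orthogonal to a whole basis.\<close>
    have "(x * line_d u - y * line_b u) * (w1 b * line_d u') + (- x * line_c u + y * line_a u) * (- w1 b * line_c u') -
        (line_a u * (w2 b * line_a u') + line_b u * (w2 b * line_b u'))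
      = int p * (z * ((x * line_d u - y * line_b u) * line_d u' - (- x * line_c u + y * line_a u) * line_c u'))
         - w2 b * (line_a u * line_a u' + line_b u * line_b u')"
      by (simp add: z algebra_simps)
    note e = this
    have "int p dvd int p * (z * ((x * line_d u - y * line_b u) * line_d u' - (- x * line_c u + y * line_a u) * line_c u'))
         - w2 b * (line_a u * line_a u' + line_b u * line_b u')"
      using c sq unfolding e by blast
    then have "int p dvd w2 b * (line_a u * line_a u' + line_b u * line_b u')"
      by (simp only: dvd_diff_right_iff dvd_triv_left)
    then have "int p dvd line_a u * line_a u' + line_b u * line_b u'"
      using w2 [OF b] prime_dvd_mult_iff [OF pp] by blast
    then show False using line_orthogonal [OF p _ 2] by blast
  qed
  show ?thesis
  proof (cases i)
    case i: (Inl q)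
    obtain u x y where q: "q = (u, x, y)" by (cases q)
    have mem: "u \<in> lines p" "x \<in> {0..<int p ^ 2}" "y \<in> {0..<int p}"
      using ij(1) by (auto simp: i q delta1_indices_def)
    show ?thesis
    proof (cases j)
      case j: (Inl q')
      obtain u' x' y' where q': "q' = (u', x', y')" by (cases q')
      have mem': "u' \<in> lines p" "x' \<in> {0..<int p ^ 2}" "y' \<in> {0..<int p}"
        using ij(2) by (auto simp: j q' delta1_indices_def)
      note c = ex [unfolded i j q q' delta1_rep.simps coset_delta1_imk2 [OF p G' [unfolded i j q q' delta1_rep.simps]]]
      have "line_a u * - line_b u' + line_b u * line_a u' - ((x * line_d u - y * line_b u) * 0 + (- x * line_c u + y * line_a u) * 0)
          = - (line_a u * line_b u' - line_b u * line_a u')"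
        by (simp add: algebra_simps)
      then have u: "u = u'"
        using c line_separated [OF p mem(1) mem'(1)] by (metis dvd_minus_iff)
      have "(x * line_d u - y * line_b u) * line_c u + (- x * line_c u + y * line_a u) * line_d u - (line_a u * (y' * line_d u) + line_b u * (- y' * line_c u))
          = (y - y') * (line_a u * line_d u - line_b u * line_c u)"
        "(x * line_d u - y * line_b u) * line_a u + (- x * line_c u + y * line_a u) * line_b u -
           (line_a u * (x' * line_d u - y' * line_b u) + line_b u * (- x' * line_c u + y' * line_a u))
          = (x - x') * (line_a u * line_d u - line_b u * line_c u)"
        by (simp_all add: algebra_simps)
      note e = this [unfolded line_det mult_1_right]
      have "int p dvd y - y'" "int p ^ 2 dvd x - x'"
        using c unfolding u [symmetric] e by blast+
      then show ?thesis
        using mem mem' u residue_unique [of p y y'] residue_unique [of "p^2" x x'] by (simp add: i j q q')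
    next
      case j: (Inr q')
      then show ?thesis using cross ex G' i by blast
    qed
  next
    case i: (Inr q)
    obtain u b where q: "q = (u, b)" by (cases q)
    have u: "u \<in> lines p" and b: "b \<in> insert None (Some ` {1..<int p})" using ij(1) by (auto simp: i q delta1_indices_def)
    show ?thesis
    proof (cases j)
      case j: (Inl q')
      then show ?thesis using cross ex' G' i by blast
    next
      case j: (Inr q')
      obtain u' b' where q': "q' = (u', b')" by (cases q')
      have u': "u' \<in> lines p" and b': "b' \<in> insert None (Some ` {1..<int p})" using ij(2) by (auto simp: j q' delta1_indices_def)
      note c = ex [unfolded i j q q' delta1_rep.simps coset_delta1_imk2 [OF p G' [unfolded i j q q' delta1_rep.simps]]]
      have "w2 b * line_a u * - line_b u' + w2 b * line_b u * line_a u' - (w1 b * line_d u * 0 + - w1 b * line_c u * 0)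
        = w2 b * - (line_a u * line_b u' - line_b u * line_a u')"
        by (simp add: algebra_simps)
      then have "int p dvd w2 b * - (line_a u * line_b u' - line_b u * line_a u')" using c by metis
      then have "int p dvd line_a u * line_b u' - line_b u * line_a u'"
        using w2 [OF b] prime_dvd_mult_iff [OF pp] by (metis dvd_minus_iff)
      then have uu: "u = u'" by (rule line_separated [OF p u u'])
      have "w2 b * line_a u * (w1 b' * line_d u) + w2 b * line_b u * (- w1 b' * line_c u) -
           (w1 b * line_d u * (w2 b' * line_a u) + - w1 b * line_c u * (w2 b' * line_b u))
         = (w2 b * w1 b' - w1 b * w2 b') * (line_a u * line_d u - line_b u * line_c u)"
        by (simp add: algebra_simps)
      then have "int p ^ 2 dvd w2 b * w1 b' - w1 b * w2 b'"
        using c unfolding uu [symmetric] line_det mult_1_right by metis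
      then have "b = b'" by (rule sep [OF b b'])
      then show ?thesis using uu by (simp add: i j q q')
    qed
  qed
qed

lemma delta1_rep_cover:
  assumes p: "prime p"
    and w: "\<And>b. b \<in> insert None (Some ` {1..<int p}) \<Longrightarrow> w1 b * w4 b - int N * w2 b = 1 \<and> int p dvd w1 b"
    and sur: "\<And>x y. int p dvd x \<Longrightarrow> \<not> int p dvd y \<Longrightarrow>
        \<exists>b\<in>insert None (Some ` {1..<int p}). int p ^ 2 dvd y * w1 b - x * w2 b"
    and g: "g \<in> Gamma0 N"
  shows "\<exists>i\<in>delta1_indices p. \<exists>h\<in>hecke_group N (delta1 p). g = h ** delta1_rep N w1 w2 w4 i"
proof -
  have pp: "prime (int p)" using p by simp
  have G: "delta1_rep N w1 w2 w4 i \<in> Gamma0 N" if "i \<in> delta1_indices p" for i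
    using that w by (intro delta1_rep_Gamma0) (auto simp: delta1_indices_def)
  obtain a1 a2 a3 a4 b1 b2 b3 b4 c1 c2 c3 c4 d1 d2 d3 d4 where
    ge: "g = block (imk2 a1 a2 a3 a4) (imk2 b1 b2 b3 b4) (imk2 (int N * c1) (int N * c2) (int N * c3) (int N * c4)) (imk2 d1 d2 d3 d4)"
    and r: "a1*d1 + a2*d2 = 1 + int N * (b1*c1 + b2*c2)"
    using g Gamma0_imk2_obtain by (metis (no_types, lifting))
  note crit = coset_delta1_imk2 [OF p g [unfolded ge]]
  show ?thesis
  proof (cases "int p dvd a1 \<and> int p dvd a2")
    case False
    obtain i where i: "i \<in> lines p" "int p dvd a2 * line_a i - a1 * line_b i"
      using line_exists [OF p] by blast
    \<comment> \<open>\<open>q\<close> is the coordinate of \<open>(a1, a2)\<close> along the line,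
      a unit modulo \<open>p\<close>. The pairing with the second row fixes \<open>y\<close> modulo
      \<open>p\<close>. Then \<open>x\<close> solves a congruence modulo \<open>p ^ 2\<close>,
      corrected by \<open>y\<close> times the part of \<open>(a1, a2)\<close> off the line, which is
      divisible by \<open>p\<close> but perhaps not by \<open>p ^ 2\<close>.\<close>
    define q where "q = a1 * line_d i - a2 * line_c i"
    have q: "\<not> int p dvd q" using line_coordinates_dvd [of p a1 i a2] i False by (auto simp: q_def)
    obtain y where y: "y \<in> {0..<int p}" "int p dvd (b1 * line_c i + b2 * line_d i) - q * y"
      using residue_exists [OF p q, of 0] by fastforce
    obtain x where x: "x \<in> {0..<int p ^ 2}"
      "int p ^ 2 dvd (b1 * line_a i + b2 * line_b i - y * (a2 * line_a i - a1 * line_b i)) - q * x"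
      using residue_exists [OF p q, of 1 "b1 * line_a i + b2 * line_b i - y * (a2 * line_a i - a1 * line_b i)"]
      by (auto simp: numeral_2_eq_2)
    have j: "Inl (i, x, y) \<in> delta1_indices p" using i x y by (auto simp: delta1_indices_def)
    have e: "a1 * - line_b i + a2 * line_a i - (b1 * 0 + b2 * 0) = a2 * line_a i - a1 * line_b i"
      "b1 * line_a i + b2 * line_b i - (a1 * (x * line_d i - y * line_b i) + a2 * (- x * line_c i + y * line_a i))
        = (b1 * line_a i + b2 * line_b i - y * (a2 * line_a i - a1 * line_b i)) - q * x"
      "b1 * line_c i + b2 * line_d i - (a1 * (y * line_d i) + a2 * (- y * line_c i)) = (b1 * line_c i + b2 * line_d i) - q * y"
      by (simp_all add: q_def algebra_simps)
    have "\<exists>h\<in>hecke_group N (delta1 p). g = h ** delta1_rep N w1 w2 w4 (Inl (i, x, y))"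
      unfolding ge delta1_rep.simps crit [OF G [OF j, unfolded delta1_rep.simps]] e
      using x y i by blast
    then show ?thesis using j by blast
  next
    case True
    have nb: "\<not> (int p dvd b1 \<and> int p dvd b2)"
    proof
      assume "int p dvd b1 \<and> int p dvd b2"
      then have "int p dvd (a1*d1 + a2*d2) - int N * (b1*c1 + b2*c2)" using True by simp
      then show False using p by (simp add: r)
    qed
    obtain i where i: "i \<in> lines p" "int p dvd b2 * line_a i - b1 * line_b i"
      using line_exists [OF p] by blast
    \<comment> \<open>The left half of the first row vanishes modulo \<open>p\<close>, so the right
      half provides the line and the unit \<open>y\<close>. The product of the left half with the
      line vector, a multiple of \<open>p\<close>, then selects the point \<open>b\<close>.\<close>
    define y where "y = b1 * line_d i - b2 * line_c i"
    have y: "\<not> int p dvd y" using line_coordinates_dvd [of p b1 i b2] i nb by (auto simp: y_def)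
    have "int p dvd a1 * line_a i + a2 * line_b i" using True by simp
    then obtain b where b: "b \<in> insert None (Some ` {1..<int p})"
      "int p ^ 2 dvd y * w1 b - (a1 * line_a i + a2 * line_b i) * w2 b"
      using sur y by blast
    have j: "Inr (i, b) \<in> delta1_indices p" using i b by (auto simp: delta1_indices_def)
    have e: "b1 * (w1 b * line_d i) + b2 * (- w1 b * line_c i) - (a1 * (w2 b * line_a i) + a2 * (w2 b * line_b i))
        = y * w1 b - (a1 * line_a i + a2 * line_b i) * w2 b"
      "b1 * - line_b i + b2 * line_a i - (a1 * 0 + a2 * 0) = b2 * line_a i - b1 * line_b i"
      by (simp_all add: y_def algebra_simps)
    have "\<exists>h\<in>hecke_group N (delta1 p). g = h ** delta1_rep N w1 w2 w4 (Inr (i, b))"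
      unfolding ge delta1_rep.simps crit [OF G [OF j, unfolded delta1_rep.simps]] e
      using b i True by simp
    then show ?thesis using j by blast
  qed
qed

text \<open>The form \<open>(x, y; y, 0)\<close> carried back to the standard basis: the inverse of
  \<open>line_mat i\<close> on the left and its transpose on the right, multiplied out.\<close>

definition delta1_sym :: "int option \<Rightarrow> int \<Rightarrow> int \<Rightarrow> real mat2" where
  "delta1_sym i x y = (let s = - x * line_c i * line_d i + y * (line_b i * line_c i + line_a i * line_d i) in
     imk2 (x * line_d i * line_d i - 2 * y * line_b i * line_d i) s s
       (x * line_c i * line_c i - 2 * y * line_a i * line_c i))"

text \<open>The inverse transpose of \<open>line_mat i\<close>.\<close>

definition line_mat' :: "int option \<Rightarrow> real mat2" where
  "line_mat' i = imk2 (line_d i) (- line_c i) (- line_b i) (line_a i)"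

text \<open>The analogue of \<open>line_sym\<close> for \<open>line_mat'\<close>, which maps the
  vector \<open>(line_a i, line_b i)\<close> to the first unit vector.\<close>

definition line_sym' :: "int option \<Rightarrow> real \<Rightarrow> real mat2" where
  "line_sym' i s = s *\<^sub>R imk2 (line_a i * line_a i) (line_a i * line_b i) (line_a i * line_b i) (line_b i * line_b i)"

lemma line_mat_delta1_sym:
  "line_mat i ** delta1_sym i x y =
     imk2 (x * line_d i - y * line_b i) (- x * line_c i + y * line_a i) (y * line_d i) (- y * line_c i)"
proof -
  have "line_a i * (x * line_d i * line_d i - 2 * y * line_b i * line_d i) +
      line_b i * (- x * line_c i * line_d i + y * (line_b i * line_c i + line_a i * line_d i)) =
      (x * line_d i - y * line_b i) * (line_a i * line_d i - line_b i * line_c i)"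
    "line_a i * (- x * line_c i * line_d i + y * (line_b i * line_c i + line_a i * line_d i)) +
      line_b i * (x * line_c i * line_c i - 2 * y * line_a i * line_c i) =
      (- x * line_c i + y * line_a i) * (line_a i * line_d i - line_b i * line_c i)"
    "line_c i * (x * line_d i * line_d i - 2 * y * line_b i * line_d i) +
      line_d i * (- x * line_c i * line_d i + y * (line_b i * line_c i + line_a i * line_d i)) =
      (y * line_d i) * (line_a i * line_d i - line_b i * line_c i)"
    "line_c i * (- x * line_c i * line_d i + y * (line_b i * line_c i + line_a i * line_d i)) +
      line_d i * (x * line_c i * line_c i - 2 * y * line_a i * line_c i) =
      (- y * line_c i) * (line_a i * line_d i - line_b i * line_c i)"
    by (simp_all add: algebra_simps)
  then show ?thesis
    unfolding line_det mult_1_right by (simp only: line_mat_def delta1_sym_def Let_def imk2_mult)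
qed

lemma line_mat'_sym: "line_mat' i ** line_sym' i s = s *\<^sub>R imk2 (line_a i) (line_b i) 0 0"
proof -
  have "line_d i * (line_a i * line_a i) - line_c i * (line_a i * line_b i) = line_a i * (line_a i * line_d i - line_b i * line_c i)"
    "line_d i * (line_a i * line_b i) - line_c i * (line_b i * line_b i) = line_b i * (line_a i * line_d i - line_b i * line_c i)"
    by (simp_all add: algebra_simps)
  then show ?thesis
    unfolding line_mat'_def line_sym'_def scaleR_mult_right imk2_mult line_det
    by (simp add: imk2_eq_iff algebra_simps)
qed

text \<open>The inverse of \<open>delta1 p\<close> divides the first row by \<open>p\<close> and
  multiplies the third by \<open>p\<close>. It turns \<open>(p ^ 2, t; N, e)\<close> into
  \<open>(1, t; N, p ^ 2 * e)\<close> times \<open>diag(p, 1 / p)\<close>, and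
  \<open>(p \<alpha>, \<alpha> b + p \<beta>; N, 1)\<close> into
  \<open>(\<alpha>, \<beta>; N p, p - N b)\<close> times the translation by
  \<open>b / p\<close>.\<close>

fun delta1_G :: "nat \<Rightarrow> nat \<Rightarrow> (int \<Rightarrow> int) \<Rightarrow> (int \<Rightarrow> int) \<Rightarrow> int \<Rightarrow> int \<Rightarrow> delta1_index \<Rightarrow> real mat4" where
  "delta1_G N p \<alpha> \<beta> t e (Inl _) = mat 1"
| "delta1_G N p \<alpha> \<beta> t e (Inr (_, None)) = slot1 1 t (int N * 1) (int p ^ 2 * e)"
| "delta1_G N p \<alpha> \<beta> t e (Inr (_, Some b)) = slot1 (\<alpha> b) (\<beta> b) (int N * int p) (int p - int N * b)"

fun delta1_A :: "nat \<Rightarrow> delta1_index \<Rightarrow> real mat2" where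
  "delta1_A p (Inl (i, _, _)) = mk2 (1 / real p) 0 0 1 ** line_mat i"
| "delta1_A p (Inr (i, None)) = mk2 (real p) 0 0 1 ** line_mat' i"
| "delta1_A p (Inr (i, Some b)) = line_mat' i"

fun delta1_S :: "nat \<Rightarrow> delta1_index \<Rightarrow> real mat2" where
  "delta1_S p (Inl (i, x, y)) = delta1_sym i x y"
| "delta1_S p (Inr (i, None)) = 0"
| "delta1_S p (Inr (i, Some b)) = line_sym' i (of_int b / real p)"

fun delta1_D :: "nat \<Rightarrow> delta1_index \<Rightarrow> real mat2" where
  "delta1_D p (Inl (i, _, _)) = mk2 (real p) 0 0 1 ** line_mat' i"
| "delta1_D p (Inr (i, None)) = mk2 (1 / real p) 0 0 1 ** line_mat i"
| "delta1_D p (Inr (i, Some b)) = line_mat i"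

text \<open>\<open>None\<close> gives the coset of \<open>diag(p, 1, 1/p, 1)\<close>, and \<open>Some b\<close> that of the translation by \<open>b / p\<close>, where
  \<open>\<alpha> b * (p - N b) - N p * \<beta> b = 1\<close>.\<close>

definition slot1_w1 :: "nat \<Rightarrow> (int \<Rightarrow> int) \<Rightarrow> int option \<Rightarrow> int" where
  "slot1_w1 p \<alpha> b = (case b of None \<Rightarrow> int p ^ 2 | Some b \<Rightarrow> int p * \<alpha> b)"
definition slot1_w2 :: "nat \<Rightarrow> (int \<Rightarrow> int) \<Rightarrow> (int \<Rightarrow> int) \<Rightarrow> int \<Rightarrow> int option \<Rightarrow> int" where
  "slot1_w2 p \<alpha> \<beta> t b = (case b of None \<Rightarrow> t | Some b \<Rightarrow> \<alpha> b * b + int p * \<beta> b)"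
definition slot1_w4 :: "int \<Rightarrow> int option \<Rightarrow> int" where
  "slot1_w4 e b = (case b of None \<Rightarrow> e | Some b \<Rightarrow> 1)"

lemmas slot1_w_defs = slot1_w1_def slot1_w2_def slot1_w4_def

lemma delta1_decompose:
  assumes p: "p > 0"
  shows "matrix_inv (delta1 p) ** delta1_rep N (slot1_w1 p \<alpha>) (slot1_w2 p \<alpha> \<beta> t) (slot1_w4 e) i =
    delta1_G N p \<alpha> \<beta> t e i ** block (delta1_A p i) (delta1_A p i ** delta1_S p i) 0 (delta1_D p i)"
proof (cases i)
  case (Inl q)
  obtain j x y where q: "q = (j, x, y)" by (cases q)
  show ?thesis
    by (simp add: Inl q matrix_inv_delta1 [OF p] block_mult line_mat_delta1_sym flip: matrix_mul_assoc)
      (simp add: line_mat_def line_mat'_def imk2_def mk2_simps zero_mk2)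
next
  case (Inr q)
  obtain j b where q: "q = (j, b)" by (cases q)
  show ?thesis
  proof (cases b)
    case None
    show ?thesis
      using p by (simp add: Inr q None matrix_inv_delta1 [OF p] block_mult slot1_def slot1_w_defs
        line_mat_def line_mat'_def imk2_def mk2_simps zero_mk2 field_simps power2_eq_square)
  next
    case (Some b')
    show ?thesis
      by (simp add: Inr q Some matrix_inv_delta1 [OF p] block_mult line_mat'_sym slot1_def slot1_w_defs flip: matrix_mul_assoc)
        (use p in \<open>simp add: line_mat_def line_mat'_def imk2_def mk2_simps zero_mk2 field_simps\<close>)
  qed
qed

lemma line_det_real:
  "real_of_int (line_a j) * real_of_int (line_d j) = 1 + real_of_int (line_b j) * real_of_int (line_c j)"
  using arg_cong [OF line_det [of j], of real_of_int] by simp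

lemma delta1_upper:
  assumes p: "p > 0"
  shows "transpose (delta1_A p i) ** delta1_D p i = mat 1"
  by (cases "(p, i)" rule: delta1_A.cases)
    (use p in \<open>simp_all add: line_mat_def line_mat'_def imk2_def mat_mk2 mk2_simps line_det_real mult.commute\<close>)

lemma transpose_delta1_S: "transpose (delta1_S p i) = delta1_S p i"
  by (cases "(p, i)" rule: delta1_S.cases)
    (simp_all add: delta1_sym_def line_sym'_def Let_def imk2_def mk2_simps)

text \<open>Here \<open>\<mu>\<close> is 1, so the weights are the powers of \<open>det A\<close>,
  which is \<open>1 / p\<close>, 1 or \<open>p\<close>. For \<open>Some b\<close> the character
  factor is the value at \<open>p - N * b\<close>, equal to that at \<open>p\<close>. For
  \<open>None\<close> the values at \<open>e\<close> cancel and the value at \<open>p ^ 2\<close>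
  remains.\<close>

lemma hecke_sum_delta1:
  assumes F: "siegel_modular_form k N \<chi>' F" and \<chi>: "dirichlet_character N \<chi>'" and k: "k > 0" and N: "N > 0"
    and p: "prime p" and pN: "\<not> p dvd N" and \<tau>: "\<tau> \<in> siegel2"
  shows "hecke_sum k N \<chi>' (delta1 p) F \<tau> =
    (\<Sum>(i, x, y)\<in>lines p \<times> {0..<int p ^ 2} \<times> {0..<int p}.
        (1 / of_nat p) ^ k * F (affine_action 1 (mk2 (1 / real p) 0 0 1 ** line_mat i) (delta1_sym i x y) \<tau>)) +
    \<chi>' (int p) * (\<Sum>(i, b)\<in>lines p \<times> {1..<int p}. F (affine_action 1 (line_mat' i) (line_sym' i (of_int b / real p)) \<tau>)) +
    \<chi>' (int p) ^ 2 * (\<Sum>i\<in>lines p. of_nat p ^ k * F (affine_action 1 (mk2 (real p) 0 0 1 ** line_mat' i) 0 \<tau>))"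
proof -
  have p0: "p > 0" using p prime_gt_0_nat by blast
  have pp: "prime (int p)" using p by simp
  obtain t e where te: "int p ^ 2 * e - int N * t = 1"
    using bezout_level [OF p pN] by metis
  have pN': "\<not> int p dvd int N" using pN by simp
  \<comment> \<open>\<open>p - N * b\<close> is prime to \<open>N\<close> because \<open>p\<close>
    is, and prime to \<open>p\<close> because \<open>N\<close> and \<open>b\<close> are. Its inverse
    modulo \<open>N * p\<close> provides \<open>\<alpha> b\<close> and
    \<open>\<beta> b\<close>.\<close>
  have "\<exists>a c. a * (int p - int N * b) - int N * int p * c = 1" if b: "b \<in> {1..<int p}" for b
  proof -
    have "\<not> int p dvd b" using b zdvd_not_zless by force
    then have "\<not> int p dvd int N * b" using pN' prime_dvd_mult_iff [OF pp] by blast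
    then have "\<not> int p dvd int p - int N * b" by (simp add: dvd_diff_right_iff)
    then have "coprime (int p) (int p - int N * b)" using prime_imp_coprime [OF pp] by blast
    moreover have "coprime (int N) (int p - int N * b)"
    proof (rule coprimeI)
      fix c assume c: "c dvd int N" "c dvd int p - int N * b"
      then have "c dvd (int p - int N * b) + int N * b" by (intro dvd_add) auto
      then have "c dvd int p" by simp
      then show "is_unit c" using c(1) coprime_common_divisor [OF coprime_level [OF p pN]] by blast
    qed
    ultimately have "coprime (int p - int N * b) (int N * int p)"
      by (simp add: coprime_commute)
    then obtain u where "[(int p - int N * b) * u = 1] (mod int N * int p)"
      using cong_solve_coprime_int by blast
    then obtain v where "(int p - int N * b) * u - 1 = (int N * int p) * v"
      by (metis cong_iff_dvd_diff dvdE)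
    then show ?thesis by (intro exI [of _ u] exI [of _ v]) (simp add: mult.commute)
  qed
  then obtain \<alpha> \<beta> where ab: "\<And>b. b \<in> {1..<int p} \<Longrightarrow> \<alpha> b * (int p - int N * b) - int N * int p * \<beta> b = 1"
    by metis
  let ?w1 = "slot1_w1 p \<alpha>" and ?w2 = "slot1_w2 p \<alpha> \<beta> t" and ?w4 = "slot1_w4 e"
  let ?B = "insert None (Some ` {1..<int p})"
  have w: "?w1 b * ?w4 b - int N * ?w2 b = 1 \<and> int p dvd ?w1 b" if "b \<in> ?B" for b
  proof (cases b)
    case None
    then show ?thesis using te by (simp add: slot1_w_defs mult.commute)
  next
    case (Some c)
    then have "\<alpha> c * (int p - int N * c) - int N * int p * \<beta> c = 1" using ab that by blast
    then have "int p * \<alpha> c - int N * (\<alpha> c * c + int p * \<beta> c) = 1" by (simp add: algebra_simps)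
    then show ?thesis by (simp add: Some slot1_w_defs)
  qed
  have na: "\<not> int p dvd \<alpha> b" if "b \<in> {1..<int p}" for b
  proof
    assume "int p dvd \<alpha> b"
    then have "int p dvd \<alpha> b * (int p - int N * b) - int N * int p * \<beta> b" by simp
    then show False using ab [OF that] p by simp
  qed
  have nt: "\<not> int p dvd t"
  proof
    assume "int p dvd t"
    then have "int p dvd int p ^ 2 * e - int N * t" by (simp add: power2_eq_square)
    then show False using te p by simp
  qed
  have psq: "int p ^ 2 dvd int p * x \<longleftrightarrow> int p dvd x" for x
    using p0 by (simp add: power2_eq_square)
  \<comment> \<open>Modulo \<open>p ^ 2\<close> the determinant for \<open>Some c\<close> and
    \<open>Some c'\<close> is \<open>p\<close> times the unit
    \<open>\<alpha> c * \<alpha> c'\<close> times \<open>c - c'\<close>; for \<open>None\<close> and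
    \<open>Some c\<close> it is, up to sign, \<open>p\<close> times the unit
    \<open>t * \<alpha> c\<close>.\<close>
  have sep: "b = b'" if bb: "b \<in> ?B" "b' \<in> ?B" and d: "int p ^ 2 dvd ?w2 b * ?w1 b' - ?w1 b * ?w2 b'" for b b'
  proof -
    have *: False if c: "c \<in> {1..<int p}" and d: "int p ^ 2 dvd t * (int p * \<alpha> c) - int p ^ 2 * (\<alpha> c * c + int p * \<beta> c)" for c
    proof -
      have "int p ^ 2 dvd int p * (t * \<alpha> c)"
        using d by (simp add: dvd_diff_left_iff mult.left_commute)
      then show False using na [OF c] nt prime_dvd_mult_iff [OF pp] by (auto simp: psq)
    qed
    show ?thesis
    proof (cases b)
      case None
      have False if "b' = Some c" "c \<in> {1..<int p}" for c
        by (rule * [OF that(2)]) (use d None that in \<open>simp add: slot1_w_defs\<close>)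
      then show ?thesis using None bb by blast
    next
      case b: (Some c)
      then have c: "c \<in> {1..<int p}" using bb by auto
      show ?thesis
      proof (cases b')
        case None
        then have "int p ^ 2 dvd t * (int p * \<alpha> c) - int p ^ 2 * (\<alpha> c * c + int p * \<beta> c)"
          using d b by (simp add: slot1_w_defs mult.commute dvd_diff_commute)
        then show ?thesis using * [OF c] by blast
      next
        case b': (Some c')
        then have c': "c' \<in> {1..<int p}" using bb by auto
        have "(\<alpha> c * c + int p * \<beta> c) * (int p * \<alpha> c') - (int p * \<alpha> c) * (\<alpha> c' * c' + int p * \<beta> c') =
          int p * (\<alpha> c * \<alpha> c' * (c - c') + int p * (\<beta> c * \<alpha> c' - \<alpha> c * \<beta> c'))"
          by (simp add: algebra_simps)
        then have "int p dvd \<alpha> c * \<alpha> c' * (c - c') + int p * (\<beta> c * \<alpha> c' - \<alpha> c * \<beta> c')"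
          using d b b' by (simp add: slot1_w_defs psq)
        then have "int p dvd \<alpha> c * \<alpha> c' * (c - c')" by (simp add: dvd_add_left_iff)
        then have "int p dvd c - c'" using na [OF c] na [OF c'] prime_dvd_mult_iff [OF pp] by blast
        then show ?thesis using residue_unique [of p c c'] c c' b b' by auto
      qed
    qed
  qed
  \<comment> \<open>For \<open>x = p z\<close> only \<open>z\<close> modulo \<open>p\<close>
    matters: \<open>None\<close> serves \<open>z = 0\<close>, and otherwise \<open>b\<close> is
    \<open>y / z\<close> modulo \<open>p\<close>, nonzero because \<open>y\<close> is a
    unit.\<close>
  have sur: "\<exists>b\<in>?B. int p ^ 2 dvd y * ?w1 b - x * ?w2 b" if x: "int p dvd x" and y: "\<not> int p dvd y" for x y
  proof -
    obtain z where z: "x = int p * z" using x by auto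
    show ?thesis
    proof (cases "int p dvd z")
      case True
      then have "int p ^ 2 dvd x" by (simp add: z psq)
      then show ?thesis by (intro bexI [of _ None]) (auto simp: slot1_w_defs)
    next
      case False
      then obtain b where b: "b \<in> {0..<int p}" "int p dvd y - z * b"
        using residue_exists [OF p False, of 0 y] by auto
      have "b \<noteq> 0" using b y by auto
      then have b': "b \<in> {1..<int p}" using b by auto
      have "y * (int p * \<alpha> b) - x * (\<alpha> b * b + int p * \<beta> b) = int p * (\<alpha> b * (y - z * b) - int p * (z * \<beta> b))"
        by (simp add: z algebra_simps)
      moreover have "int p dvd \<alpha> b * (y - z * b) - int p * (z * \<beta> b)" using b by simp
      ultimately show ?thesis using b' by (intro bexI [of _ "Some b"]) (auto simp: slot1_w_defs psq)
    qed
  qed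
  define f where "f = (\<lambda>i. of_real (det (delta1_A p i) / 1) ^ k *
     F ((1 / 1) *\<^sub>R (cmat (delta1_A p i) ** (\<tau> + cmat (delta1_S p i)) ** cmat (transpose (delta1_A p i)))))"
  define h where "h = (\<lambda>i. cnj (char_mat \<chi>' (delta1_rep N ?w1 ?w2 ?w4 i)) * char_mat \<chi>' (delta1_G N p \<alpha> \<beta> t e i))"
  have fin: "finite (lines p)" by (simp add: lines_def)
  have ld: "det (line_mat i) = 1" "det (line_mat' i) = 1" for i
    using line_det_real [of i] by (simp_all add: line_mat_def line_mat'_def imk2_def det_mk2 mult.commute)
  have one: "char_mat \<chi>' (mat 1) = 1"
    using char_mat_block [of \<chi>' _ _ _ 1 0 0 1] dirichlet_character_one [OF \<chi>]
    unfolding mat_block imk2_one [symmetric] by simp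
  have "hecke_sum k N \<chi>' (delta1 p) F \<tau> = (\<Sum>i\<in>delta1_indices p. h i * f i)"
    unfolding h_def f_def
  proof (rule hecke_sum_representatives [OF F \<chi> k N delta1_def _ det_delta1 [OF p0]])
    show "det (mk2 (1 / real p) 0 0 1) \<noteq> 0" using p0 by (simp add: det_mk2)
    show "delta1_rep N ?w1 ?w2 ?w4 i \<in> Gamma0 N" if "i \<in> delta1_indices p" for i
      using that w by (intro delta1_rep_Gamma0) (auto simp: delta1_indices_def)
    show "delta1_G N p \<alpha> \<beta> t e i \<in> Gamma0 N" if "i \<in> delta1_indices p" for i
    proof (cases i)
      case (Inr q)
      obtain j b where q: "q = (j, b)" by (cases q)
      show ?thesis
      proof (cases b)
        case None
        have "slot1 1 t (int N * 1) (int p ^ 2 * e) \<in> Gamma0 N"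
          by (rule slot1_Gamma0) (use te in simp)
        then show ?thesis by (simp only: Inr q None delta1_G.simps)
      next
        case (Some c)
        then have "\<alpha> c * (int p - int N * c) - int N * int p * \<beta> c = 1"
          using that ab Inr q by (auto simp: delta1_indices_def)
        then have "slot1 (\<alpha> c) (\<beta> c) (int N * int p) (int p - int N * c) \<in> Gamma0 N"
          by (rule slot1_Gamma0)
        then show ?thesis by (simp only: Inr q Some delta1_G.simps)
      qed
    qed (simp add: Gamma0_one)
  qed (use p0 \<tau> in \<open>auto simp: delta1_decompose delta1_upper transpose_delta1_S
         intro: delta1_rep_disjoint [OF p w sep] delta1_rep_cover [OF p w sur]\<close>)
  also have "\<dots> = (\<Sum>i\<in>lines p \<times> {0..<int p ^ 2} \<times> {0..<int p}. h (Inl i) * f (Inl i)) +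
     (\<Sum>i\<in>lines p \<times> ?B. h (Inr i) * f (Inr i))"
    using fin by (simp add: delta1_indices_def sum.Plus)
  also have "(\<Sum>i\<in>lines p \<times> {0..<int p ^ 2} \<times> {0..<int p}. h (Inl i) * f (Inl i)) =
      (\<Sum>(i, x, y)\<in>lines p \<times> {0..<int p ^ 2} \<times> {0..<int p}.
        (1 / of_nat p) ^ k * F (affine_action 1 (mk2 (1 / real p) 0 0 1 ** line_mat i) (delta1_sym i x y) \<tau>))"
  proof (intro sum.cong refl, clarify)
    fix i x y
    have "line_d i * line_a i - - line_c i * - line_b i = line_a i * line_d i - line_b i * line_c i"
      by simp
    then have "h (Inl (i, x, y)) = 1"
      by (simp add: h_def one char_mat_block line_det dirichlet_character_one [OF \<chi>])
    then show "h (Inl (i, x, y)) * f (Inl (i, x, y)) =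
        (1 / of_nat p) ^ k * F (affine_action 1 (mk2 (1 / real p) 0 0 1 ** line_mat i) (delta1_sym i x y) \<tau>)"
      by (simp add: f_def affine_action_def det_mul det_mk2 ld)
  qed
  also have "(\<Sum>i\<in>lines p \<times> ?B. h (Inr i) * f (Inr i)) =
    \<chi>' (int p) * (\<Sum>(i, b)\<in>lines p \<times> {1..<int p}. F (affine_action 1 (line_mat' i) (line_sym' i (of_int b / real p)) \<tau>)) +
    \<chi>' (int p) ^ 2 * (\<Sum>i\<in>lines p. of_nat p ^ k * F (affine_action 1 (mk2 (real p) 0 0 1 ** line_mat' i) 0 \<tau>))"
  proof -
    have char: "char_mat \<chi>' (delta1_rep N ?w1 ?w2 ?w4 (Inr (i, b))) = \<chi>' (?w4 b)" for i b
    proof -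
      have "?w4 b * line_a i * line_d i - ?w4 b * line_b i * line_c i = ?w4 b * (line_a i * line_d i - line_b i * line_c i)"
        by (simp add: algebra_simps)
      then show ?thesis by (simp add: char_mat_block line_det)
    qed
    have "[e * int p ^ 2 = 1] (mod int N)"
    proof -
      have "e * int p ^ 2 - 1 = int N * t" using te by (simp add: algebra_simps)
      then show ?thesis by (simp add: cong_iff_dvd_diff)
    qed
    then have "coprime e (int N)" by (meson coprime_iff_invertible_int)
    then have ce: "cnj (\<chi>' e) * \<chi>' e = 1" by (rule dirichlet_character_cnj [OF \<chi> N])
    have "h (Inr (i, None)) = (cnj (\<chi>' e) * \<chi>' e) * \<chi>' (int p) ^ 2" for i
      unfolding h_def char
      by (simp add: slot1_w_defs slot1_def char_mat_block dirichlet_character_mult [OF \<chi>] power2_eq_square mult_ac)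
    then have h2: "h (Inr (i, None)) = \<chi>' (int p) ^ 2" for i by (simp add: ce)
    have "\<chi>' (int p - int N * b) = \<chi>' (int p)" for b
      by (rule dirichlet_character_cong [OF \<chi>]) (simp add: cong_iff_dvd_diff)
    then have h1: "h (Inr (i, Some b)) = \<chi>' (int p)" for i b
      unfolding h_def char
      by (simp add: slot1_w_defs slot1_def char_mat_block dirichlet_character_one [OF \<chi>])
    have f1: "f (Inr (i, Some b)) = F (affine_action 1 (line_mat' i) (line_sym' i (of_int b / real p)) \<tau>)" for i b
      by (simp add: f_def affine_action_def ld)
    have f2: "f (Inr (i, None)) = of_nat p ^ k * F (affine_action 1 (mk2 (real p) 0 0 1 ** line_mat' i) 0 \<tau>)" for i
      by (simp add: f_def affine_action_def det_mul det_mk2 ld)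
    have "(\<Sum>i\<in>lines p \<times> ?B. h (Inr i) * f (Inr i)) = (\<Sum>i\<in>lines p. \<Sum>b\<in>?B. h (Inr (i, b)) * f (Inr (i, b)))"
      unfolding sum.cartesian_product by (intro sum.cong) auto
    also have "\<dots> = (\<Sum>i\<in>lines p. \<chi>' (int p) * (\<Sum>b\<in>{1..<int p}. F (affine_action 1 (line_mat' i) (line_sym' i (of_int b / real p)) \<tau>)) +
       \<chi>' (int p) ^ 2 * (of_nat p ^ k * F (affine_action 1 (mk2 (real p) 0 0 1 ** line_mat' i) 0 \<tau>)))"
      by (intro sum.cong refl) (simp add: sum.reindex h1 h2 f1 f2 sum_distrib_left add.commute)
    finally show ?thesis
      by (simp add: sum.distrib sum.cartesian_product flip: sum_distrib_left)
  qed
  finally show ?thesis by (simp only: add.assoc)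
qed

section \<open>Comparison of Fourier coefficients\<close>

definition cexp :: "complex \<Rightarrow> complex" where "cexp z = exp (2 * of_real pi * \<i> * z)"

lemma cexp_add: "cexp (x + y) = cexp x * cexp y"
  by (simp add: cexp_def distrib_left exp_add)

lemma cexp_of_real: "cexp (of_real x) = cis (2 * pi * x)"
  by (simp add: cexp_def cis_conv_exp mult_ac)

lemma cexp_of_int [simp]: "cexp (of_int n) = 1"
  using cexp_of_real [of "of_int n"] cis_multiple_2pi [of "of_int n"] by simp

text \<open>Summation runs over all real matrices and the support is left to the coefficients, so
  that a substitution in the variable merely permutes the index set.\<close>

definition fourier_series :: "(complex mat2 \<Rightarrow> complex) \<Rightarrow> (real mat2 \<Rightarrow> complex) \<Rightarrow> bool" where
  "fourier_series G C \<longleftrightarrow> (\<forall>\<tau>\<in>siegel2. ((\<lambda>T. C T * cexp (trace (cmat T ** \<tau>))) has_sum G \<tau>) UNIV)"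

lemma fourier_series_cmult: "fourier_series G C \<Longrightarrow> fourier_series (\<lambda>\<tau>. z * G \<tau>) (\<lambda>T. z * C T)"
  unfolding fourier_series_def mult.assoc by (auto intro!: has_sum_cmult_right)

lemma fourier_series_add: "fourier_series G C \<Longrightarrow> fourier_series G' C' \<Longrightarrow> fourier_series (\<lambda>\<tau>. G \<tau> + G' \<tau>) (\<lambda>T. C T + C' T)"
  unfolding fourier_series_def distrib_right by (auto intro!: has_sum_add)

lemma fourier_series_sum:
  assumes "\<And>i. i \<in> I \<Longrightarrow> fourier_series (G i) (C i)"
  shows "fourier_series (\<lambda>\<tau>. \<Sum>i\<in>I. G i \<tau>) (\<lambda>T. \<Sum>i\<in>I. C i T)"
  unfolding fourier_series_def sum_distrib_right
  using assms by (intro ballI has_sum_sum_finite) (simp add: fourier_series_def)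

definition coeff_ext :: "(real mat2 \<Rightarrow> complex) \<Rightarrow> real mat2 \<Rightarrow> complex" where
  "coeff_ext a T = (if T \<in> half_integral_psd then a T else 0)"

lemma fourier_series_fourier_expansion:
  assumes "fourier_expansion F a" shows "fourier_series F (coeff_ext a)"
  unfolding fourier_series_def
proof
  fix \<tau> assume "\<tau> \<in> siegel2"
  then have "((\<lambda>T. a T * cexp (trace (cmat T ** \<tau>))) has_sum F \<tau>) half_integral_psd"
    using assms by (simp add: fourier_expansion_def cexp_def)
  then show "((\<lambda>T. coeff_ext a T * cexp (trace (cmat T ** \<tau>))) has_sum F \<tau>) UNIV"
    by (rule has_sum_cong_neutral [THEN iffD1, rotated -1]) (auto simp: coeff_ext_def)
qed

lemma trace_act:
  "trace (cmat T ** affine_action c A S \<tau>) =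
     trace (cmat (c *\<^sub>R (transpose A ** T ** A)) ** \<tau>) + of_real (trace ((c *\<^sub>R (transpose A ** T ** A)) ** S))"
  by (simp add: affine_action_def trace_def sum_2 matrix_matrix_mult_def cmat_def transpose_def scaleR_conv_of_real [where 'a = complex])
    (simp add: algebra_simps)

text \<open>By \<open>trace_act\<close> the congruence moves from the variable to the index, where
  it is a bijection with inverse given by \<open>B\<close>. The translation leaves an exponential in
  the trace of the new index times \<open>S\<close>.\<close>

lemma fourier_series_act:
  assumes G: "fourier_series G C" and S: "transpose S = S" and A: "A ** B = mat 1" and c: "c > 0"
  shows "fourier_series (\<lambda>\<tau>. G (affine_action c A S \<tau>)) (\<lambda>T. C ((1 / c) *\<^sub>R (transpose B ** T ** B)) * cexp (of_real (trace (T ** S))))"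
  unfolding fourier_series_def
proof
  fix \<tau> assume \<tau>: "\<tau> \<in> siegel2"
  have dA: "det A \<noteq> 0" using A by (metis det_I det_mul mult_zero_left zero_neq_one)
  have BA: "B ** A = mat 1" using A matrix_left_right_inverse by blast
  have tAB: "transpose A ** transpose B = mat 1" "transpose B ** transpose A = mat 1"
    using A BA by (metis matrix_transpose_mul transpose_mat)+
  have "affine_action c A S \<tau> \<in> siegel2"
    unfolding affine_action_def by (rule siegel2_act [OF \<tau> S dA c])
  then have "((\<lambda>T. C T * cexp (trace (cmat T ** affine_action c A S \<tau>))) has_sum G (affine_action c A S \<tau>)) UNIV"
    using G by (simp add: fourier_series_def)
  moreover have inv1: "c *\<^sub>R (transpose A ** ((1 / c) *\<^sub>R (transpose B ** T ** B)) ** A) = T" for T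
  proof -
    have "transpose A ** (transpose B ** T ** B) ** A = (transpose A ** transpose B) ** T ** (B ** A)"
      by (simp only: matrix_mul_assoc)
    then show ?thesis using c by (simp add: scaleR_mult_left scaleR_mult_right tAB BA)
  qed
  moreover have inv2: "(1 / c) *\<^sub>R (transpose B ** (c *\<^sub>R (transpose A ** T ** A)) ** B) = T" for T
  proof -
    have "transpose B ** (transpose A ** T ** A) ** B = (transpose B ** transpose A) ** T ** (A ** B)"
      by (simp only: matrix_mul_assoc)
    then show ?thesis using c by (simp add: scaleR_mult_left scaleR_mult_right tAB A)
  qed
  ultimately show "((\<lambda>T. C ((1 / c) *\<^sub>R (transpose B ** T ** B)) * cexp (of_real (trace (T ** S))) * cexp (trace (cmat T ** \<tau>)))
      has_sum G (affine_action c A S \<tau>)) UNIV"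
    by (subst has_sum_reindex_bij_witness [where i = "\<lambda>T. c *\<^sub>R (transpose A ** T ** A)" and j = "\<lambda>T. (1 / c) *\<^sub>R (transpose B ** T ** B)"
          and T = UNIV and h = "\<lambda>T. C T * cexp (trace (cmat T ** affine_action c A S \<tau>))"])
      (simp_all add: trace_act cexp_add mult_ac)
qed

text \<open>Substitutions whose matrices have denominator \<open>p\<close> lead outside the
  half-integral indices. A common denominator \<open>q\<close> keeps all frequencies in one lattice,
  on which coefficients are unique.\<close>

definition half_lattice :: "nat \<Rightarrow> real mat2 set" where
  "half_lattice q = {T. transpose T = T \<and> int_mat (real q *\<^sub>R T)}"

lemma coeff_ext_lat: "coeff_ext a T \<noteq> 0 \<Longrightarrow> T \<in> half_lattice 2"
  by (auto simp: coeff_ext_def half_integral_psd_def half_lattice_def int_mat_def split: if_splits)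

lemma half_lattice_congruence:
  assumes T: "(1 / c) *\<^sub>R (transpose B ** T ** B) \<in> half_lattice 2" and c: "c \<in> \<int>" "c > 0"
    and A: "A ** B = mat 1" "int_mat (real p *\<^sub>R A)"
  shows "T \<in> half_lattice (2 * p ^ 2)"
proof -
  define T' where "T' = (1 / c) *\<^sub>R (transpose B ** T ** B)"
  have BA: "B ** A = mat 1" using A matrix_left_right_inverse by blast
  have tAB: "transpose A ** transpose B = mat 1"
    using BA by (metis matrix_transpose_mul transpose_mat)
  have "transpose A ** (transpose B ** T ** B) ** A = (transpose A ** transpose B) ** T ** (B ** A)"
    by (simp only: matrix_mul_assoc)
  then have T': "T = c *\<^sub>R (transpose A ** T' ** A)"
    using c by (simp add: T'_def scaleR_mult_left scaleR_mult_right tAB BA)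
  have t: "transpose T' = T'" "int_mat (2 *\<^sub>R T')" using T by (simp_all add: half_lattice_def T'_def)
  have "transpose T = T"
    unfolding T' by (simp add: t(1) matrix_transpose_mul matrix_mul_assoc transpose_scalar)
  moreover have "real (2 * p ^ 2) *\<^sub>R T = c *\<^sub>R (transpose (real p *\<^sub>R A) ** (2 *\<^sub>R T') ** (real p *\<^sub>R A))"
    unfolding T' by (simp add: transpose_scalar scaleR_mult_left scaleR_mult_right power2_eq_square)
  moreover have "int_mat (c *\<^sub>R M)" if "int_mat M" for M :: "real mat2"
    using that c by (auto simp: int_mat_def)
  ultimately show ?thesis
    using A(2) t(2) by (simp add: half_lattice_def int_mat_mult int_mat_transpose)
qed

lemma half_lattice_mono: "T \<in> half_lattice q \<Longrightarrow> T \<in> half_lattice (q * r)"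
proof -
  assume "T \<in> half_lattice q"
  moreover have "real (q * r) *\<^sub>R T = real r *\<^sub>R (real q *\<^sub>R T)" by simp
  moreover have "int_mat (real r *\<^sub>R M)" if "int_mat M" for M :: "real mat2"
    using that by (auto simp: int_mat_def)
  ultimately show ?thesis unfolding half_lattice_def by (metis (no_types, lifting) mem_Collect_eq)
qed

section \<open>Uniqueness of the coefficients on a lattice\<close>

lemma siegel2_base: "mk2 (\<i> + of_real x) (of_real z) (of_real z) (\<i> + of_real y) \<in> siegel2"
proof -
  have "(v::real^2) \<bullet> ((\<chi> i j. Im (mk2 (\<i> + of_real x) (of_real z) (of_real z) (\<i> + of_real y) $ i $ j)) *v v) = v$1^2 + v$2^2" for v
    by (simp add: quadratic_form_2 power2_eq_square)
  moreover have "v$1^2 + v$2^2 > 0" if "v \<noteq> 0" for v :: "real^2"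
    using that by (auto simp: vec_eq_iff forall_2 sum_power2_gt_zero_iff)
  ultimately show ?thesis
    by (simp add: siegel2_def transpose_mk2)
qed

text \<open>On the real translates of the imaginary unit times the identity the series is
  trigonometric in three real variables. \<open>infsum_frequency_zero\<close> separates one
  frequency after the other, until the sum consists of the single index \<open>T\<close>.\<close>

lemma fourier_series_zero_unique:
  assumes C: "fourier_series (\<lambda>_. 0) C" and L: "\<And>T. C T \<noteq> 0 \<Longrightarrow> T \<in> half_lattice q" and q: "q > 0"
  shows "C T = 0"
proof (cases "T \<in> half_lattice q")
  case False
  then show ?thesis using L by blast
next
  case T: True
  define f where "f = (\<lambda>T. C T * cexp (trace (cmat T ** mk2 \<i> 0 0 \<i>)))"
  \<comment> \<open>Both off-diagonal entries multiply the same variable, so only their sum is a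
    frequency; the symmetry of \<open>T\<close> recovers each of them.\<close>
  define \<phi>1 \<phi>2 \<phi>3 where "\<phi>1 = (\<lambda>T::real mat2. \<lfloor>real q * T$1$1\<rfloor>)" "\<phi>2 = (\<lambda>T::real mat2. \<lfloor>real q * (T$1$2 + T$2$1)\<rfloor>)"
    "\<phi>3 = (\<lambda>T::real mat2. \<lfloor>real q * T$2$2\<rfloor>)"
  have \<phi>: "of_int (\<phi>1 T) = real q * T$1$1" "of_int (\<phi>2 T) = real q * (T$1$2 + T$2$1)" "of_int (\<phi>3 T) = real q * T$2$2" 
    "T$2$1 = T$1$2" if "T \<in> half_lattice q" for T
  proof -
    have i: "real q * T$i$j \<in> \<int>" for i j using that by (simp add: half_lattice_def int_mat_def)
    then show "of_int (\<phi>1 T) = real q * T$1$1" "of_int (\<phi>2 T) = real q * (T$1$2 + T$2$1)" "of_int (\<phi>3 T) = real q * T$2$2"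
      using Ints_add [OF i [of 1 2] i [of 2 1]] by (auto simp: \<phi>1_\<phi>2_\<phi>3_def distrib_left of_int_floor)
    have "transpose T $ 1 $ 2 = T $ 1 $ 2" using that by (simp add: half_lattice_def)
    then show "T$2$1 = T$1$2" by (simp only: transpose_def vec_lambda_beta)
  qed
  have hs: "((\<lambda>T. f T * cis (2 * pi * of_int (\<phi>1 T) * x) * cis (2 * pi * of_int (\<phi>2 T) * z) * cis (2 * pi * of_int (\<phi>3 T) * y)) has_sum 0) (half_lattice q)"
    for x y z :: real
  proof -
    \<comment> \<open>The real parts are scaled by \<open>q\<close> to make the frequencies
      integers.\<close>
    let ?\<tau> = "mk2 (\<i> + of_real (real q * x)) (of_real (real q * z)) (of_real (real q * z)) (\<i> + of_real (real q * y))"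
    have "((\<lambda>T. C T * cexp (trace (cmat T ** ?\<tau>))) has_sum 0) UNIV"
      using C siegel2_base unfolding fourier_series_def by blast
    then have "((\<lambda>T. C T * cexp (trace (cmat T ** ?\<tau>))) has_sum 0) (half_lattice q)"
      by (rule has_sum_cong_neutral [THEN iffD1, rotated -1]) (use L in auto)
    moreover have "C T * cexp (trace (cmat T ** ?\<tau>)) =
      f T * cis (2 * pi * of_int (\<phi>1 T) * x) * cis (2 * pi * of_int (\<phi>2 T) * z) * cis (2 * pi * of_int (\<phi>3 T) * y)" if "T \<in> half_lattice q" for T
    proof -
      have "trace (cmat T ** ?\<tau>) = trace (cmat T ** mk2 \<i> 0 0 \<i>) + of_real (of_int (\<phi>1 T) * x) + of_real (of_int (\<phi>2 T) * z) + of_real (of_int (\<phi>3 T) * y)"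
        unfolding \<phi>(1-3) [OF that]
        by (simp add: trace_def sum_2 matrix_matrix_mult_def cmat_def algebra_simps)
      then show ?thesis
        unfolding f_def by (simp only: cexp_add cexp_of_real) (simp add: mult.assoc)
    qed
    ultimately show ?thesis by (simp cong: has_sum_cong)
  qed
  have z1: "(\<Sum>\<^sub>\<infinity>T\<in>{T \<in> half_lattice q. \<phi>1 T = n1}. f T * cis (2 * pi * of_int (\<phi>2 T) * z) * cis (2 * pi * of_int (\<phi>3 T) * y)) = 0" for n1 z y
  proof (rule infsum_frequency_zero)
    show "(\<lambda>T. f T * cis (2 * pi * of_int (\<phi>2 T) * z) * cis (2 * pi * of_int (\<phi>3 T) * y)) summable_on half_lattice q"
      using hs [of 0 z y] by (simp add: summable_on_def) blast
    show "(\<Sum>\<^sub>\<infinity>T\<in>half_lattice q. f T * cis (2 * pi * of_int (\<phi>2 T) * z) * cis (2 * pi * of_int (\<phi>3 T) * y) * cis (2 * pi * of_int (\<phi>1 T) * x)) = 0" for x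
      using infsumI [OF hs [of x z y]] by (simp only: mult_ac)
  qed
  have sf: "f summable_on half_lattice q"
    using hs [of 0 0 0] by (simp add: summable_on_def) blast
  have sm: "(\<lambda>T. f T * cis (g T)) summable_on X" if "X \<subseteq> half_lattice q" for g X
  proof -
    have "f summable_on X" by (rule summable_on_subset_banach [OF sf that])
    then have "(\<lambda>T. norm (f T)) summable_on X" by (rule summable_on_iff_abs_summable_on_complex [THEN iffD1])
    then have "(\<lambda>T. norm (f T * cis (g T))) summable_on X" by (simp only: norm_mult norm_cis mult_1_right)
    then show ?thesis by (rule abs_summable_summable)
  qed
  have z2: "(\<Sum>\<^sub>\<infinity>T\<in>{T \<in> {T \<in> half_lattice q. \<phi>1 T = n1}. \<phi>2 T = n2}. f T * cis (2 * pi * of_int (\<phi>3 T) * y)) = 0" for n1 n2 y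
  proof (rule infsum_frequency_zero)
    show "(\<lambda>T. f T * cis (2 * pi * of_int (\<phi>3 T) * y)) summable_on {T \<in> half_lattice q. \<phi>1 T = n1}"
      by (rule sm) auto
    show "(\<Sum>\<^sub>\<infinity>T\<in>{T \<in> half_lattice q. \<phi>1 T = n1}. f T * cis (2 * pi * of_int (\<phi>3 T) * y) * cis (2 * pi * of_int (\<phi>2 T) * x)) = 0" for x
      using z1 [where ?n1.0 = n1 and z = x and y = y] by (simp only: mult_ac)
  qed
  have z3: "infsum f {T \<in> {T \<in> {T \<in> half_lattice q. \<phi>1 T = n1}. \<phi>2 T = n2}. \<phi>3 T = n3} = 0" for n1 n2 n3
    by (rule infsum_frequency_zero [OF _ z2]) (use sm [of _ "\<lambda>_. 0"] in auto)
  have "{T' \<in> {T' \<in> {T' \<in> half_lattice q. \<phi>1 T' = \<phi>1 T}. \<phi>2 T' = \<phi>2 T}. \<phi>3 T' = \<phi>3 T} = {T}"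
  proof -
    have "T' = T" if "T' \<in> half_lattice q" "\<phi>1 T' = \<phi>1 T" "\<phi>2 T' = \<phi>2 T" "\<phi>3 T' = \<phi>3 T" for T'
      using \<phi> [OF that(1)] \<phi> [OF T] q unfolding that(2-4) by (simp add: mat2_eq_iff)
    then show ?thesis using T by auto
  qed
  then have "f T = 0" using z3 [of "\<phi>1 T" "\<phi>2 T" "\<phi>3 T"] by simp
  then show ?thesis by (simp add: f_def cexp_def)
qed

lemma fourier_series_unique:
  assumes "fourier_series G C" "fourier_series G C'" and L: "\<And>T. C T \<noteq> 0 \<Longrightarrow> T \<in> half_lattice q" "\<And>T. C' T \<noteq> 0 \<Longrightarrow> T \<in> half_lattice q" and q: "q > 0"
  shows "C T = C' T"
proof -
  have "fourier_series (\<lambda>_. 0) (\<lambda>T. C T + (- 1) * C' T)"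
    using fourier_series_add [OF assms(1) fourier_series_cmult [OF assms(2), of "-1"]] by simp
  then have "C T + (- 1) * C' T = 0"
  proof (rule fourier_series_zero_unique [OF _ _ q])
    fix T assume "C T + (- 1) * C' T \<noteq> 0"
    then have "C T \<noteq> 0 \<or> C' T \<noteq> 0" by auto
    then show "T \<in> half_lattice q" using L by blast
  qed
  then show ?thesis by simp
qed

definition lattice_series :: "nat \<Rightarrow> (complex mat2 \<Rightarrow> complex) \<Rightarrow> (real mat2 \<Rightarrow> complex) \<Rightarrow> bool" where
  "lattice_series q G C \<longleftrightarrow> fourier_series G C \<and> (\<forall>T. C T \<noteq> 0 \<longrightarrow> T \<in> half_lattice q)"

lemma lattice_series_cmult: "lattice_series q G C \<Longrightarrow> lattice_series q (\<lambda>\<tau>. z * G \<tau>) (\<lambda>T. z * C T)"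
  by (auto simp: lattice_series_def intro: fourier_series_cmult)

lemma lattice_series_add:
  assumes "lattice_series q G C" "lattice_series q G' C'"
  shows "lattice_series q (\<lambda>\<tau>. G \<tau> + G' \<tau>) (\<lambda>T. C T + C' T)"
proof -
  have "C T \<noteq> 0 \<or> C' T \<noteq> 0" if "C T + C' T \<noteq> 0" for T using that by auto
  then show ?thesis using assms by (auto simp: lattice_series_def intro!: fourier_series_add)
qed

lemma lattice_series_sum:
  assumes "\<And>i. i \<in> I \<Longrightarrow> lattice_series q (G i) (C i)"
  shows "lattice_series q (\<lambda>\<tau>. \<Sum>i\<in>I. G i \<tau>) (\<lambda>T. \<Sum>i\<in>I. C i T)"
proof -
  have "\<exists>i\<in>I. C i T \<noteq> 0" if "(\<Sum>i\<in>I. C i T) \<noteq> 0" for T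
    using that by (meson sum.not_neutral_contains_not_neutral)
  then show ?thesis using assms by (fastforce simp: lattice_series_def intro!: fourier_series_sum)
qed

lemma lattice_series_act:
  assumes "lattice_series 2 G C" and S: "transpose S = S" and A: "A ** B = mat 1" "int_mat (real p *\<^sub>R A)"
    and c: "c \<in> \<int>" "c > 0"
  shows "lattice_series (2 * p ^ 2) (\<lambda>\<tau>. G (affine_action c A S \<tau>)) (\<lambda>T. C ((1 / c) *\<^sub>R (transpose B ** T ** B)) * cexp (of_real (trace (T ** S))))"
  using assms fourier_series_act [of G C S A B c] half_lattice_congruence [OF _ c A] unfolding lattice_series_def by auto

lemma lattice_series_mono: "lattice_series q G C \<Longrightarrow> lattice_series (q * r) G C"
  by (auto simp: lattice_series_def intro: half_lattice_mono)

lemma lattice_series_cong: "lattice_series q G C \<Longrightarrow> (\<And>\<tau>. \<tau> \<in> siegel2 \<Longrightarrow> G' \<tau> = G \<tau>) \<Longrightarrow> lattice_series q G' C"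
  by (simp add: lattice_series_def fourier_series_def)

lemma lattice_series_unique:
  "lattice_series q G C \<Longrightarrow> lattice_series q G' C' \<Longrightarrow> q > 0 \<Longrightarrow> (\<And>\<tau>. \<tau> \<in> siegel2 \<Longrightarrow> G \<tau> = G' \<tau>) \<Longrightarrow> C T = C' T"
  unfolding lattice_series_def by (rule fourier_series_unique [where q = q and G = G']) (auto simp: fourier_series_def)

section \<open>Invariance under integral congruence and the coefficient formulas\<close>

lemma cexp_Ints: "r \<in> \<int> \<Longrightarrow> cexp (of_real r) = 1"
  by (auto elim!: Ints_cases)

text \<open>A block diagonal element of \<open>Gamma0 N\<close> acts on the index by congruence with
  an integer matrix of determinant 1 or -1. For determinant -1 the factor
  \<open>\<chi>' (- 1) * (- 1) ^ k\<close> appears, the source of \<open>eps\<close> and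
  \<open>eta\<close>.\<close>

lemma coefficient_GL2:
  assumes F: "siegel_modular_form k N \<chi>' F" and C: "lattice_series 2 F C"
    and \<epsilon>: "v1 * v4 - v2 * v3 = \<epsilon>" "\<epsilon> * \<epsilon> = 1"
  shows "C (transpose (imk2 v1 v2 v3 v4) ** T ** imk2 v1 v2 v3 v4) = \<chi>' \<epsilon> * of_int \<epsilon> ^ k * C T"
proof -
  define V where "V = imk2 v1 v2 v3 v4"
  \<comment> \<open>The inverse of \<open>V\<close>: its adjugate times \<open>\<epsilon>\<close>,
    which is its own inverse.\<close>
  define A where "A = imk2 (\<epsilon> * v4) (- \<epsilon> * v2) (- \<epsilon> * v3) (\<epsilon> * v1)"
  have e: "\<epsilon> * v4 * v1 - \<epsilon> * v2 * v3 = 1" 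
    using arg_cong [OF \<epsilon>(1), of "\<lambda>x. \<epsilon> * x"] \<epsilon>(2) by (simp add: algebra_simps)
  have AV: "A ** V = mat 1"
    using e by (simp add: A_def V_def imk2_mult imk2_one imk2_eq_iff algebra_simps)
  have AD: "transpose A ** transpose V = mat 1"
    using AV matrix_left_right_inverse by (metis matrix_transpose_mul transpose_mat)
  define M where "M = block A (A ** 0) 0 (transpose V)"
  have "M \<in> Gamma0 N"
    unfolding M_def A_def V_def matrix_mult_zero imk2_transpose
    unfolding imk2_zero
    by (rule Gamma0_imk2_intro [of _ 0 _ 0 _ 0 _ 0]) (use e in \<open>auto simp: algebra_simps\<close>)
  have dA: "det A = of_int \<epsilon>"
  proof -
    have "\<epsilon> * v4 * (\<epsilon> * v1) - - \<epsilon> * v2 * (- \<epsilon> * v3) = \<epsilon> * \<epsilon> * (v1 * v4 - v2 * v3)"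
      by (simp add: algebra_simps)
    then show ?thesis unfolding A_def imk2_det by (simp add: \<epsilon>)
  qed
  have cM: "char_mat \<chi>' M = \<chi>' \<epsilon>"
    unfolding M_def V_def imk2_transpose char_mat_block using \<epsilon> by (simp add: mult.commute)
  have "of_int \<epsilon> ^ k * F (affine_action 1 A 0 \<tau>) = \<chi>' \<epsilon> * F \<tau>" if "\<tau> \<in> siegel2" for \<tau>
  proof -
    have "slash k F M \<tau> = \<chi>' \<epsilon> * F \<tau>"
      using F \<open>M \<in> Gamma0 N\<close> that by (simp add: siegel_modular_form_def cM)
    moreover have "slash k F M \<tau> = of_int \<epsilon> ^ k * F (affine_action 1 A 0 \<tau>)"
      unfolding M_def by (subst slash_upper [OF AD]) (simp_all add: affine_action_def dA)
    ultimately show ?thesis by simp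
  qed
  note eq = this
  have i: "int_mat (real 1 *\<^sub>R A)" by (simp add: A_def)
  have L: "lattice_series 2 (\<lambda>\<tau>. of_int \<epsilon> ^ k * F (affine_action 1 A 0 \<tau>))
      (\<lambda>T. of_int \<epsilon> ^ k * (C ((1 / 1) *\<^sub>R (transpose V ** T ** V)) * cexp (of_real (trace (T ** 0)))))"
    using lattice_series_cmult [OF lattice_series_act [OF C _ AV i, of 0 1]] by simp
  have "of_int \<epsilon> ^ k * (C ((1 / 1) *\<^sub>R (transpose V ** T ** V)) * cexp (of_real (trace (T ** 0)))) = \<chi>' \<epsilon> * C T"
    by (rule lattice_series_unique [OF L lattice_series_cmult [OF C]]) (use eq in auto)
  then have "of_int \<epsilon> ^ k * C (transpose V ** T ** V) = \<chi>' \<epsilon> * C T"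
    by (simp add: trace_def cexp_def)
  moreover have "of_int \<epsilon> ^ k * (of_int \<epsilon> :: complex) ^ k = 1"
    by (metis \<epsilon>(2) of_int_1 of_int_mult power_mult_distrib power_one)
  ultimately show ?thesis
    unfolding V_def [symmetric] by (metis mult.assoc mult.commute mult_1)
qed

text \<open>The Gram matrix of the columns of the inverse of \<open>line_mat i\<close> times
  \<open>diag(p, 1)\<close>, which span a sublattice of index \<open>p\<close>.\<close>

definition line_form :: "nat \<Rightarrow> int option \<Rightarrow> real mat2" where
  "line_form p i = imk2 (int p ^ 2 * (line_d i ^ 2 + line_c i ^ 2)) (- int p * (line_b i * line_d i + line_a i * line_c i))
     (- int p * (line_b i * line_d i + line_a i * line_c i)) (line_a i ^ 2 + line_b i ^ 2)"

text \<open>For integral \<open>\<nu>\<close> this is the sum over the \<open>p + 1\<close> sublattices of index \<open>p\<close> of the form \<open>\<nu> I\<close>; the Hecke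
  relations also use it at \<open>\<nu> = n / p\<close> and \<open>\<nu> = n / p\<^sup>2\<close>.\<close>

definition line_sum :: "(real mat2 \<Rightarrow> complex) \<Rightarrow> nat \<Rightarrow> real \<Rightarrow> complex" where
  "line_sum C p \<nu> = (\<Sum>i\<in>lines p. C (\<nu> *\<^sub>R line_form p i))"

lemma line_mat_inv: "line_mat i ** imk2 (line_d i) (- line_b i) (- line_c i) (line_a i) = mat 1"
  using line_det [of i] unfolding line_mat_def imk2_mult imk2_one imk2_eq_iff by (simp add: algebra_simps)

lemma line_mat'_inv: "line_mat' i ** imk2 (line_a i) (line_c i) (line_b i) (line_d i) = mat 1"
  using line_det [of i] unfolding line_mat'_def imk2_mult imk2_one imk2_eq_iff by (simp add: algebra_simps)

lemma scaled_line_mat: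
  assumes "p > 0"
  shows "mk2 (1 / real p) 0 0 1 ** line_mat i ** (imk2 (line_d i) (- line_b i) (- line_c i) (line_a i) ** mk2 (real p) 0 0 1) = mat 1"
    "int_mat (real p *\<^sub>R (mk2 (1 / real p) 0 0 1 ** line_mat i))"
proof -
  have "mk2 (1 / real p) 0 0 1 ** line_mat i ** (imk2 (line_d i) (- line_b i) (- line_c i) (line_a i) ** mk2 (real p) 0 0 1)
     = mk2 (1 / real p) 0 0 1 ** (line_mat i ** imk2 (line_d i) (- line_b i) (- line_c i) (line_a i)) ** mk2 (real p) 0 0 1"
    by (simp only: matrix_mul_assoc)
  then show "mk2 (1 / real p) 0 0 1 ** line_mat i ** (imk2 (line_d i) (- line_b i) (- line_c i) (line_a i) ** mk2 (real p) 0 0 1) = mat 1"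
    using assms by (simp add: line_mat_inv mk2_simps mat_mk2)
  show "int_mat (real p *\<^sub>R (mk2 (1 / real p) 0 0 1 ** line_mat i))"
    using assms by (simp add: line_mat_def imk2_def mk2_simps int_mat_mk2)
qed

lemma scaled_line_mat':
  assumes "p > 0"
  shows "mk2 (real p) 0 0 1 ** line_mat' i ** (imk2 (line_a i) (line_c i) (line_b i) (line_d i) ** mk2 (1 / real p) 0 0 1) = mat 1"
    "int_mat (real p *\<^sub>R (mk2 (real p) 0 0 1 ** line_mat' i))"
proof -
  have "mk2 (real p) 0 0 1 ** line_mat' i ** (imk2 (line_a i) (line_c i) (line_b i) (line_d i) ** mk2 (1 / real p) 0 0 1)
     = mk2 (real p) 0 0 1 ** (line_mat' i ** imk2 (line_a i) (line_c i) (line_b i) (line_d i)) ** mk2 (1 / real p) 0 0 1"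
    by (simp only: matrix_mul_assoc)
  then show "mk2 (real p) 0 0 1 ** line_mat' i ** (imk2 (line_a i) (line_c i) (line_b i) (line_d i) ** mk2 (1 / real p) 0 0 1) = mat 1"
    using assms by (simp add: line_mat'_inv mk2_simps mat_mk2)
  show "int_mat (real p *\<^sub>R (mk2 (real p) 0 0 1 ** line_mat' i))"
    using assms by (simp add: line_mat'_def imk2_def mk2_simps int_mat_mk2)
qed

lemma powi_shift:
  assumes "p > 0"
  shows "(of_nat p :: complex) powi (int k - 3) * (of_nat p ^ 3 * (1 / of_nat p) ^ k) = 1"
    "(of_nat p :: complex) powi (int k - 3) * of_nat p = of_nat p powi (int k - 2)"
    "(of_nat p :: complex) powi (int k - 3) * of_nat p ^ k = of_nat p * (of_nat p powi (int k - 2)) ^ 2"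
proof -
  have nz: "(of_nat p :: complex) \<noteq> 0" using assms by simp
  show "(of_nat p :: complex) powi (int k - 3) * (of_nat p ^ 3 * (1 / of_nat p) ^ k) = 1"
    using nz by (simp add: power_int_diff power_one_over)
  show "(of_nat p :: complex) powi (int k - 3) * of_nat p = of_nat p powi (int k - 2)"
    using nz by (simp add: power_int_diff field_simps power2_eq_square power3_eq_cube)
  show "(of_nat p :: complex) powi (int k - 3) * of_nat p ^ k = of_nat p * (of_nat p powi (int k - 2)) ^ 2"
    using nz by (simp add: power_int_diff field_simps power2_eq_square power3_eq_cube)
qed

text \<open>Both operators end in three terms weighted as in \<open>powi_shift\<close>. Abstracting
  the weights gives the two relations a common shape, in which they can be combined.\<close>

lemma hecke_factors:
  fixes P X Q b :: complex
  assumes "P * (X * Y) = 1" "P * b = Q" "P * d = b * Q ^ 2"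
  shows "P * (X * Y * u + c * (b * w) + c ^ 2 * (d * v)) = u + c * Q * w + b * (c * Q) ^ 2 * v"
proof -
  have "P * (X * Y * u + c * (b * w) + c ^ 2 * (d * v)) = (P * (X * Y)) * u + c * (P * b) * w + c ^ 2 * (P * d) * v"
    by (simp add: algebra_simps)
  then show ?thesis unfolding assms by (simp add: power_mult_distrib mult_ac)
qed

text \<open>At a scalar index the traces against the integral translations are integers. All
  exponentials are therefore 1, and the translations contribute only their number,
  \<open>p ^ 3\<close> for the first kind and \<open>p\<close> for each line.\<close>

lemma hecke_T_coefficient:
  assumes F: "siegel_modular_form k N \<chi>' F" and \<chi>: "dirichlet_character N \<chi>'" and k: "k > 0" and N: "N > 0"
    and p: "prime p" and C: "lattice_series 2 F C" and eig: "has_eigenvalue (hecke_T k N \<chi>' p) F lam"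
  shows "lam * C (mat (real n)) = C (mat (real (p * n))) +
    \<chi>' (int p) * of_nat p powi (int k - 2) * line_sum C p (real n / real p) +
    of_nat p * (\<chi>' (int p) * of_nat p powi (int k - 2)) ^ 2 * C (mat (real n / real p))"
proof -
  have p0: "p > 0" using p prime_gt_0_nat by blast
  have pZ: "real p \<in> \<int>" "real p > 0" using p0 by auto
  define B where "B = (\<lambda>i. imk2 (line_d i) (- line_b i) (- line_c i) (line_a i) ** mk2 (real p) 0 0 1)"
  define C1 where "C1 = (\<lambda>q T. (1 / of_nat p) ^ k *
      (C ((1 / real p) *\<^sub>R (transpose (mk2 (real p) 0 0 (real p)) ** T ** mk2 (real p) 0 0 (real p))) *
        cexp (of_real (trace (T ** (case q of (x, y, z) \<Rightarrow> imk2 x y y z))))))"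
  define C2 where "C2 = (\<lambda>q T. C ((1 / real p) *\<^sub>R (transpose (B (fst q)) ** T ** B (fst q))) *
        cexp (of_real (trace (T ** line_sym (fst q) (of_int (snd q))))))"
  define C3 where "C3 = (\<lambda>T. of_nat p ^ k * (C ((1 / real p) *\<^sub>R (transpose (mat 1) ** T ** mat 1)) * cexp (of_real (trace (T ** 0)))))"
  have L1: "lattice_series (2 * p ^ 2) (\<lambda>\<tau>. (1 / of_nat p) ^ k * F (affine_action (real p) (mk2 (1 / real p) 0 0 (1 / real p)) (case q of (x, y, z) \<Rightarrow> imk2 x y y z) \<tau>)) (C1 q)" for q
    unfolding C1_def
    by (intro lattice_series_cmult lattice_series_act C pZ)
      (use p0 in \<open>auto simp: imk2_transpose mk2_simps mat_mk2 int_mat_mk2 split: prod.splits\<close>)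
  have L2: "lattice_series (2 * p ^ 2) (\<lambda>\<tau>. F (affine_action (real p) (mk2 (1 / real p) 0 0 1 ** line_mat (fst q)) (line_sym (fst q) (of_int (snd q))) \<tau>)) (C2 q)" for q
    unfolding C2_def B_def by (intro lattice_series_act C pZ scaled_line_mat [OF p0] transpose_line_sym)
  have L3: "lattice_series (2 * p ^ 2) (\<lambda>\<tau>. of_nat p ^ k * F (affine_action (real p) (mat 1) 0 \<tau>)) C3"
    unfolding C3_def by (intro lattice_series_cmult lattice_series_act C pZ) (auto simp: mat_mk2 mk2_simps int_mat_mk2)
  let ?X = "{0..<int p} \<times> {0..<int p} \<times> {0..<int p}" and ?Y = "lines p \<times> {0..<int p}"
  have L: "lattice_series (2 * p ^ 2) (hecke_T k N \<chi>' p F) (\<lambda>T. of_nat p powi (int k - 3) *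
     ((\<Sum>q\<in>?X. C1 q T) + \<chi>' (int p) * (\<Sum>q\<in>?Y. C2 q T) + \<chi>' (int p) ^ 2 * C3 T))"
    (is "lattice_series _ _ ?R")
  proof (rule lattice_series_cong)
    show "lattice_series (2 * p ^ 2) (\<lambda>\<tau>. of_nat p powi (int k - 3) * (
       (\<Sum>q\<in>?X. (1 / of_nat p) ^ k * F (affine_action (real p) (mk2 (1 / real p) 0 0 (1 / real p)) (case q of (x, y, z) \<Rightarrow> imk2 x y y z) \<tau>)) +
       \<chi>' (int p) * (\<Sum>q\<in>?Y. F (affine_action (real p) (mk2 (1 / real p) 0 0 1 ** line_mat (fst q)) (line_sym (fst q) (of_int (snd q))) \<tau>)) +
       \<chi>' (int p) ^ 2 * (of_nat p ^ k * F (affine_action (real p) (mat 1) 0 \<tau>)))) ?R"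
      (is "lattice_series _ ?G _")
      by (intro lattice_series_cmult lattice_series_add lattice_series_sum L1 L2 L3)
    show "hecke_T k N \<chi>' p F \<tau> = ?G \<tau>" if "\<tau> \<in> siegel2" for \<tau>
      unfolding hecke_T_def hecke_sum_delta [OF F \<chi> k N p that] by (simp add: case_prod_unfold)
  qed
  have "lam * C (mat (real n)) = ?R (mat (real n))"
  proof (rule lattice_series_unique [OF lattice_series_mono [OF lattice_series_cmult [OF C]] L])
    show "2 * p ^ 2 > 0" using p0 by simp
    show "lam * F \<tau> = hecke_T k N \<chi>' p F \<tau>" if "\<tau> \<in> siegel2" for \<tau>
      using eig that by (simp add: has_eigenvalue_def)
  qed
  also have "(\<Sum>q\<in>?X. C1 q (mat (real n))) = of_nat p ^ 3 * (1 / of_nat p) ^ k * C (mat (real (p * n)))"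
  proof -
    have "C1 q (mat (real n)) = (1 / of_nat p) ^ k * C (mat (real (p * n)))" for q
    proof -
      obtain x y z where q: "q = (x, y, z)" by (cases q)
      have "trace (mat (real n) ** imk2 x y y z) \<in> \<int>"
        by (simp add: imk2_def mat_mk2 mk2_simps)
      then have "cexp (of_real (trace (mat (real n) ** imk2 x y y z))) = 1" by (rule cexp_Ints)
      moreover have "(1 / real p) *\<^sub>R (transpose (mk2 (real p) 0 0 (real p)) ** mat (real n) ** mk2 (real p) 0 0 (real p)) = mat (real (p * n))"
        using p0 by (simp add: mat_mk2 mk2_simps)
      ultimately show ?thesis by (simp add: C1_def q)
    qed
    then show ?thesis by (simp add: card_cartesian_product power3_eq_cube)
  qed
  also have "(\<Sum>q\<in>?Y. C2 q (mat (real n))) = of_nat p * line_sum C p (real n / real p)"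
  proof -
    have "C2 (i, s) (mat (real n)) = C ((real n / real p) *\<^sub>R line_form p i)" for i s
    proof -
      have "trace (mat (real n) ** line_sym i (of_int s)) \<in> \<int>"
        by (simp add: line_sym_def imk2_def mat_mk2 mk2_simps)
      then have "cexp (of_real (trace (mat (real n) ** line_sym i (of_int s)))) = 1" by (rule cexp_Ints)
      moreover have "(1 / real p) *\<^sub>R (transpose (B i) ** mat (real n) ** B i) = (real n / real p) *\<^sub>R line_form p i"
        using p0 by (simp add: B_def line_form_def imk2_def mat_mk2 mk2_simps power2_eq_square field_simps)
      ultimately show ?thesis by (simp add: C2_def)
    qed
    then have "(\<Sum>q\<in>?Y. C2 q (mat (real n))) = (\<Sum>i\<in>lines p. \<Sum>s\<in>{0..<int p}. C ((real n / real p) *\<^sub>R line_form p i))"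
      unfolding sum.cartesian_product by (intro sum.cong) auto
    then show ?thesis by (simp add: line_sum_def sum_distrib_left)
  qed
  also have "C3 (mat (real n)) = of_nat p ^ k * C (mat (real n / real p))"
  proof -
    have "(1 / real p) *\<^sub>R (transpose (mat 1) ** mat (real n) ** mat 1) = (mat (real n / real p) :: real mat2)"
      by (simp add: transpose_mat) (simp add: mat_mk2 mk2_simps)
    then show ?thesis by (simp add: C3_def trace_def cexp_def)
  qed
  finally show ?thesis
    by (simp only: hecke_factors [OF powi_shift [OF p0, of k]])
qed

lemma sum_ee_nonzero_residues:
  assumes p: "prime p"
  shows "(\<Sum>b\<in>{1..<int p}. cexp (of_real (of_int m * (of_int b / real p)))) = (if int p dvd m then of_nat p else 0) - 1"
proof -
  have p0: "p > 0" using p prime_gt_0_nat by blast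
  have "(if int p dvd m then of_nat p else 0) = (\<Sum>j<p. cis (2 * pi * of_int m * (real j / real p)))"
    by (rule sum_cis_roots [OF p0, symmetric])
  also have "\<dots> = (\<Sum>b\<in>{0..<int p}. cexp (of_real (of_int m * (of_int b / real p))))"
    unfolding cexp_of_real
    by (rule sum.reindex_bij_witness [where i = nat and j = int]) (auto simp: mult.assoc)
  also have "{0..<int p} = insert 0 {1..<int p}" using p0 by auto
  also have "(\<Sum>b\<in>insert 0 {1..<int p}. cexp (of_real (of_int m * (of_int b / real p)))) =
      1 + (\<Sum>b\<in>{1..<int p}. cexp (of_real (of_int m * (of_int b / real p))))"
    by (subst sum.insert) (auto simp: cexp_def)
  finally show ?thesis by simp
qed

text \<open>The factor \<open>n\<close> makes this the set of isotropic lines of the form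
  \<open>n I\<close> modulo \<open>p\<close>: all lines if \<open>p\<close> divides
  \<open>n\<close>.\<close>

definition isotropic_lines :: "nat \<Rightarrow> nat \<Rightarrow> int option set" where
  "isotropic_lines p n = {i\<in>lines p. int p dvd int n * (line_a i ^ 2 + line_b i ^ 2)}"

text \<open>The translations by \<open>b / p\<close> with \<open>b\<close> nonzero produce
  exponential sums: every line contributes -1, and an isotropic line \<open>p\<close> in addition.
  The total of -1 over the \<open>p + 1\<close> lines is exactly what the extra term of the modified
  operator cancels.\<close>

lemma hecke_T1_coefficient:
  assumes F: "siegel_modular_form k N \<chi>' F" and \<chi>: "dirichlet_character N \<chi>'" and k: "k > 0" and N: "N > 0"
    and p: "prime p" and pN: "\<not> p dvd N" and C: "lattice_series 2 F C" and eig: "has_eigenvalue (hecke_T1_tilde k N \<chi>' p) F lam"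
  shows "lam * C (mat (real n)) = line_sum C p (real n) +
    \<chi>' (int p) * of_nat p powi (int k - 2) * (of_nat (card (isotropic_lines p n)) * C (mat (real n))) +
    of_nat p * (\<chi>' (int p) * of_nat p powi (int k - 2)) ^ 2 * line_sum C p (real n / real p ^ 2)"
proof -
  have p0: "p > 0" using p prime_gt_0_nat by blast
  have one: "(1::real) \<in> \<int>" "(1::real) > 0" by auto
  have fin: "finite (lines p)" by (simp add: lines_def)
  have cardl: "card (lines p) = p + 1"
    by (simp add: lines_def card_image)
  define B where "B = (\<lambda>i. imk2 (line_d i) (- line_b i) (- line_c i) (line_a i) ** mk2 (real p) 0 0 1)"
  define V where "V = (\<lambda>i. imk2 (line_a i) (line_c i) (line_b i) (line_d i))"
  define B' where "B' = (\<lambda>i. V i ** mk2 (1 / real p) 0 0 1)"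
  define C1 where "C1 = (\<lambda>q T. (1 / of_nat p) ^ k *
      (C ((1 / 1) *\<^sub>R (transpose (B (fst q)) ** T ** B (fst q))) *
        cexp (of_real (trace (T ** delta1_sym (fst q) (fst (snd q)) (snd (snd q)))))))"
  define C2 where "C2 = (\<lambda>q T. C ((1 / 1) *\<^sub>R (transpose (V (fst q)) ** T ** V (fst q))) *
        cexp (of_real (trace (T ** line_sym' (fst q) (of_int (snd q) / real p)))))"
  define C3 where "C3 = (\<lambda>i T. of_nat p ^ k * (C ((1 / 1) *\<^sub>R (transpose (B' i) ** T ** B' i)) * cexp (of_real (trace (T ** 0)))))"
  have S1: "transpose (delta1_sym i x y) = delta1_sym i x y" for i x y
    using transpose_delta1_S [of p "Inl (i, x, y)"] by simp
  have S2: "transpose (line_sym' i s) = line_sym' i s" for i s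
    by (simp add: line_sym'_def imk2_def mk2_simps)
  have L1: "lattice_series (2 * p ^ 2) (\<lambda>\<tau>. (1 / of_nat p) ^ k * F (affine_action 1 (mk2 (1 / real p) 0 0 1 ** line_mat (fst q)) (delta1_sym (fst q) (fst (snd q)) (snd (snd q))) \<tau>)) (C1 q)" for q
    unfolding C1_def B_def by (intro lattice_series_cmult lattice_series_act C one scaled_line_mat [OF p0] S1)
  have L2: "lattice_series (2 * p ^ 2) (\<lambda>\<tau>. F (affine_action 1 (line_mat' (fst q)) (line_sym' (fst q) (of_int (snd q) / real p)) \<tau>)) (C2 q)" for q
    unfolding C2_def V_def
    by (intro lattice_series_act C one S2 line_mat'_inv) (simp add: line_mat'_def imk2_scale)
  have L3: "lattice_series (2 * p ^ 2) (\<lambda>\<tau>. of_nat p ^ k * F (affine_action 1 (mk2 (real p) 0 0 1 ** line_mat' i) 0 \<tau>)) (C3 i)" for i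
    unfolding C3_def B'_def V_def by (intro lattice_series_cmult lattice_series_act C one scaled_line_mat' [OF p0]) simp
  let ?X = "lines p \<times> {0..<int p ^ 2} \<times> {0..<int p}" and ?Y = "lines p \<times> {1..<int p}"
  have L: "lattice_series (2 * p ^ 2) (hecke_T1_tilde k N \<chi>' p F) (\<lambda>T. of_nat p powi (int k - 3) *
     ((\<Sum>q\<in>?X. C1 q T) + \<chi>' (int p) * (\<Sum>q\<in>?Y. C2 q T) + \<chi>' (int p) ^ 2 * (\<Sum>i\<in>lines p. C3 i T)) +
      \<chi>' (int p) * of_nat p powi (int k - 3) * (of_nat p + 1) * C T)"
    (is "lattice_series _ _ ?R")
  proof (rule lattice_series_cong)
    show "lattice_series (2 * p ^ 2) (\<lambda>\<tau>. of_nat p powi (int k - 3) * (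
       (\<Sum>q\<in>?X. (1 / of_nat p) ^ k * F (affine_action 1 (mk2 (1 / real p) 0 0 1 ** line_mat (fst q)) (delta1_sym (fst q) (fst (snd q)) (snd (snd q))) \<tau>)) +
       \<chi>' (int p) * (\<Sum>q\<in>?Y. F (affine_action 1 (line_mat' (fst q)) (line_sym' (fst q) (of_int (snd q) / real p)) \<tau>)) +
       \<chi>' (int p) ^ 2 * (\<Sum>i\<in>lines p. of_nat p ^ k * F (affine_action 1 (mk2 (real p) 0 0 1 ** line_mat' i) 0 \<tau>))) +
       \<chi>' (int p) * of_nat p powi (int k - 3) * (of_nat p + 1) * F \<tau>) ?R"
      (is "lattice_series _ ?G _")
      by (intro lattice_series_cmult lattice_series_add lattice_series_sum L1 L2 L3 lattice_series_mono C)
    show "hecke_T1_tilde k N \<chi>' p F \<tau> = ?G \<tau>" if "\<tau> \<in> siegel2" for \<tau>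
      unfolding hecke_T1_tilde_def hecke_T1_def hecke_sum_delta1 [OF F \<chi> k N p pN that] by (simp add: case_prod_unfold)
  qed
  have SL2: "C (transpose (imk2 v1 v2 v3 v4) ** T ** imk2 v1 v2 v3 v4) = C T" if "v1 * v4 - v2 * v3 = 1" for v1 v2 v3 v4 T
    using coefficient_GL2 [OF F C that] dirichlet_character_one [OF \<chi>] by simp
  have "lam * C (mat (real n)) = ?R (mat (real n))"
  proof (rule lattice_series_unique [OF lattice_series_mono [OF lattice_series_cmult [OF C]] L])
    show "2 * p ^ 2 > 0" using p0 by simp
    show "lam * F \<tau> = hecke_T1_tilde k N \<chi>' p F \<tau>" if "\<tau> \<in> siegel2" for \<tau>
      using eig that by (simp add: has_eigenvalue_def)
  qed
  also have "(\<Sum>q\<in>?X. C1 q (mat (real n))) = of_nat p ^ 3 * (1 / of_nat p) ^ k * line_sum C p (real n)"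
  proof -
    have "C1 (i, x, y) (mat (real n)) = (1 / of_nat p) ^ k * C (real n *\<^sub>R line_form p i)" for i x y
    proof -
      have "trace (mat (real n) ** delta1_sym i x y) \<in> \<int>"
        by (simp add: delta1_sym_def Let_def imk2_def mat_mk2 mk2_simps)
      then have "cexp (of_real (trace (mat (real n) ** delta1_sym i x y))) = 1" by (rule cexp_Ints)
      moreover have "(1 / 1) *\<^sub>R (transpose (B i) ** mat (real n) ** B i) = real n *\<^sub>R line_form p i"
        by (simp add: B_def line_form_def imk2_def mat_mk2 mk2_simps power2_eq_square algebra_simps)
      ultimately show ?thesis by (simp add: C1_def)
    qed
    then have "(\<Sum>q\<in>?X. C1 q (mat (real n))) = (\<Sum>i\<in>lines p. \<Sum>s\<in>{0..<int p ^ 2} \<times> {0..<int p}. (1 / of_nat p) ^ k * C (real n *\<^sub>R line_form p i))"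
      unfolding sum.cartesian_product by (intro sum.cong) auto
    then show ?thesis
      by (simp add: line_sum_def sum_distrib_left card_cartesian_product nat_power_eq power3_eq_cube power2_eq_square mult_ac)
  qed
  also have "(\<Sum>q\<in>?Y. C2 q (mat (real n))) = of_nat p * (of_nat (card (isotropic_lines p n)) * C (mat (real n))) - (of_nat p + 1) * C (mat (real n))"
  proof -
    have "C2 (i, b) (mat (real n)) = C (mat (real n)) * cexp (of_real (of_int (int n * (line_a i ^ 2 + line_b i ^ 2)) * (of_int b / real p)))" for i b
    proof -
      have "trace (mat (real n) ** line_sym' i (of_int b / real p)) = of_int (int n * (line_a i ^ 2 + line_b i ^ 2)) * (of_int b / real p)"
        by (simp add: line_sym'_def imk2_def mat_mk2 mk2_simps power2_eq_square algebra_simps)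
      moreover have "C ((1 / 1) *\<^sub>R (transpose (V i) ** mat (real n) ** V i)) = C (mat (real n))"
        unfolding V_def by (simp, rule SL2) (use line_det [of i] in \<open>simp add: mult.commute\<close>)
      ultimately show ?thesis by (simp only: C2_def fst_conv snd_conv)
    qed
    then have "(\<Sum>q\<in>?Y. C2 q (mat (real n))) = (\<Sum>i\<in>lines p. \<Sum>b\<in>{1..<int p}. C (mat (real n)) * cexp (of_real (of_int (int n * (line_a i ^ 2 + line_b i ^ 2)) * (of_int b / real p))))"
      unfolding sum.cartesian_product by (intro sum.cong) auto
    also have "\<dots> = (\<Sum>i\<in>lines p. C (mat (real n)) * ((if int p dvd int n * (line_a i ^ 2 + line_b i ^ 2) then of_nat p else 0) - 1))"
      by (simp only: sum_ee_nonzero_residues [OF p] sum_distrib_left [symmetric])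
    also have "\<dots> = C (mat (real n)) * ((\<Sum>i\<in>lines p. if int p dvd int n * (line_a i ^ 2 + line_b i ^ 2) then of_nat p else 0) - (of_nat p + 1))"
      by (simp add: sum_distrib_left [symmetric] sum_subtractf cardl)
    also have "(\<Sum>i\<in>lines p. if int p dvd int n * (line_a i ^ 2 + line_b i ^ 2) then of_nat p else (0::complex)) = of_nat (card (isotropic_lines p n)) * of_nat p"
      unfolding isotropic_lines_def by (subst sum.inter_filter [OF fin, symmetric]) simp
    finally show ?thesis by (simp add: algebra_simps)
  qed
  also have "(\<Sum>i\<in>lines p. C3 i (mat (real n))) = of_nat p ^ k * line_sum C p (real n / real p ^ 2)"
  proof -
    have "C3 i (mat (real n)) = of_nat p ^ k * C ((real n / real p ^ 2) *\<^sub>R line_form p i)" for i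
    proof -
      \<comment> \<open>The form obtained from \<open>B' i\<close> is \<open>line_form p i\<close>
        divided by \<open>p ^ 2\<close>, up to a rotation by a right angle, which has determinant
        one.\<close>
      have "(1 / 1) *\<^sub>R (transpose (B' i) ** mat (real n) ** B' i) =
          transpose (imk2 0 1 (- 1) 0) ** ((real n / real p ^ 2) *\<^sub>R line_form p i) ** imk2 0 1 (- 1) 0"
        using p0 by (simp add: B'_def V_def line_form_def imk2_def mat_mk2 mk2_simps power2_eq_square field_simps)
      then have "C ((1 / 1) *\<^sub>R (transpose (B' i) ** mat (real n) ** B' i)) = C ((real n / real p ^ 2) *\<^sub>R line_form p i)"
        using SL2 [of 0 0 1 "-1"] by simp
      then show ?thesis by (simp add: C3_def trace_def cexp_def)
    qed
    then show ?thesis by (simp add: line_sum_def sum_distrib_left)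
  qed
  also have "of_nat p powi (int k - 3) * (of_nat p ^ 3 * (1 / of_nat p) ^ k * line_sum C p (real n) +
      \<chi>' (int p) * (of_nat p * (of_nat (card (isotropic_lines p n)) * C (mat (real n))) - (of_nat p + 1) * C (mat (real n))) +
      \<chi>' (int p) ^ 2 * (of_nat p ^ k * line_sum C p (real n / real p ^ 2))) +
      \<chi>' (int p) * of_nat p powi (int k - 3) * (of_nat p + 1) * C (mat (real n)) =
    of_nat p powi (int k - 3) * (of_nat p ^ 3 * (1 / of_nat p) ^ k * line_sum C p (real n) +
      \<chi>' (int p) * (of_nat p * (of_nat (card (isotropic_lines p n)) * C (mat (real n)))) +
      \<chi>' (int p) ^ 2 * (of_nat p ^ k * line_sum C p (real n / real p ^ 2)))"
    by (simp add: algebra_simps)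
  finally show ?thesis
    by (simp only: hecke_factors [OF powi_shift [OF p0, of k]])
qed

section \<open>Binary forms of discriminant minus four\<close>

definition roots_minus_one :: "nat \<Rightarrow> int set" where
  "roots_minus_one p = {u\<in>{0..<int p}. int p dvd 1 + u ^ 2}"

lemma QuadRes_minus_one_iff:
  assumes p: "prime p" "p > 2"
  shows "QuadRes (int p) (- 1) \<longleftrightarrow> p mod 4 = 1"
proof -
  have odd: "odd p" using p by (metis prime_odd_nat)
  have L: "[Legendre (- 1) (int p) = (- 1) ^ ((p - 1) div 2)] (mod int p)"
    using euler_criterion p by blast
  have n1: "\<not> [- 1 = 0] (mod int p)" using p by (simp add: cong_iff_dvd_diff)
  have n2: "\<not> [1 = - 1] (mod int p)" using p zdvd_imp_le [of "int p" 2] by (auto simp: cong_iff_dvd_diff)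
  have n3: "\<not> [- 1 = 1] (mod int p)" using n2 cong_sym by blast
  show ?thesis
  proof (cases "even ((p - 1) div 2)")
    case True
    have "p mod 4 = 1" using True odd by presburger
    moreover have "QuadRes (int p) (- 1)"
      using L True n1 n3 by (auto simp: Legendre_def split: if_splits)
    ultimately show ?thesis by simp
  next
    case False
    have "p mod 4 \<noteq> 1" using False by presburger
    moreover have "\<not> QuadRes (int p) (- 1)"
      using L False n1 n2 by (auto simp: Legendre_def split: if_splits)
    ultimately show ?thesis by simp
  qed
qed

lemma card_roots_minus_one:
  assumes p: "prime p" shows "of_nat (card (roots_minus_one p)) = alphaI p"
proof (cases "p = 2")
  case True
  have "u \<in> roots_minus_one 2 \<longleftrightarrow> u = 1" for u
  proof
    assume "u \<in> roots_minus_one 2"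
    then have "u \<in> {0..<2}" "2 dvd 1 + u ^ 2" by (auto simp: roots_minus_one_def)
    then show "u = 1" by (cases "u = 0") auto
  qed (simp add: roots_minus_one_def)
  then have "roots_minus_one 2 = {1}" by blast
  then show ?thesis using True by (simp add: alphaI_def)
next
  case False
  then have p2: "p > 2" using p prime_ge_2_nat [of p] by simp
  have pp: "prime (int p)" using p by simp
  have root: "[u ^ 2 = - 1] (mod int p) \<longleftrightarrow> int p dvd 1 + u ^ 2" for u
    by (simp add: cong_iff_dvd_diff add.commute)
  show ?thesis
  proof (cases "QuadRes (int p) (- 1)")
    case False
    then have "roots_minus_one p = {}"
      by (auto simp: roots_minus_one_def QuadRes_def root)
    moreover have "\<not> [p = 1] (mod 4)" using False QuadRes_minus_one_iff [OF p p2] by (simp add: cong_def)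
    ultimately show ?thesis using p2 by (simp add: alphaI_def)
  next
    case True
    then obtain v where v: "int p dvd 1 + v ^ 2" by (auto simp: QuadRes_def root)
    define w where "w = v mod int p"
    have w: "w \<in> {0..<int p}" using p2 by (simp add: w_def)
    have "[w ^ 2 = v ^ 2] (mod int p)" by (intro cong_pow) (simp add: w_def cong_def)
    then have wr: "int p dvd 1 + w ^ 2"
      using v root by (metis cong_trans)
    have w0: "w \<noteq> 0" using wr p2 by (auto simp: power2_eq_square)
    have "roots_minus_one p = {w, int p - w}"
    proof (intro subset_antisym subsetI)
      fix u assume u: "u \<in> roots_minus_one p"
      have "(u - w) * (u + w) = (1 + u ^ 2) - (1 + w ^ 2)" by (simp add: algebra_simps power2_eq_square)
      moreover have "int p dvd \<dots>" using u wr by (intro dvd_diff) (auto simp: roots_minus_one_def)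
      ultimately have "int p dvd u - w \<or> int p dvd u + w" using prime_dvd_mult_iff [OF pp] by metis
      then show "u \<in> {w, int p - w}"
      proof
        assume "int p dvd u - w"
        then have "u = w" by (rule residue_unique) (use u w in \<open>auto simp: roots_minus_one_def\<close>)
        then show ?thesis by simp
      next
        assume "int p dvd u + w"
        then have "int p dvd u - (int p - w)" by (metis add_diff_eq diff_diff_eq2 dvd_diff dvd_refl)
        then have "u = int p - w" by (rule residue_unique) (use u w w0 in \<open>auto simp: roots_minus_one_def\<close>)
        then show ?thesis by simp
      qed
    next
      fix u assume "u \<in> {w, int p - w}"
      moreover have "1 + (int p - w) ^ 2 = int p * (int p - 2 * w) + (1 + w ^ 2)"
        by (simp add: power2_eq_square algebra_simps)
      then have "int p dvd 1 + (int p - w) ^ 2" using wr by (metis dvd_add dvd_triv_left)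
      ultimately show "u \<in> roots_minus_one p"
        using w w0 wr by (auto simp: roots_minus_one_def)
    qed
    moreover have "w \<noteq> int p - w"
    proof
      assume "w = int p - w"
      then have "int p = 2 * w" by simp
      then have "even (int p)" by simp
      then show False using p p2 by (simp add: prime_odd_nat)
    qed
    moreover have "[p = 1] (mod 4)" using True QuadRes_minus_one_iff [OF p p2] by (simp add: cong_def)
    ultimately show ?thesis using p2 by (simp add: alphaI_def)
  qed
qed

lemma isotropic_lines_dvd: "p dvd n \<Longrightarrow> isotropic_lines p n = lines p"
  by (auto simp: isotropic_lines_def)

lemma isotropic_lines_not_dvd:
  assumes p: "prime p" and n: "\<not> p dvd n"
  shows "isotropic_lines p n = Some ` roots_minus_one p"
proof -
  have pp: "prime (int p)" using p by simp
  have dvd: "int p dvd int n * x \<longleftrightarrow> int p dvd x" for x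
    using prime_dvd_mult_iff [OF pp] n by auto
  have "\<not> int p dvd 1" using p by auto
  then show ?thesis
    unfolding isotropic_lines_def dvd
    by (auto simp: lines_def roots_minus_one_def line_a_def line_b_def)
qed

section \<open>Integral forms of determinant one\<close>

lemma gram_half_integral:
  "real n *\<^sub>R (transpose (imk2 v1 v2 v3 v4) ** imk2 v1 v2 v3 v4) \<in> half_integral_psd"
proof -
  have "(v::real^2) \<bullet> ((real n *\<^sub>R (transpose (imk2 v1 v2 v3 v4) ** imk2 v1 v2 v3 v4)) *v v)
     = real n * ((v1 * v$1 + v2 * v$2)^2 + (v3 * v$1 + v4 * v$2)^2)" for v
    by (simp add: imk2_def mk2_simps quadratic_form_2 power2_eq_square algebra_simps)
  then have "\<forall>v. v \<bullet> ((real n *\<^sub>R (transpose (imk2 v1 v2 v3 v4) ** imk2 v1 v2 v3 v4)) *v v) \<ge> 0"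
    by simp
  moreover have "real n *\<^sub>R (transpose (imk2 v1 v2 v3 v4) ** imk2 v1 v2 v3 v4) =
     imk2 (int n * (v1 * v1 + v3 * v3)) (int n * (v1 * v2 + v3 * v4)) (int n * (v1 * v2 + v3 * v4)) (int n * (v2 * v2 + v4 * v4))"
    by (simp add: imk2_simps mult.commute)
  ultimately show ?thesis
    unfolding half_integral_psd_def forall_2 by (simp add: imk2_transpose) (simp add: imk2_def)
qed

lemma scalar_half_integral: "mat (real n) \<in> half_integral_psd"
  using gram_half_integral [of n 1 0 0 1] by (simp add: imk2_def mk2_simps mat_mk2)

definition GL2_invariant :: "(real mat2 \<Rightarrow> complex) \<Rightarrow> bool" where
  "GL2_invariant C \<longleftrightarrow> (\<forall>v1 v2 v3 v4 T. (v1 * v4 - v2 * v3) ^ 2 = 1 \<longrightarrow>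
     C (transpose (imk2 v1 v2 v3 v4) ** T ** imk2 v1 v2 v3 v4) = C T)"

lemma GL2_invariantD:
  assumes "GL2_invariant C" "(v1 * v4 - v2 * v3) ^ 2 = 1"
    "T' = transpose (imk2 v1 v2 v3 v4) ** T ** imk2 v1 v2 v3 v4"
  shows "C T' = C T"
  using assms by (simp add: GL2_invariant_def)

lemma GL2_shear:
  assumes "GL2_invariant C"
  shows "C (\<nu> *\<^sub>R imk2 a (a * s + b) (a * s + b) (a * s ^ 2 + 2 * b * s + c)) = C (\<nu> *\<^sub>R imk2 a b b c)"
    "C (\<nu> *\<^sub>R imk2 (a + 2 * b * s + c * s ^ 2) (b + c * s) (b + c * s) c) = C (\<nu> *\<^sub>R imk2 a b b c)"
    "C (\<nu> *\<^sub>R imk2 a (- b) (- b) c) = C (\<nu> *\<^sub>R imk2 a b b c)"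
    "C (\<nu> *\<^sub>R imk2 c b b a) = C (\<nu> *\<^sub>R imk2 a b b c)"
  by (rule GL2_invariantD [OF assms, of 1 1 s 0] GL2_invariantD [OF assms, of 1 1 0 s]
      GL2_invariantD [OF assms, of 1 "-1" 0 0] GL2_invariantD [OF assms, of 0 0 1 1];
      simp add: imk2_def mk2_simps power2_eq_square algebra_simps)+

text \<open>Gauss reduction: \<open>a * c = 1 + b ^ 2\<close> is less than
  \<open>(\<bar>b\<bar> + 1) ^ 2\<close> unless \<open>b = 0\<close>, so \<open>a\<close> or
  \<open>c\<close> is at most \<open>\<bar>b\<bar>\<close> and one shear makes
  \<open>\<bar>b\<bar>\<close> smaller. At \<open>b = 0\<close> both diagonal entries are 1.\<close>

lemma reduced_binary_form:
  assumes C: "GL2_invariant C" and "a > 0" "a * c - b ^ 2 = 1"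
  shows "C (\<nu> *\<^sub>R imk2 a b b c) = C (\<nu> *\<^sub>R mat 1)"
  using assms(2,3)
proof (induction "nat \<bar>b\<bar>" arbitrary: a b c rule: less_induct)
  case less
  have ac: "a * c = 1 + b ^ 2" using less.prems by simp
  have c0: "c > 0"
    using less.prems ac by (smt (verit) mult_nonneg_nonpos zero_le_power2)
  show ?case
  proof (cases "b = 0")
    case True
    then have "a = 1" "c = 1" using ac less.prems pos_zmult_eq_1_iff [of a c] by auto
    then show ?thesis using True by (simp add: imk2_def mat_mk2)
  next
    case False
    have "a \<le> \<bar>b\<bar> \<or> c \<le> \<bar>b\<bar>"
    proof (rule ccontr)
      assume "\<not> (a \<le> \<bar>b\<bar> \<or> c \<le> \<bar>b\<bar>)"
      then have "(\<bar>b\<bar> + 1) * (\<bar>b\<bar> + 1) \<le> a * c" by (intro mult_mono) auto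
      then show False using ac False by (simp add: power2_eq_square algebra_simps)
    qed
    then show ?thesis
    proof
      assume a: "a \<le> \<bar>b\<bar>"
      let ?s = "- sgn b"
      have "\<bar>a * ?s + b\<bar> < \<bar>b\<bar>" using a less.prems False by (auto simp: sgn_if abs_if split: if_splits)
      moreover have "a * (a * ?s ^ 2 + 2 * b * ?s + c) - (a * ?s + b) ^ 2 = 1"
        using less.prems by (simp add: power2_eq_square algebra_simps)
      ultimately have "C (\<nu> *\<^sub>R imk2 a (a * ?s + b) (a * ?s + b) (a * ?s ^ 2 + 2 * b * ?s + c)) = C (\<nu> *\<^sub>R mat 1)"
        using less.prems by (intro less.hyps) auto
      then show ?thesis using GL2_shear(1) [OF C] by metis
    next
      assume c: "c \<le> \<bar>b\<bar>"
      let ?s = "- sgn b"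
      have "\<bar>b + c * ?s\<bar> < \<bar>b\<bar>" using c c0 False by (auto simp: sgn_if abs_if split: if_splits)
      moreover have d: "(a + 2 * b * ?s + c * ?s ^ 2) * c - (b + c * ?s) ^ 2 = 1"
        using less.prems by (simp add: power2_eq_square algebra_simps)
      moreover have "a + 2 * b * ?s + c * ?s ^ 2 > 0"
      proof -
        have "0 < (a + 2 * b * ?s + c * ?s ^ 2) * c" using d by (smt (verit) zero_le_power2)
        then show ?thesis using c0 by (simp add: zero_less_mult_iff)
      qed
      ultimately have "C (\<nu> *\<^sub>R imk2 (a + 2 * b * ?s + c * ?s ^ 2) (b + c * ?s) (b + c * ?s) c) = C (\<nu> *\<^sub>R mat 1)"
        by (intro less.hyps) auto
      then show ?thesis using GL2_shear(2) [OF C] by metis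
    qed
  qed
qed

section \<open>Sums over the sublattices of index \<open>p\<close>\<close>

lemma line_form_simps:
  "line_form p None = imk2 (int p ^ 2) 0 0 1"
  "line_form p (Some u) = imk2 (int p ^ 2) (- (int p * u)) (- (int p * u)) (1 + u ^ 2)"
  by (simp_all add: line_form_def line_a_def line_b_def line_c_def line_d_def)

lemma line_sum_expand:
  "line_sum C p \<nu> = C (\<nu> *\<^sub>R imk2 (int p ^ 2) 0 0 1) +
     (\<Sum>u\<in>{0..<int p}. C (\<nu> *\<^sub>R imk2 (int p ^ 2) (- (int p * u)) (- (int p * u)) (1 + u ^ 2)))"
  unfolding line_sum_def lines_def
  by (subst sum.insert) (auto simp: sum.reindex line_form_simps)

text \<open>The form of a line times \<open>l / p\<close> can be half-integral only if
  \<open>p\<close> divides the lower right entry, which is 1 for \<open>None\<close> and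
  \<open>1 + u ^ 2\<close> for \<open>Some u\<close>. If \<open>1 + u ^ 2 = p z\<close>, it is
  \<open>l\<close> times \<open>(p, - u; - u, z)\<close>, of determinant one and hence equivalent to
  the identity. So the roots of -1 modulo \<open>p\<close> are counted.\<close>

lemma line_sum_div_p:
  assumes C: "GL2_invariant C" and supp: "\<And>T. C T \<noteq> 0 \<Longrightarrow> T \<in> half_integral_psd"
    and p: "prime p" and l: "\<not> p dvd l"
  shows "line_sum C p (real l / real p) = alphaI p * C (mat (real l))"
proof -
  have p0: "p > 0" using p prime_gt_0_nat by blast
  have pp: "prime (int p)" using p by simp
  have ndvd: "int p dvd int l * x \<longleftrightarrow> int p dvd x" for x
    using prime_dvd_mult_iff [OF pp] l by auto
  have zero: "C ((real l / real p) *\<^sub>R imk2 a b b x) = 0" if "\<not> int p dvd x" for a b x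
  proof (rule ccontr)
    assume "C ((real l / real p) *\<^sub>R imk2 a b b x) \<noteq> 0"
    then have "(real l / real p) * of_int x \<in> \<int>"
      using supp by (fastforce simp: half_integral_psd_def forall_2 imk2_def mk2_simps)
    then have "of_int (int l * x) / real p \<in> \<int>" by simp
    then show False using of_int_div_Ints [OF p0] that ndvd by blast
  qed
  have one: "C ((real l / real p) *\<^sub>R imk2 (int p ^ 2) (- (int p * u)) (- (int p * u)) (1 + u ^ 2)) = C (mat (real l))"
    if u: "int p dvd 1 + u ^ 2" for u
  proof -
    obtain z where z: "1 + u ^ 2 = int p * z" using u by (elim dvdE)
    have "(real l / real p) *\<^sub>R imk2 (int p ^ 2) (- (int p * u)) (- (int p * u)) (1 + u ^ 2) = real l *\<^sub>R imk2 (int p) (- u) (- u) z"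
      unfolding z using p0 by (simp add: imk2_def mk2_simps power2_eq_square)
    also have "C \<dots> = C (real l *\<^sub>R mat 1)"
      using p0 z by (intro reduced_binary_form [OF C]) (auto simp: power2_eq_square)
    also have "real l *\<^sub>R mat 1 = (mat (real l) :: real mat2)" by (simp add: mat_mk2 mk2_simps)
    finally show ?thesis .
  qed
  have "line_sum C p (real l / real p) = (\<Sum>u\<in>{0..<int p}. if int p dvd 1 + u ^ 2 then C (mat (real l)) else 0)"
  proof -
    have "C ((real l / real p) *\<^sub>R imk2 (int p ^ 2) 0 0 1) = 0"
      by (rule zero) (use p in auto)
    moreover have "C ((real l / real p) *\<^sub>R imk2 (int p ^ 2) (- (int p * u)) (- (int p * u)) (1 + u ^ 2)) =
        (if int p dvd 1 + u ^ 2 then C (mat (real l)) else 0)" for u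
      using zero one by auto
    ultimately show ?thesis unfolding line_sum_expand by (simp only: add_0)
  qed
  also have "\<dots> = of_nat (card (roots_minus_one p)) * C (mat (real l))"
    unfolding roots_minus_one_def by (subst sum.inter_filter [symmetric]) auto
  finally show ?thesis by (simp add: card_roots_minus_one [OF p])
qed

text \<open>For \<open>Some u\<close> a nonzero coefficient would need \<open>p ^ 2\<close> to
  divide \<open>1 + u ^ 2\<close> and \<open>2 p u\<close>, the latter doubled because off-diagonal
  entries are only half-integral. For odd \<open>p\<close> this makes \<open>p\<close> divide
  \<open>u\<close>, against the first condition; for \<open>p = 2\<close> no square is -1 modulo
  4.\<close>

lemma line_sum_div_p2:
  assumes supp: "\<And>T. C T \<noteq> 0 \<Longrightarrow> T \<in> half_integral_psd"
    and p: "prime p" and l: "\<not> p dvd l"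
  shows "line_sum C p (real l / real p ^ 2) = 0"
proof -
  have p0: "p > 0" using p prime_gt_0_nat by blast
  have pp: "prime (int p)" using p by simp
  have cop: "coprime (int l) (int p)" using p l by (metis coprime_commute coprime_int_iff prime_imp_coprime)
  have ints: "int p ^ 2 dvd x \<and> int p ^ 2 dvd 2 * b" if "C ((real l / real p ^ 2) *\<^sub>R imk2 a b b x) \<noteq> 0" for a b x
  proof -
    have h: "(real l / real p ^ 2) *\<^sub>R imk2 a b b x \<in> half_integral_psd" using supp that by blast
    have "(real l / real p ^ 2) * of_int x \<in> \<int>" "2 * ((real l / real p ^ 2) * of_int b) \<in> \<int>"
      using h by (simp_all add: half_integral_psd_def forall_2 imk2_def mk2_simps)
    then have "of_int (int l * x) / real (p ^ 2) \<in> \<int>" "of_int (int l * (2 * b)) / real (p ^ 2) \<in> \<int>"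
      by (simp_all add: mult_ac)
    then have "int (p ^ 2) dvd int l * x" "int (p ^ 2) dvd int l * (2 * b)"
      using of_int_div_Ints [of "p ^ 2"] p0 by (metis zero_less_power)+
    then show ?thesis
      using cop by (simp add: coprime_dvd_mult_right_iff coprime_commute)
  qed
  have n1: "\<not> int p dvd 1" using p by auto
  have "C ((real l / real p ^ 2) *\<^sub>R imk2 (int p ^ 2) 0 0 1) = 0"
    using ints [of "int p ^ 2" 0 1] n1 by (metis dvd_mult_left power2_eq_square)
  moreover have "C ((real l / real p ^ 2) *\<^sub>R imk2 (int p ^ 2) (- (int p * u)) (- (int p * u)) (1 + u ^ 2)) = 0" if "u \<in> {0..<int p}" for u
  proof (rule ccontr)
    assume "C ((real l / real p ^ 2) *\<^sub>R imk2 (int p ^ 2) (- (int p * u)) (- (int p * u)) (1 + u ^ 2)) \<noteq> 0"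
    then have 1: "int p ^ 2 dvd 1 + u ^ 2" and 2: "int p ^ 2 dvd 2 * (- (int p * u))" using ints by blast+
    have "2 * (- (int p * u)) = int p * (- 2 * u)" by simp
    then have "int p dvd - 2 * u" using 2 p0 by (metis dvd_mult_cancel_left of_nat_0_less_iff less_irrefl power2_eq_square)
    then have "int p dvd 2 \<or> int p dvd u" using prime_dvd_mult_iff [OF pp, of 2 u] by simp
    moreover have "\<not> int p dvd u"
    proof
      assume "int p dvd u"
      moreover have "int p dvd 1 + u ^ 2" using 1 by (metis dvd_mult_left power2_eq_square)
      ultimately have "int p dvd (1 + u ^ 2) - u * u" by (intro dvd_diff dvd_mult) auto
      then show False using n1 by (simp add: power2_eq_square)
    qed
    moreover have "\<not> int p dvd 2"
    proof
      assume "int p dvd 2"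
      then have "p = 2" using p by (metis int_dvd_int_iff of_nat_numeral primes_dvd_imp_eq two_is_prime_nat)
      then have "u = 0 \<or> u = 1" using that by auto
      then show False using 1 \<open>p = 2\<close> by auto
    qed
    ultimately show False by blast
  qed
  ultimately show ?thesis unfolding line_sum_expand by simp
qed

text \<open>The lines fall into three groups. The roots of -1 give forms with a factor
  \<open>p\<close>, equivalent to \<open>p n\<close> times the identity. \<open>None\<close> and
  \<open>u = 0\<close> give the same diagonal form up to exchange of variables. Every other
  \<open>u\<close> pairs with \<open>p - u\<close>, and the member below \<open>p / 2\<close>
  represents the pair.\<close>

lemma line_sum_at_multiple:
  assumes C: "GL2_invariant C" and p: "prime p"
  shows "line_sum C p (real n) = alphaI p * C (mat (real (p * n))) +
    2 * C (mk2 (real n) 0 0 (real (p ^ 2 * n))) +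
    2 * (\<Sum>u | 1 \<le> u \<and> real u < real p / 2 \<and> \<not> [(int u)^2 = -1] (mod int p).
       C (real n *\<^sub>R imk2 (1 + (int u)^2) (int p * int u) (int p * int u) (int p ^ 2)))"
proof -
  have p0: "p > 0" using p prime_gt_0_nat by blast
  define g where "g = (\<lambda>u. C (real n *\<^sub>R imk2 (1 + u ^ 2) (int p * u) (int p * u) (int p ^ 2)))"
  have lf: "C (real n *\<^sub>R imk2 (int p ^ 2) (- (int p * u)) (- (int p * u)) (1 + u ^ 2)) = g u" for u
    unfolding g_def by (metis GL2_shear(3,4) [OF C])
  have diag: "C (real n *\<^sub>R imk2 (int p ^ 2) 0 0 1) = C (mk2 (real n) 0 0 (real (p ^ 2 * n)))"
  proof -
    have "real n *\<^sub>R imk2 1 0 0 (int p ^ 2) = mk2 (real n) 0 0 (real (p ^ 2 * n))"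
      by (simp add: imk2_def mk2_simps)
    then show ?thesis by (metis GL2_shear(4) [OF C])
  qed
  have g0: "g 0 = C (mk2 (real n) 0 0 (real (p ^ 2 * n)))"
    by (simp add: g_def imk2_def mk2_simps mult.commute)
  have neg: "g (int p - u) = g u" for u
  proof -
    have "g (int p - u) = g (- u)"
      unfolding g_def
      using GL2_shear(2) [OF C, of "real n" "1 + u ^ 2" "- (int p * u)" 1 "int p ^ 2"]
      by (simp add: power2_eq_square algebra_simps)
    also have "\<dots> = g u" unfolding g_def using GL2_shear(3) [OF C] by simp
    finally show ?thesis .
  qed
  have groot: "g u = C (mat (real (p * n)))" if u: "int p dvd 1 + u ^ 2" for u
  proof -
    obtain z where z: "1 + u ^ 2 = int p * z" using u by (elim dvdE)
    have z0: "z > 0"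
    proof -
      have "0 < int p * z" unfolding z [symmetric] by (simp add: add_pos_nonneg)
      then show ?thesis using p0 by (simp add: zero_less_mult_iff)
    qed
    have "real n *\<^sub>R imk2 (1 + u ^ 2) (int p * u) (int p * u) (int p ^ 2) = real (p * n) *\<^sub>R imk2 z u u (int p)"
      unfolding z by (simp add: imk2_def mk2_simps power2_eq_square)
    also have "C \<dots> = C (real (p * n) *\<^sub>R mat 1)"
      using z z0 by (intro reduced_binary_form [OF C]) (auto simp: algebra_simps)
    also have "real (p * n) *\<^sub>R mat 1 = (mat (real (p * n)) :: real mat2)" by (simp add: mat_mk2 mk2_simps)
    finally show ?thesis by (simp add: g_def)
  qed
  define A where "A = {u. 1 \<le> u \<and> real u < real p / 2 \<and> \<not> [(int u)^2 = -1] (mod int p)}"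
  have root: "[u ^ 2 = - 1] (mod int p) \<longleftrightarrow> int p dvd 1 + u ^ 2" for u
    by (simp add: cong_iff_dvd_diff add.commute)
  have finA: "finite A" by (rule finite_subset [of _ "{..p}"]) (auto simp: A_def)
  have root_neg: "int p dvd 1 + (int p - u) ^ 2 \<longleftrightarrow> int p dvd 1 + u ^ 2" for u
  proof -
    have "1 + (int p - u) ^ 2 = int p * (int p - 2 * u) + (1 + u ^ 2)" by (simp add: power2_eq_square algebra_simps)
    then show ?thesis by (simp only: dvd_add_right_iff dvd_triv_left)
  qed
  have split: "{1..<int p} - roots_minus_one p = int ` A \<union> (\<lambda>u. int p - int u) ` A"
  proof (intro subset_antisym subsetI)
    fix u assume u: "u \<in> {1..<int p} - roots_minus_one p"
    then have nr: "\<not> int p dvd 1 + u ^ 2" by (auto simp: roots_minus_one_def)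
    consider "2 * u < int p" | "2 * u = int p" | "2 * u > int p" by linarith
    then show "u \<in> int ` A \<union> (\<lambda>u. int p - int u) ` A"
    proof cases
      case 1
      then have "nat u \<in> A" using u nr by (auto simp: A_def root)
      then show ?thesis using u by (intro UnI1 image_eqI [of _ _ "nat u"]) auto
    next
      case 2
      then have "2 dvd p" by presburger
      then have "p = 2" using p by (metis primes_dvd_imp_eq two_is_prime_nat)
      then show ?thesis using 2 nr by auto
    next
      case 3
      then have "nat (int p - u) \<in> A" using u nr root_neg [of u] by (auto simp: A_def root)
      then show ?thesis using u by (intro UnI2 image_eqI [of _ _ "nat (int p - u)"]) auto
    qed
  next
    fix u assume "u \<in> int ` A \<union> (\<lambda>u. int p - int u) ` A"
    then obtain v where v: "v \<in> A" "u = int v \<or> u = int p - int v" by auto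
    have "\<not> int p dvd 1 + int v ^ 2" "1 \<le> v" "2 * v < p" using v(1) by (auto simp: A_def root)
    then show "u \<in> {1..<int p} - roots_minus_one p"
      using v(2) root_neg [of "int v"] by (auto simp: roots_minus_one_def)
  qed
  have "(\<Sum>u\<in>{1..<int p} - roots_minus_one p. g u) = (\<Sum>u\<in>int ` A. g u) + (\<Sum>u\<in>(\<lambda>u. int p - int u) ` A. g u)"
    unfolding split
  proof (rule sum.union_disjoint)
    show "int ` A \<inter> (\<lambda>u. int p - int u) ` A = {}"
      by (auto simp: A_def)
  qed (use finA in auto)
  also have "(\<Sum>u\<in>int ` A. g u) = (\<Sum>u\<in>A. g (int u))" by (simp add: sum.reindex)
  also have "(\<Sum>u\<in>(\<lambda>u. int p - int u) ` A. g u) = (\<Sum>u\<in>A. g (int u))"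
    by (subst sum.reindex) (auto simp: inj_on_def neg)
  finally have nonroots: "(\<Sum>u\<in>{1..<int p} - roots_minus_one p. g u) = 2 * (\<Sum>u\<in>A. g (int u))" by simp
  have sub: "roots_minus_one p \<subseteq> {1..<int p}"
  proof
    fix u assume u: "u \<in> roots_minus_one p"
    then have "u \<noteq> 0" using p by (auto simp: roots_minus_one_def)
    then show "u \<in> {1..<int p}" using u by (auto simp: roots_minus_one_def)
  qed
  have "(\<Sum>u\<in>{1..<int p}. g u) = (\<Sum>u\<in>{1..<int p} - roots_minus_one p. g u) + (\<Sum>u\<in>roots_minus_one p. g u)"
    by (rule sum.subset_diff [OF sub]) simp
  also have "(\<Sum>u\<in>roots_minus_one p. g u) = alphaI p * C (mat (real (p * n)))"
    using groot by (simp add: roots_minus_one_def flip: card_roots_minus_one [OF p, unfolded roots_minus_one_def])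
  finally have "(\<Sum>u\<in>{1..<int p}. g u) = 2 * (\<Sum>u\<in>A. g (int u)) + alphaI p * C (mat (real (p * n)))"
    by (simp add: nonroots)
  moreover have "{0..<int p} = insert 0 {1..<int p}" using p0 by auto
  ultimately have "(\<Sum>u\<in>{0..<int p}. g u) = C (mk2 (real n) 0 0 (real (p ^ 2 * n))) + (2 * (\<Sum>u\<in>A. g (int u)) + alphaI p * C (mat (real (p * n))))"
    by (simp add: g0)
  then show ?thesis
    unfolding line_sum_expand lf diag A_def [symmetric] by (simp add: g_def)
qed

section \<open>Multiplicativity\<close>

text \<open>For \<open>l\<close> prime to \<open>p\<close> the index \<open>l / p\<close> is not
  integral, so the last term vanishes and the line sum is the one of
  \<open>line_sum_div_p\<close>.\<close>

lemma hecke_T_relation_unit: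
  assumes C: "GL2_invariant C" and supp: "\<And>T. C T \<noteq> 0 \<Longrightarrow> T \<in> half_integral_psd"
    and p: "prime p" and l: "\<not> p dvd l"
    and rel: "\<And>n. lam * C (mat (real n)) = C (mat (real (p * n))) + x * line_sum C p (real n / real p) +
      of_nat p * x ^ 2 * C (mat (real n / real p))"
  shows "lam * C (mat (real l)) = C (mat (real (p * l))) + x * (alphaI p * C (mat (real l)))"
proof -
  have "C (mat (real l / real p)) = 0"
  proof (rule ccontr)
    assume "C (mat (real l / real p)) \<noteq> 0"
    then have "mat (real l / real p) \<in> half_integral_psd" by (rule supp)
    then have "real_of_int (int l) / real p \<in> \<int>"
      by (simp add: half_integral_psd_def forall_2 mat_def)
    then show False using l p prime_gt_0_nat of_int_div_Ints [of p "int l"] by simp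
  qed
  then show ?thesis
    using rel [of l] line_sum_div_p [OF C supp p l] by simp
qed

lemma hecke_T_relation_multiple:
  assumes p: "prime p"
    and rel: "\<And>n. lam * C (mat (real n)) = C (mat (real (p * n))) + x * line_sum C p (real n / real p) +
      of_nat p * x ^ 2 * C (mat (real n / real p))"
  shows "lam * C (mat (real (p * n))) = C (mat (real (p * (p * n)))) + x * line_sum C p (real n) + of_nat p * x ^ 2 * C (mat (real n))"
  using rel [of "p * n"] p by (simp add: prime_gt_0_nat)

text \<open>The relations of \<open>T(p)\<close> and of the modified \<open>T\<^sub>1(p\<^sup>2)\<close> form a linear recursion for the pairs of
  the coefficient and the line sum at \<open>p\<^sup>e l\<close>. Its initial values are multiples of the coefficient at \<open>l\<close>.\<close>

lemma coefficient_prime_power: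
  assumes C: "GL2_invariant C" and supp: "\<And>T. C T \<noteq> 0 \<Longrightarrow> T \<in> half_integral_psd"
    and p: "prime p"
    and rel: "\<And>n. lam * C (mat (real n)) = C (mat (real (p * n))) + x * line_sum C p (real n / real p) +
      of_nat p * x ^ 2 * C (mat (real n / real p))"
    and rel1: "\<And>n. x \<noteq> 0 \<Longrightarrow> lam1 * C (mat (real n)) = line_sum C p (real n) +
      x * (of_nat (card (isotropic_lines p n)) * C (mat (real n))) + of_nat p * x ^ 2 * line_sum C p (real n / real p ^ 2)"
  shows "\<exists>c. \<forall>l. \<not> p dvd l \<longrightarrow> C (mat (real (p ^ e * l))) = c * C (mat (real l))"
proof -
  have p0: "p > 0" using p prime_gt_0_nat by blast
  have unit: "lam * C (mat (real l)) = C (mat (real (p * l))) + x * (alphaI p * C (mat (real l)))" if "\<not> p dvd l" for l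
    by (rule hecke_T_relation_unit [OF C supp p that rel])
  note mult = hecke_T_relation_multiple [OF p rel]
  show ?thesis
  proof (cases "x = 0")
    case True
    \<comment> \<open>For \<open>x = 0\<close>, as happens when \<open>p\<close> divides the level,
      \<open>T(p)\<close> alone gives a geometric progression.\<close>
    have step: "C (mat (real (p * n))) = lam * C (mat (real n))" for n
      using rel [of n] True by simp
    have "C (mat (real (p ^ e * l))) = lam ^ e * C (mat (real l))" for l
    proof (induction e)
      case (Suc e)
      then show ?case using step [of "p ^ e * l"] by (simp add: mult.assoc)
    qed simp
    then show ?thesis by blast
  next
    case False
    note rel1 = rel1 [OF False]
    have card_lines: "card (lines p) = p + 1" by (simp add: lines_def card_image)
    have card_roots: "of_nat (card (isotropic_lines p l)) = alphaI p" if "\<not> p dvd l" for l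
      using that by (simp add: isotropic_lines_not_dvd [OF p] card_image flip: card_roots_minus_one [OF p])
    have unit1: "line_sum C p (real l) = (lam1 - x * alphaI p) * C (mat (real l))" if "\<not> p dvd l" for l
      using rel1 [of l] line_sum_div_p2 [OF supp p that] card_roots [OF that] by (simp add: algebra_simps)
    \<comment> \<open>Once \<open>p\<close> divides the index every line is isotropic, so the count
      \<open>alphaI p\<close> is replaced by \<open>p + 1\<close>.\<close>
    have mult1: "line_sum C p (real (p * l)) = (lam1 - x * (of_nat p + 1)) * C (mat (real (p * l))) - of_nat p * x ^ 2 * (alphaI p * C (mat (real l)))"
      if "\<not> p dvd l" for l
    proof -
      have "real (p * l) / real p ^ 2 = real l / real p" using p0 by (simp add: power2_eq_square)
      then show ?thesis
        using rel1 [of "p * l"] line_sum_div_p [OF C supp p that]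
        by (simp add: isotropic_lines_dvd card_lines algebra_simps)
    qed
    have mult2: "line_sum C p (real (p * (p * n))) = (lam1 - x * (of_nat p + 1)) * C (mat (real (p * (p * n)))) - of_nat p * x ^ 2 * line_sum C p (real n)" for n
    proof -
      have "real (p * (p * n)) / real p ^ 2 = real n" using p0 by (simp add: power2_eq_square)
      then show ?thesis
        using rel1 [of "p * (p * n)"] by (simp add: isotropic_lines_dvd card_lines algebra_simps)
    qed
    \<comment> \<open>The state holds the coefficient and the line sum at two consecutive powers,
      because the recursion reaches back two steps. The four factors are fixed before
      \<open>l\<close>, which is the point of the statement.\<close>
    have "\<exists>b0 w0 b1 w1. \<forall>l. \<not> p dvd l \<longrightarrow>
        C (mat (real (p ^ e * l))) = b0 * C (mat (real l)) \<and> line_sum C p (real (p ^ e * l)) = w0 * C (mat (real l)) \<and>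
        C (mat (real (p * (p ^ e * l)))) = b1 * C (mat (real l)) \<and> line_sum C p (real (p * (p ^ e * l))) = w1 * C (mat (real l))"
    proof (induction e)
      case 0
      have b1: "C (mat (real (p * l))) = (lam - x * alphaI p) * C (mat (real l))" if "\<not> p dvd l" for l
        using unit [OF that] by (simp add: algebra_simps)
      have "line_sum C p (real (p * l)) = ((lam1 - x * (of_nat p + 1)) * (lam - x * alphaI p) - of_nat p * x ^ 2 * alphaI p) * C (mat (real l))"
        if "\<not> p dvd l" for l
        unfolding mult1 [OF that] b1 [OF that] by (simp add: algebra_simps)
      then show ?case
        using unit1 b1
        by (intro exI [of _ 1] exI [of _ "lam1 - x * alphaI p"] exI [of _ "lam - x * alphaI p"]
            exI [of _ "(lam1 - x * (of_nat p + 1)) * (lam - x * alphaI p) - of_nat p * x ^ 2 * alphaI p"]) simp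
    next
      case (Suc e)
      then obtain b0 w0 b1 w1 where IH: "\<And>l. \<not> p dvd l \<Longrightarrow>
        C (mat (real (p ^ e * l))) = b0 * C (mat (real l)) \<and> line_sum C p (real (p ^ e * l)) = w0 * C (mat (real l)) \<and>
        C (mat (real (p * (p ^ e * l)))) = b1 * C (mat (real l)) \<and> line_sum C p (real (p * (p ^ e * l))) = w1 * C (mat (real l))"
        by blast
      have b2: "C (mat (real (p * (p * (p ^ e * l))))) = (lam * b1 - x * w0 - of_nat p * x ^ 2 * b0) * C (mat (real l))" if "\<not> p dvd l" for l
      proof -
        have "C (mat (real (p * (p * (p ^ e * l))))) = lam * C (mat (real (p * (p ^ e * l)))) - x * line_sum C p (real (p ^ e * l))
            - of_nat p * x ^ 2 * C (mat (real (p ^ e * l)))"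
          using mult [of "p ^ e * l"] by (simp add: algebra_simps)
        also have "\<dots> = lam * (b1 * C (mat (real l))) - x * (w0 * C (mat (real l))) - of_nat p * x ^ 2 * (b0 * C (mat (real l)))"
          using IH [OF that] by (simp only:)
        finally show ?thesis by (simp only: left_diff_distrib mult.assoc)
      qed
      have w2: "line_sum C p (real (p * (p * (p ^ e * l)))) =
          ((lam1 - x * (of_nat p + 1)) * (lam * b1 - x * w0 - of_nat p * x ^ 2 * b0) - of_nat p * x ^ 2 * w0) * C (mat (real l))"
        if "\<not> p dvd l" for l
      proof -
        have "line_sum C p (real (p ^ e * l)) = w0 * C (mat (real l))" using IH [OF that] by blast
        then show ?thesis unfolding mult2 b2 [OF that] by (simp only: left_diff_distrib mult.assoc)
      qed
      have e: "p ^ Suc e * l = p * (p ^ e * l)" for l by simp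
      show ?case
        unfolding e
      proof (intro exI allI impI conjI)
        fix l assume l: "\<not> p dvd l"
        show "C (mat (real (p * (p ^ e * l)))) = b1 * C (mat (real l))" using IH [OF l] by blast
        show "line_sum C p (real (p * (p ^ e * l))) = w1 * C (mat (real l))" using IH [OF l] by blast
        show "C (mat (real (p * (p * (p ^ e * l))))) = (lam * b1 - x * w0 - of_nat p * x ^ 2 * b0) * C (mat (real l))"
          by (rule b2 [OF l])
        show "line_sum C p (real (p * (p * (p ^ e * l)))) =
          ((lam1 - x * (of_nat p + 1)) * (lam * b1 - x * w0 - of_nat p * x ^ 2 * b0) - of_nat p * x ^ 2 * w0) * C (mat (real l))"
          by (rule w2 [OF l])
      qed
    qed
    then show ?thesis by blast
  qed
qed

text \<open>The factor \<open>c\<close> must not depend on \<open>m\<close>. Splitting off one full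
  prime power at a time preserves this, since the remaining argument \<open>m * n'\<close> is again
  prime to \<open>p\<close>.\<close>

lemma coefficient_coprime:
  fixes f :: "nat \<Rightarrow> complex"
  assumes pp: "\<And>p e. prime p \<Longrightarrow> p dvd n \<Longrightarrow> \<exists>c. \<forall>l. \<not> p dvd l \<longrightarrow> f (p ^ e * l) = c * f l" and "n > 0"
  shows "\<exists>c. \<forall>m. coprime m n \<longrightarrow> f (m * n) = c * f m"
  using assms
proof (induction n rule: less_induct)
  case (less n)
  show ?case
  proof (cases "n = 1")
    case True
    then show ?thesis by (intro exI [of _ 1]) simp
  next
    case False
    then obtain p where p: "prime p" "p dvd n" by (metis prime_factor_nat)
    obtain e n' where e: "\<not> p dvd n'" "n = n' * p ^ e"
      using prime_power_canonical [OF p(1), of n] less.prems by blast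
    have "e \<noteq> 0" using e p by (cases e) auto
    then have "p ^ e > 1" using one_less_power [OF prime_gt_1_nat [OF p(1)]] by simp
    moreover have n': "n' > 0" using less.prems e by auto
    ultimately have "n' < n" using e by simp
    then obtain c where c: "\<And>m. coprime m n' \<Longrightarrow> f (m * n') = c * f m"
      using less.IH [of n'] less.prems n' e by (metis dvd_mult2)
    obtain d where d: "\<And>l. \<not> p dvd l \<Longrightarrow> f (p ^ e * l) = d * f l"
      using less.prems(1) [OF p] by blast
    have "f (m * n) = (d * c) * f m" if m: "coprime m n" for m
    proof -
      have "coprime m n'" using m e by simp
      then have "f (m * n') = c * f m" by (rule c)
      moreover have "\<not> p dvd m" using m p coprime_common_divisor [of m n p] by auto
      then have "\<not> p dvd m * n'" using e p by (simp add: prime_dvd_mult_iff)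
      then have "f (p ^ e * (m * n')) = d * f (m * n')" by (rule d)
      moreover have "m * n = p ^ e * (m * n')" by (simp add: e(2))
      ultimately show ?thesis by (simp only: mult.assoc)
    qed
    then show ?thesis by blast
  qed
qed

theorem theorem1p1:
  fixes k N :: nat and \<chi>' :: "int \<Rightarrow> complex"
    and F :: "complex mat2 \<Rightarrow> complex" and a :: "real mat2 \<Rightarrow> complex"
  assumes "k > 0" and "N > 0"
    and "dirichlet_character N \<chi>'"
    and "siegel_modular_form k N \<chi>' F"
    and "fourier_expansion F a"
  shows
    "(\<forall>p lam lam1. prime p \<longrightarrow>
        has_eigenvalue (hecke_T k N \<chi>' p) F lam \<longrightarrow>
        has_eigenvalue (hecke_T1_tilde k N \<chi>' p) F lam1 \<longrightarrow>
        (\<forall>m. 0 < m \<longrightarrow> \<not> p dvd m \<longrightarrow>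
          lam * a (scalarI m) =
            \<chi>' (int p) * of_nat p powi (int k - 2) * eta k \<chi>' p * a (scalarI m)
              + a (scalarI (m * p)) \<and>
          \<chi>' (int p) * of_nat p powi (int k - 2) * lam1 * a (scalarI m) =
            \<chi>' (int (p^2)) * of_nat p powi (2 * int k - 4) * (alphaI p - of_nat p) * a (scalarI m)
              + lam * a (scalarI (p * m)) - a (scalarI (p^2 * m))) \<and>
        (\<forall>m l r. 0 < m \<longrightarrow> \<not> p dvd m \<longrightarrow> 0 < l \<longrightarrow> \<not> p dvd l \<longrightarrow> 1 \<le> r \<longrightarrow>
          a (scalarI m) * a (scalarI (p^(r+1) * l)) =
            a (scalarI (p * m)) * a (scalarI (p^r * l))
            - \<chi>' (int (p^2)) * of_nat p powi (2 * int k - 3)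
                * a (scalarI m) * a (scalarI (p^(r-1) * l))
            - eps k \<chi>' * \<chi>' (int p) * of_nat p powi (int k - 2) * a (scalarI m)
                * a (mk2 (real (p^(r-1) * l)) 0 0 (real (p^(r+1) * l)))
            - eps k \<chi>' * \<chi>' (int p) * of_nat p powi (int k - 2) * a (scalarI m)
                * (\<Sum>u | 1 \<le> u \<and> real u < real p / 2 \<and> \<not> [(int u)^2 = -1] (mod int p).
                     a (real (p^r * l) *\<^sub>R
                        mk2 ((1 + (real u)^2) / real p) (real u) (real u) (real p)))))
     \<and>
     (\<forall>n m. 0 < n \<longrightarrow>
        (\<forall>p. prime p \<longrightarrow> p dvd n \<longrightarrow>
           (\<exists>lam. has_eigenvalue (hecke_T k N \<chi>' p) F lam) \<and>
           (\<exists>lam1. has_eigenvalue (hecke_T1_tilde k N \<chi>' p) F lam1)) \<longrightarrow>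
        0 < m \<longrightarrow> coprime m n \<longrightarrow>
        (a (scalarI m) = 0 \<longrightarrow> a (scalarI (m * n)) = 0) \<and>
        a (scalarI 1) * a (scalarI (m * n)) = a (scalarI m) * a (scalarI n))"
proof -
  note \<chi> = \<open>dirichlet_character N \<chi>'\<close> and F = \<open>siegel_modular_form k N \<chi>' F\<close>
  define C where "C = coeff_ext a"
  define \<sigma> where "\<sigma> = \<chi>' (- 1) * (- 1) ^ k"
  define x where "x = (\<lambda>p. \<chi>' (int p) * of_nat p powi (int k - 2))"
  have L: "lattice_series 2 F C"
    unfolding C_def lattice_series_def using fourier_series_fourier_expansion [OF assms(5)] coeff_ext_lat by blast
  have supp: "\<And>T. C T \<noteq> 0 \<Longrightarrow> T \<in> half_integral_psd"
    by (auto simp: C_def coeff_ext_def split: if_splits)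
  have aC: "T \<in> half_integral_psd \<Longrightarrow> a T = C T" for T
    by (simp add: C_def coeff_ext_def)
  have aI: "a (scalarI n) = C (mat (real n))" for n
    unfolding scalarI_def by (rule aC) (rule scalar_half_integral)
  have \<sigma>C: "C (transpose (imk2 v1 v2 v3 v4) ** T ** imk2 v1 v2 v3 v4) = \<sigma> * C T" if "v1 * v4 - v2 * v3 = - 1" for v1 v2 v3 v4 T
    using coefficient_GL2 [OF F L that] by (simp add: \<sigma>_def)
  have C1: "C (transpose (imk2 v1 v2 v3 v4) ** T ** imk2 v1 v2 v3 v4) = C T" if "v1 * v4 - v2 * v3 = 1" for v1 v2 v3 v4 T
    using coefficient_GL2 [OF F L that] by (simp add: dirichlet_character_one [OF \<chi>])
  have relT: "lam * C (mat (real n)) = C (mat (real (p * n))) + x p * line_sum C p (real n / real p) +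
      of_nat p * x p ^ 2 * C (mat (real n / real p))"
    if "prime p" "has_eigenvalue (hecke_T k N \<chi>' p) F lam" for p lam n
    unfolding x_def by (rule hecke_T_coefficient [OF F \<chi> assms(1,2) that(1) L that(2)])
  have relT1: "lam1 * C (mat (real n)) = line_sum C p (real n) +
      x p * (of_nat (card (isotropic_lines p n)) * C (mat (real n))) + of_nat p * x p ^ 2 * line_sum C p (real n / real p ^ 2)"
    if "prime p" "has_eigenvalue (hecke_T1_tilde k N \<chi>' p) F lam1" "x p \<noteq> 0" for p lam1 n
  proof -
    have "\<not> p dvd N"
      using that character_level_zero [OF \<chi> that(1)] by (auto simp: x_def)
    then show ?thesis
      unfolding x_def by (rule hecke_T1_coefficient [OF F \<chi> assms(1,2) that(1) _ L that(2)])
  qed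
  show ?thesis
  proof (cases "\<sigma> = 1")
    case False
    \<comment> \<open>The reflection \<open>diag(1, -1)\<close> fixes every scalar matrix, so the
      coefficient there equals \<open>\<sigma>\<close> times itself. Every term of every claim
      contains such a coefficient.\<close>
    have "C (mat (real n)) = \<sigma> * C (mat (real n))" for n
      using \<sigma>C [of 1 "-1" 0 0 "mat (real n)"] by (simp add: imk2_def mk2_simps mat_mk2)
    then have "C (mat (real n)) = 0" for n using False by (metis mult_cancel_right1)
    then have "a (scalarI n) = 0" for n by (simp only: aI)
    then show ?thesis by simp
  next
    case \<sigma>: True
    have inv: "GL2_invariant C"
      unfolding GL2_invariant_def using C1 \<sigma>C \<sigma> by (auto simp: power2_eq_1_iff)
    have eps: "eps k \<chi>' = 2" using \<sigma> by (simp add: eps_def \<sigma>_def)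
    have eta: "eta k \<chi>' p = alphaI p" for p
      using \<sigma> by (simp add: eta_def alphaI_def \<sigma>_def)
    have \<chi>2: "\<chi>' (int (p ^ 2)) * of_nat p powi (2 * int k - 4) = x p ^ 2"
      "\<chi>' (int (p ^ 2)) * of_nat p powi (2 * int k - 3) = of_nat p * x p ^ 2" if "prime p" for p
    proof -
      have nz: "(of_nat p :: complex) \<noteq> 0" using that by auto
      have "(of_nat p :: complex) powi (2 * int k - 4) = (of_nat p powi (int k - 2)) ^ 2"
      proof -
        have "2 * int k - 4 = (int k - 2) + (int k - 2)" by simp
        then show ?thesis by (simp only: power_int_add nz power2_eq_square simp_thms)
      qed
      moreover have "(of_nat p :: complex) powi (2 * int k - 3) = of_nat p * of_nat p powi (2 * int k - 4)"
        using power_int_add_1' [of "of_nat p :: complex" "2 * int k - 4"] nz by simp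
      moreover have "\<chi>' (int (p ^ 2)) = \<chi>' (int p) ^ 2"
        by (simp add: dirichlet_character_power [OF \<chi>])
      ultimately show "\<chi>' (int (p ^ 2)) * of_nat p powi (2 * int k - 4) = x p ^ 2"
        "\<chi>' (int (p ^ 2)) * of_nat p powi (2 * int k - 3) = of_nat p * x p ^ 2"
        by (simp_all add: x_def power_mult_distrib)
    qed
    have prime_power: "\<exists>c. \<forall>l. \<not> p dvd l \<longrightarrow> C (mat (real (p ^ e * l))) = c * C (mat (real l))"
      if "prime p" "has_eigenvalue (hecke_T k N \<chi>' p) F lam" "has_eigenvalue (hecke_T1_tilde k N \<chi>' p) F lam1" for p lam lam1 e
      by (rule coefficient_prime_power [OF inv supp that(1) relT [OF that(1,2)] relT1 [OF that(1,3)]])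
    have partA1: "lam * C (mat (real m)) = C (mat (real (p * m))) + x p * (alphaI p * C (mat (real m)))"
      if "prime p" "has_eigenvalue (hecke_T k N \<chi>' p) F lam" "\<not> p dvd m" for p lam m
      by (rule hecke_T_relation_unit [OF inv supp that(1,3) relT [OF that(1,2)]])
    have rec: "lam * C (mat (real (p * n))) = C (mat (real (p * (p * n)))) + x p * line_sum C p (real n) + of_nat p * x p ^ 2 * C (mat (real n))"
      if "prime p" "has_eigenvalue (hecke_T k N \<chi>' p) F lam" for p lam n
      by (rule hecke_T_relation_multiple [OF that(1) relT [OF that]])
    have partA2: "x p * lam1 * C (mat (real m)) = x p ^ 2 * (alphaI p - of_nat p) * C (mat (real m)) + lam * C (mat (real (p * m))) - C (mat (real (p * (p * m))))"
      if "prime p" "has_eigenvalue (hecke_T k N \<chi>' p) F lam" "has_eigenvalue (hecke_T1_tilde k N \<chi>' p) F lam1" "\<not> p dvd m" for p lam lam1 m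
    proof (cases "x p = 0")
      \<comment> \<open>With \<open>x p = 0\<close> the second eigenvalue drops out of the claim,
        which becomes the recursion of \<open>T(p)\<close>.\<close>
      case True
      then show ?thesis using rec [OF that(1,2), of m] by simp
    next
      case False
      have "of_nat (card (isotropic_lines p m)) = alphaI p"
        using that(4) by (simp add: isotropic_lines_not_dvd [OF that(1)] card_image flip: card_roots_minus_one [OF that(1)])
      then have "lam1 * C (mat (real m)) = line_sum C p (real m) + x p * (alphaI p * C (mat (real m)))"
        using relT1 [OF that(1,3) False, of m] line_sum_div_p2 [OF supp that(1,4)] by simp
      then have "x p * (lam1 * C (mat (real m))) = x p * line_sum C p (real m) + x p * (x p * (alphaI p * C (mat (real m))))"
        by (simp add: distrib_left)
      then show ?thesis using rec [OF that(1,2), of m] by (simp add: power2_eq_square algebra_simps)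
    qed
    show ?thesis
    proof (intro conjI allI impI)
      fix p lam lam1 m
      assume p: "prime p" and T: "has_eigenvalue (hecke_T k N \<chi>' p) F lam"
        and T1: "has_eigenvalue (hecke_T1_tilde k N \<chi>' p) F lam1" and m: "0 < m" "\<not> p dvd m"
      show "lam * a (scalarI m) = \<chi>' (int p) * of_nat p powi (int k - 2) * eta k \<chi>' p * a (scalarI m) + a (scalarI (m * p))"
        using partA1 [OF p T m(2)] by (simp add: aI eta x_def mult_ac)
      show "\<chi>' (int p) * of_nat p powi (int k - 2) * lam1 * a (scalarI m) =
            \<chi>' (int (p^2)) * of_nat p powi (2 * int k - 4) * (alphaI p - of_nat p) * a (scalarI m)
              + lam * a (scalarI (p * m)) - a (scalarI (p^2 * m))"
      proof -
        have xp: "\<chi>' (int p) * of_nat p powi (int k - 2) = x p" by (simp add: x_def)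
        have e: "p ^ 2 * m = p * (p * m)" by (simp add: power2_eq_square)
        show ?thesis unfolding aI \<chi>2 [OF p] xp e by (rule partA2 [OF p T T1 m(2)])
      qed
    next
      fix p lam lam1 m l r
      assume p: "prime p" and T: "has_eigenvalue (hecke_T k N \<chi>' p) F lam"
        and m: "\<not> p dvd m" and r: "1 \<le> (r::nat)"
      obtain s where s: "r = Suc s" using r by (cases r) auto
      define n where "n = p ^ s * l"
      define D where "D = C (mk2 (real n) 0 0 (real (p ^ 2 * n)))"
      define S where "S = (\<Sum>u | 1 \<le> u \<and> real u < real p / 2 \<and> \<not> [(int u)^2 = -1] (mod int p).
         C (real n *\<^sub>R imk2 (1 + (int u)^2) (int p * int u) (int p * int u) (int p ^ 2)))"
      \<comment> \<open>\<open>a\<close> may take any value outside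
        \<open>half_integral_psd\<close>, so the index must be recognised as half-integral and
        semi-definite before \<open>a\<close> is replaced by \<open>C\<close>. Here and in
        \<open>aS\<close> it is \<open>n\<close> times a Gram matrix.\<close>
      have aD: "a (mk2 (real (p^(r-1) * l)) 0 0 (real (p^(r+1) * l))) = D"
      proof -
        have "mk2 (real n) 0 0 (real (p ^ 2 * n)) \<in> half_integral_psd"
          using gram_half_integral [of n 1 0 0 "int p"] by (simp add: imk2_def mk2_simps power2_eq_square mult_ac)
        moreover have "p^(r-1) * l = n" "p^(r+1) * l = p ^ 2 * n" by (simp_all add: s n_def power2_eq_square)
        ultimately show ?thesis by (simp only: aC D_def)
      qed
      have aS: "a (real (p^r * l) *\<^sub>R mk2 ((1 + (real u)^2) / real p) (real u) (real u) (real p)) =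
         C (real n *\<^sub>R imk2 (1 + (int u)^2) (int p * int u) (int p * int u) (int p ^ 2))" for u
      proof -
        have "real (p^r * l) = real p * real n" by (simp add: s n_def)
        then have "real (p^r * l) *\<^sub>R mk2 ((1 + (real u)^2) / real p) (real u) (real u) (real p) =
           real n *\<^sub>R imk2 (1 + (int u)^2) (int p * int u) (int p * int u) (int p ^ 2)"
          using p by (simp add: imk2_def mk2_simps power2_eq_square prime_gt_0_nat)
        moreover have "imk2 (1 + (int u)^2) (int p * int u) (int p * int u) (int p ^ 2) = transpose (imk2 1 0 (int u) (int p)) ** imk2 1 0 (int u) (int p)"
          by (simp add: imk2_simps power2_eq_square mult.commute)
        ultimately show ?thesis using aC gram_half_integral by metis
      qed
      have W: "line_sum C p (real n) = alphaI p * C (mat (real (p * n))) + 2 * D + 2 * S"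
        unfolding D_def S_def by (rule line_sum_at_multiple [OF inv p])
      have e: "p^(r+1) * l = p * (p * n)" "p ^ r * l = p * n" "p^(r-1) * l = n" by (simp_all add: s n_def)
      have "C (mat (real m)) * C (mat (real (p * (p * n)))) =
          C (mat (real m)) * (lam * C (mat (real (p * n))) - x p * line_sum C p (real n) - of_nat p * x p ^ 2 * C (mat (real n)))"
        using rec [OF p T, of n] by (simp add: algebra_simps)
      also have "\<dots> = (lam * C (mat (real m))) * C (mat (real (p * n))) - C (mat (real m)) * x p * (alphaI p * C (mat (real (p * n))) + 2 * D + 2 * S)
          - of_nat p * x p ^ 2 * C (mat (real m)) * C (mat (real n))"
        unfolding W by (simp add: algebra_simps)
      \<comment> \<open>The relation at \<open>m\<close> replaces \<open>lam\<close> times the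
        coefficient; its term with \<open>alphaI p\<close> cancels the one from
        \<open>W\<close>.\<close>
      also have "\<dots> = C (mat (real (p * m))) * C (mat (real (p * n))) - of_nat p * x p ^ 2 * C (mat (real m)) * C (mat (real n))
          - 2 * x p * C (mat (real m)) * D - 2 * x p * C (mat (real m)) * S"
        unfolding partA1 [OF p T m] by (simp add: algebra_simps)
      finally have main: "C (mat (real m)) * C (mat (real (p * (p * n)))) = C (mat (real (p * m))) * C (mat (real (p * n)))
          - of_nat p * x p ^ 2 * C (mat (real m)) * C (mat (real n)) - 2 * x p * C (mat (real m)) * D - 2 * x p * C (mat (real m)) * S" .
      show "a (scalarI m) * a (scalarI (p^(r+1) * l)) =
            a (scalarI (p * m)) * a (scalarI (p^r * l))
            - \<chi>' (int (p^2)) * of_nat p powi (2 * int k - 3) * a (scalarI m) * a (scalarI (p^(r-1) * l))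
            - eps k \<chi>' * \<chi>' (int p) * of_nat p powi (int k - 2) * a (scalarI m)
                * a (mk2 (real (p^(r-1) * l)) 0 0 (real (p^(r+1) * l)))
            - eps k \<chi>' * \<chi>' (int p) * of_nat p powi (int k - 2) * a (scalarI m)
                * (\<Sum>u | 1 \<le> u \<and> real u < real p / 2 \<and> \<not> [(int u)^2 = -1] (mod int p).
                     a (real (p^r * l) *\<^sub>R mk2 ((1 + (real u)^2) / real p) (real u) (real u) (real p)))"
        unfolding aD aS aI eps \<chi>2 [OF p] S_def [symmetric]
        unfolding e main unfolding x_def by (simp only: mult.assoc)
    next
      fix n m :: nat
      assume n: "0 < n" and ev: "\<forall>p. prime p \<longrightarrow> p dvd n \<longrightarrow>
           (\<exists>lam. has_eigenvalue (hecke_T k N \<chi>' p) F lam) \<and>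
           (\<exists>lam1. has_eigenvalue (hecke_T1_tilde k N \<chi>' p) F lam1)" and m: "coprime m n"
      have "\<exists>c. \<forall>m. coprime m n \<longrightarrow> C (mat (real (m * n))) = c * C (mat (real m))"
        by (rule coefficient_coprime [OF _ n]) (use ev prime_power in blast)
      then obtain c where c: "\<And>m. coprime m n \<Longrightarrow> C (mat (real (m * n))) = c * C (mat (real m))" by blast
      show "a (scalarI (m * n)) = 0" if "a (scalarI m) = 0"
        using that c [OF m] by (simp add: aI)
      \<comment> \<open>The case \<open>m = 1\<close> identifies the coefficient at
        \<open>n I\<close> as \<open>c\<close> times that at \<open>I\<close>.\<close>
      show "a (scalarI 1) * a (scalarI (m * n)) = a (scalarI m) * a (scalarI n)"
        using c [OF m] c [of 1] by (simp add: aI)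
    qed
  qed
qed

end
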